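(* Let $\mathfrak g$ be a basic Lie superalgebra and $k\in\mathbb C$, $k\ne-h^\vee$. Assume that the category $KL_k^{fin}$ is semisimple and that for any irreducible $V_k(\mathfrak g)$-module $M$ in $KL_k$ we have $$\mathrm{Ext}^1(M_{top},M_{top})=\{0\}$$ in the category of finite-dimensional $\mathfrak g$-modules. Then $KL_k$ is semisimple and $KL_k^{fin}=KL_k$.
   Context: Everything is over $\mathbb C$. A basic Lie superalgebra $\mathfrak g=\mathfrak g_{\bar 0}\oplus\mathfrak g_{\bar 1}$ is a simple finite-dimensional Lie superalgebra with $\mathfrak g_{\bar 0}$ reductive admitting a nondegenerate even invariant supersymmetric bilinear form, normalized by $(\theta|\theta)=2$ for a fixed even root $\theta$ maximal among even positive roots (with $-\theta$ minimal). $h^\vee$ is half the eigenvalue on $\mathfrak g$ of the Casimir operator. $\mathfrak h$ is a Cartan subalgebra of $\mathfrak g_{\bar0}$, $\widehat{\mathfrak g}=\mathbb C[t,t^{-1}]\otimes\mathfrak g\oplus\mathbb CK\oplus\mathbb Cd$, $\widehat{\mathfrak h}=\mathfrak h\oplus\mathbb CK\oplus\mathbb Cd$. $V_k(\mathfrak g)$ is the simple affine vertex algebra of level $k$, $L_{\mathfrak g}$ its Sugawara vector; $d$ acts on weak modules as $-L_{\mathfrak g}(0)$. $KL_k$ is the category of weak $V_k(\mathfrak g)$-modules which are locally finite as $\mathfrak g$-modules and decompose into generalized eigenspaces for $L_{\mathfrak g}(0)$ with eigenvalues bounded below; $KL_k^{fin}$ is the full subcategory of modules on which $\widehat{\mathfrak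 h}$ acts semisimply. Semisimple means every object is a direct sum of irreducibles. $M_{top}$ is the top component of $M$, i.e. its lowest $L_{\mathfrak g}(0)$-weight space, regarded as a $\mathfrak g$-module. *)

theory Defs
  imports Complex_Main "HOL-Library.Z2" "HOL-Library.Product_Plus" "HOL-Library.Groups_Big_Fun"
begin

section \<open>Complex superspaces\<close>

class complex_vector = ab_group_add +
  fixes scaleC :: "complex \<Rightarrow> 'a \<Rightarrow> 'a" (infixr "*\<^sub>C" 75)
  assumes scaleC_add_right: "c *\<^sub>C (x + y) = c *\<^sub>C x + c *\<^sub>C y"
    and scaleC_add_left: "(c + d) *\<^sub>C x = c *\<^sub>C x + d *\<^sub>C x"
    and scaleC_scaleC: "c *\<^sub>C (d *\<^sub>C x) = (c * d) *\<^sub>C x"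
    and scaleC_one: "1 *\<^sub>C x = x"

global_interpretation cvec: vector_space "scaleC :: complex \<Rightarrow> 'a \<Rightarrow> 'a::complex_vector"
  by unfold_locales (rule scaleC_add_right scaleC_add_left scaleC_scaleC scaleC_one)+

instantiation prod :: (complex_vector, complex_vector) complex_vector
begin

definition scaleC_prod :: "complex \<Rightarrow> 'a \<times> 'b \<Rightarrow> 'a \<times> 'b" where
  "scaleC_prod c z = (c *\<^sub>C fst z, c *\<^sub>C snd z)"

instance
  by standard
    (simp_all add: scaleC_prod_def scaleC_add_right scaleC_add_left scaleC_scaleC scaleC_one)

end

definition fin_dim :: "'a::complex_vector set \<Rightarrow> bool" where
  "fin_dim S \<longleftrightarrow> (\<exists>X. finite X \<and> S = cvec.span X)"

definition clinear_on :: "'a::complex_vector set \<Rightarrow> ('a \<Rightarrow> 'b::complex_vector) \<Rightarrow> bool" where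
  "clinear_on S f \<longleftrightarrow>
     (\<forall>x\<in>S. \<forall>y\<in>S. f (x + y) = f x + f y) \<and> (\<forall>c. \<forall>x\<in>S. f (c *\<^sub>C x) = c *\<^sub>C f x)"

text \<open>
  Parities are elements of the two-element field \<open>bit\<close>; a superspace is a subspace \<open>S\<close> together
  with the family \<open>G\<close> of its even part \<open>G 0\<close> and its odd part \<open>G 1\<close>.
\<close>

definition koszul :: "bit \<Rightarrow> bit \<Rightarrow> complex" where
  "koszul p q = (if p = 1 \<and> q = 1 then - 1 else 1)"

definition superspace :: "'a::complex_vector set \<Rightarrow> (bit \<Rightarrow> 'a set) \<Rightarrow> bool" where
  "superspace S G \<longleftrightarrow> cvec.subspace S \<and> cvec.subspace (G 0) \<and> cvec.subspace (G 1) \<and>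
     G 0 \<inter> G 1 = {0} \<and> S = {x + y | x y. x \<in> G 0 \<and> y \<in> G 1}"

definition graded_subspace :: "(bit \<Rightarrow> 'a::complex_vector set) \<Rightarrow> 'a set \<Rightarrow> bool" where
  "graded_subspace G N \<longleftrightarrow> superspace N (\<lambda>p. N \<inter> G p)"

definition direct_sum_of :: "'a::complex_vector set \<Rightarrow> 'a set set \<Rightarrow> bool" where
  "direct_sum_of S \<N> \<longleftrightarrow>
     S = cvec.span (\<Union>\<N>) \<and> (\<forall>N\<in>\<N>. N \<inter> cvec.span (\<Union>(\<N> - {N})) = {0})"


section \<open>Basic Lie superalgebras\<close>

record 'g lie_sa =
  br :: "'g \<Rightarrow> 'g \<Rightarrow> 'g"
  grade :: "bit \<Rightarrow> 'g set"

definition lie_superalgebra :: "'g::complex_vector lie_sa \<Rightarrow> bool" where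
  "lie_superalgebra g \<longleftrightarrow>
     superspace UNIV (grade g) \<and>
     (\<forall>x. clinear_on UNIV (br g x)) \<and> (\<forall>y. clinear_on UNIV (\<lambda>x. br g x y)) \<and>
     (\<forall>p q. \<forall>x\<in>grade g p. \<forall>y\<in>grade g q. br g x y \<in> grade g (p + q)) \<and>
     (\<forall>p q. \<forall>x\<in>grade g p. \<forall>y\<in>grade g q. br g x y = - (koszul p q *\<^sub>C br g y x)) \<and>
     (\<forall>p q. \<forall>x\<in>grade g p. \<forall>y\<in>grade g q. \<forall>z.
        br g x (br g y z) = br g (br g x y) z + koszul p q *\<^sub>C br g y (br g x z))"

definition simple_lie_sa :: "'g::complex_vector lie_sa \<Rightarrow> bool" where
  "simple_lie_sa g \<longleftrightarrow> lie_superalgebra g \<and> (\<exists>x y. br g x y \<noteq> 0) \<and>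
     (\<forall>I. graded_subspace (grade g) I \<and> (\<forall>x. \<forall>y\<in>I. br g x y \<in> I) \<longrightarrow> I = {0} \<or> I = UNIV)"

definition even_ideal :: "'g::complex_vector lie_sa \<Rightarrow> 'g set \<Rightarrow> bool" where
  "even_ideal g I \<longleftrightarrow> cvec.subspace I \<and> I \<subseteq> grade g 0 \<and> (\<forall>x\<in>grade g 0. \<forall>y\<in>I. br g x y \<in> I)"

text \<open>Reductive: the adjoint representation of the even part is completely reducible.\<close>

definition reductive_even_part :: "'g::complex_vector lie_sa \<Rightarrow> bool" where
  "reductive_even_part g \<longleftrightarrow>
     (\<forall>I. even_ideal g I \<longrightarrow>
        (\<exists>J. even_ideal g J \<and> I \<inter> J = {0} \<and> grade g 0 = {x + y | x y. x \<in> I \<and> y \<in> J}))"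

definition basic_form :: "'g::complex_vector lie_sa \<Rightarrow> ('g \<Rightarrow> 'g \<Rightarrow> complex) \<Rightarrow> bool" where
  "basic_form g B \<longleftrightarrow>
     (\<forall>x y z. B (x + y) z = B x z + B y z \<and> B z (x + y) = B z x + B z y) \<and>
     (\<forall>c x y. B (c *\<^sub>C x) y = c * B x y \<and> B x (c *\<^sub>C y) = c * B x y) \<and>
     (\<forall>x. (\<forall>y. B x y = 0) \<longrightarrow> x = 0) \<and>
     (\<forall>x\<in>grade g 0. \<forall>y\<in>grade g 1. B x y = 0 \<and> B y x = 0) \<and>
     (\<forall>p q. \<forall>x\<in>grade g p. \<forall>y\<in>grade g q. B x y = koszul p q * B y x) \<and>
     (\<forall>x y z. B (br g x y) z = B x (br g y z))"

definition basic_lie_superalgebra :: "'g::complex_vector lie_sa \<Rightarrow> bool" where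
  "basic_lie_superalgebra g \<longleftrightarrow>
     simple_lie_sa g \<and> fin_dim (UNIV :: 'g set) \<and> reductive_even_part g \<and> (\<exists>B. basic_form g B)"

text \<open>
  As usual for a reductive Lie algebra, a Cartan subalgebra is a maximal toral subalgebra:
  abelian and (simultaneously) diagonalizable on \<open>g\<close>.
\<close>

definition root_space :: "'g::complex_vector lie_sa \<Rightarrow> 'g set \<Rightarrow> ('g \<Rightarrow> complex) \<Rightarrow> 'g set" where
  "root_space g \<hh> \<alpha> = {x. \<forall>h\<in>\<hh>. br g h x = \<alpha> h *\<^sub>C x}"

definition toral :: "'g::complex_vector lie_sa \<Rightarrow> 'g set \<Rightarrow> bool" where
  "toral g \<hh> \<longleftrightarrow> cvec.subspace \<hh> \<and> \<hh> \<subseteq> grade g 0 \<and> (\<forall>x\<in>\<hh>. \<forall>y\<in>\<hh>. br g x y = 0) \<and>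
     cvec.span (\<Union>\<alpha>. root_space g \<hh> \<alpha>) = UNIV"

definition cartan_subalgebra :: "'g::complex_vector lie_sa \<Rightarrow> 'g set \<Rightarrow> bool" where
  "cartan_subalgebra g \<hh> \<longleftrightarrow> toral g \<hh> \<and> (\<forall>\<tt>. toral g \<tt> \<and> \<hh> \<subseteq> \<tt> \<longrightarrow> \<tt> = \<hh>)"

text \<open>
  A linear functional on \<open>\<hh>\<close> is represented by the function on \<open>g\<close> that extends it by \<open>0\<close> off \<open>\<hh>\<close>.
\<close>

definition dual_space :: "'g::complex_vector set \<Rightarrow> ('g \<Rightarrow> complex) set" where
  "dual_space \<hh> = {\<alpha>. (\<forall>x\<in>\<hh>. \<forall>y\<in>\<hh>. \<alpha> (x + y) = \<alpha> x + \<alpha> y) \<and>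
     (\<forall>c. \<forall>x\<in>\<hh>. \<alpha> (c *\<^sub>C x) = c * \<alpha> x) \<and> (\<forall>x. x \<notin> \<hh> \<longrightarrow> \<alpha> x = 0)}"

definition roots :: "'g::complex_vector lie_sa \<Rightarrow> 'g set \<Rightarrow> ('g \<Rightarrow> complex) set" where
  "roots g \<hh> = {\<alpha> \<in> dual_space \<hh>. \<alpha> \<noteq> (\<lambda>_. 0) \<and> root_space g \<hh> \<alpha> \<noteq> {0}}"

definition even_roots :: "'g::complex_vector lie_sa \<Rightarrow> 'g set \<Rightarrow> ('g \<Rightarrow> complex) set" where
  "even_roots g \<hh> = {\<alpha> \<in> roots g \<hh>. root_space g \<hh> \<alpha> \<inter> grade g 0 \<noteq> {0}}"

definition additive_function :: "(('g \<Rightarrow> complex) \<Rightarrow> real) \<Rightarrow> bool" where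
  "additive_function \<phi> \<longleftrightarrow> (\<forall>\<alpha> \<beta>. \<phi> (\<lambda>x. \<alpha> x + \<beta> x) = \<phi> \<alpha> + \<phi> \<beta>)"

definition positive_system ::
  "'g::complex_vector lie_sa \<Rightarrow> 'g set \<Rightarrow> ('g \<Rightarrow> complex) set \<Rightarrow> bool" where
  "positive_system g \<hh> P \<longleftrightarrow>
     (\<exists>\<phi>. additive_function \<phi> \<and> (\<forall>\<alpha>\<in>roots g \<hh>. \<phi> \<alpha> \<noteq> 0) \<and> P = {\<alpha>\<in>roots g \<hh>. 0 < \<phi> \<alpha>})"

definition root_le ::
  "('g \<Rightarrow> complex) set \<Rightarrow> ('g \<Rightarrow> complex) \<Rightarrow> ('g \<Rightarrow> complex) \<Rightarrow> bool" where
  "root_le P \<alpha> \<beta> \<longleftrightarrow>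
     (\<exists>c :: ('g \<Rightarrow> complex) \<Rightarrow> nat. \<forall>x. \<beta> x - \<alpha> x = (\<Sum>\<gamma>\<in>P. of_nat (c \<gamma>) * \<gamma> x))"

text \<open>
  A minimal root in the sense of Kac and Wakimoto; this is a condition relative to all roots, odd
  ones included.
\<close>

definition minimal_root :: "'g::complex_vector lie_sa \<Rightarrow> 'g set \<Rightarrow> ('g \<Rightarrow> complex) \<Rightarrow> bool" where
  "minimal_root g \<hh> \<eta> \<longleftrightarrow> \<eta> \<in> even_roots g \<hh> \<and>
     (\<exists>\<phi>. additive_function \<phi> \<and> (\<exists>\<alpha>\<in>roots g \<hh>. \<phi> \<alpha> \<noteq> 0) \<and>
        (\<forall>\<alpha>\<in>roots g \<hh> - {\<eta>}. \<phi> \<eta> < \<phi> \<alpha>))"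

definition maximal_even_root ::
  "'g::complex_vector lie_sa \<Rightarrow> 'g set \<Rightarrow> ('g \<Rightarrow> complex) set \<Rightarrow> ('g \<Rightarrow> complex) \<Rightarrow> bool" where
  "maximal_even_root g \<hh> P \<theta> \<longleftrightarrow> \<theta> \<in> P \<inter> even_roots g \<hh> \<and>
     (\<forall>\<beta>\<in>P \<inter> even_roots g \<hh>. root_le P \<theta> \<beta> \<longrightarrow> \<beta> = \<theta>) \<and>
     minimal_root g \<hh> (\<lambda>x. - \<theta> x)"

text \<open>The form induced on the dual of \<open>\<hh>\<close> by the restriction of \<open>B\<close> to \<open>\<hh>\<close>.\<close>

definition dual_form ::
  "('g \<Rightarrow> 'g \<Rightarrow> complex) \<Rightarrow> 'g set \<Rightarrow> ('g \<Rightarrow> complex) \<Rightarrow> ('g \<Rightarrow> complex) \<Rightarrow> complex" where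
  "dual_form B \<hh> \<alpha> \<beta> =
     (let t = (\<lambda>\<gamma>. THE t. t \<in> \<hh> \<and> (\<forall>h\<in>\<hh>. B t h = \<gamma> h)) in B (t \<alpha>) (t \<beta>))"


section \<open>Casimir operator and dual Coxeter number\<close>

definition homogeneous_basis :: "'g::complex_vector lie_sa \<Rightarrow> 'g set \<Rightarrow> bool" where
  "homogeneous_basis g S \<longleftrightarrow>
     \<not> cvec.dependent S \<and> cvec.span S = UNIV \<and> S \<subseteq> grade g 0 \<union> grade g 1"

text \<open>
  With \<open>x\<^sup>*\<close> denoting the dual basis normalized by \<open>(x | y\<^sup>*) = \<delta>\<close>, the element
  \<open>\<Sum> x\<^sup>* \<otimes> x\<close> (in this order, without signs) is the invariant one in the super setting;
  it does not depend on the basis.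
\<close>

definition some_basis :: "'g::complex_vector lie_sa \<Rightarrow> 'g set" where
  "some_basis g = (SOME S. homogeneous_basis g S)"

definition dual_vector :: "'g::complex_vector lie_sa \<Rightarrow> ('g \<Rightarrow> 'g \<Rightarrow> complex) \<Rightarrow> 'g \<Rightarrow> 'g" where
  "dual_vector g B y = (THE z. \<forall>x\<in>some_basis g. B x z = (if x = y then 1 else 0))"

definition casimir_adj :: "'g::complex_vector lie_sa \<Rightarrow> ('g \<Rightarrow> 'g \<Rightarrow> complex) \<Rightarrow> 'g \<Rightarrow> 'g" where
  "casimir_adj g B y = (\<Sum>x\<in>some_basis g. br g (dual_vector g B x) (br g x y))"

definition dual_coxeter :: "'g::complex_vector lie_sa \<Rightarrow> ('g \<Rightarrow> 'g \<Rightarrow> complex) \<Rightarrow> complex" where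
  "dual_coxeter g B = (THE c. \<forall>y. casimir_adj g B y = (2 * c) *\<^sub>C y)"


section \<open>Vertex superalgebras and weak modules\<close>

record 'v vertex_sa =
  vgrade :: "bit \<Rightarrow> 'v set"
  vac :: "'v"
  nprod :: "'v \<Rightarrow> int \<Rightarrow> 'v \<Rightarrow> 'v"

text \<open>
  The Borcherds identity for \<open>a\<close>, \<open>b\<close> of parities \<open>p\<close>, \<open>q\<close>. All sums have finite support by the
  truncation axioms.
\<close>

definition borcherds_identity ::
  "('v \<Rightarrow> int \<Rightarrow> 'v \<Rightarrow> 'v) \<Rightarrow> ('v \<Rightarrow> int \<Rightarrow> 'm \<Rightarrow> 'm::complex_vector) \<Rightarrow>
    bit \<Rightarrow> bit \<Rightarrow> 'v \<Rightarrow> 'v \<Rightarrow> 'm \<Rightarrow> bool" where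
  "borcherds_identity pr act p q a b c \<longleftrightarrow> (\<forall>l m n :: int.
     Sum_any (\<lambda>j::nat. (of_int m gchoose j) *\<^sub>C act (pr a (n + int j) b) (m + l - int j) c) =
     Sum_any (\<lambda>j::nat. ((- 1) ^ j * (of_int n gchoose j)) *\<^sub>C
       (act a (m + n - int j) (act b (l + int j) c) -
        (koszul p q * (- 1) powi n) *\<^sub>C act b (n + l - int j) (act a (m + int j) c))))"

definition vertex_superalgebra :: "'v::complex_vector vertex_sa \<Rightarrow> bool" where
  "vertex_superalgebra V \<longleftrightarrow>
     superspace UNIV (vgrade V) \<and> vac V \<in> vgrade V 0 \<and>
     (\<forall>n a. clinear_on UNIV (nprod V a n)) \<and> (\<forall>n b. clinear_on UNIV (\<lambda>a. nprod V a n b)) \<and>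
     (\<forall>p q n. \<forall>a\<in>vgrade V p. \<forall>b\<in>vgrade V q. nprod V a n b \<in> vgrade V (p + q)) \<and>
     (\<forall>a b. \<exists>N. \<forall>n\<ge>N. nprod V a n b = 0) \<and>
     (\<forall>n a. nprod V (vac V) n a = (if n = - 1 then a else 0)) \<and>
     (\<forall>a. nprod V a (- 1) (vac V) = a) \<and> (\<forall>a. \<forall>n\<ge>0. nprod V a n (vac V) = 0) \<and>
     (\<forall>p q. \<forall>a\<in>vgrade V p. \<forall>b\<in>vgrade V q. \<forall>c.
        borcherds_identity (nprod V) (nprod V) p q a b c)"

definition simple_vertex_sa :: "'v::complex_vector vertex_sa \<Rightarrow> bool" where
  "simple_vertex_sa V \<longleftrightarrow> vertex_superalgebra V \<and> vac V \<noteq> 0 \<and>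
     (\<forall>I. graded_subspace (vgrade V) I \<and>
          (\<forall>a n. \<forall>b\<in>I. nprod V a n b \<in> I \<and> nprod V b n a \<in> I) \<longrightarrow> I = {0} \<or> I = UNIV)"

definition generated_by :: "'v::complex_vector vertex_sa \<Rightarrow> 'v set \<Rightarrow> bool" where
  "generated_by V X \<longleftrightarrow>
     (\<forall>W. cvec.subspace W \<and> vac V \<in> W \<and> (\<forall>n. \<forall>a\<in>W. \<forall>b\<in>W. nprod V a n b \<in> W) \<and> X \<subseteq> W \<longrightarrow>
       W = UNIV)"

text \<open>
  \<open>V\<close>, with the even map \<open>\<iota>\<close> from \<open>g\<close> to \<open>V\<close>, is the simple affine vertex algebra of level \<open>k\<close>:
  it is simple and generated by currents satisfying the affine operator product expansions of
  level \<open>k\<close>, i.e. it is the simple quotient of the universal affine vertex algebra of level \<open>k\<close>.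
  This determines \<open>(V, \<iota>)\<close> up to isomorphism. For \<open>k = 0\<close> the map \<open>\<iota>\<close> is zero, so injectivity
  must not be required.
\<close>

definition simple_affine_vertex_algebra ::
  "'g::complex_vector lie_sa \<Rightarrow> ('g \<Rightarrow> 'g \<Rightarrow> complex) \<Rightarrow> complex \<Rightarrow>
    'v::complex_vector vertex_sa \<Rightarrow> ('g \<Rightarrow> 'v) \<Rightarrow> bool" where
  "simple_affine_vertex_algebra g B k V \<iota> \<longleftrightarrow>
     simple_vertex_sa V \<and> clinear_on UNIV \<iota> \<and> (\<forall>p. \<iota> ` grade g p \<subseteq> vgrade V p) \<and>
     (\<forall>x y. nprod V (\<iota> x) 0 (\<iota> y) = \<iota> (br g x y)) \<and>
     (\<forall>x y. nprod V (\<iota> x) 1 (\<iota> y) = (k * B x y) *\<^sub>C vac V) \<and>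
     (\<forall>x y. \<forall>n\<ge>2. nprod V (\<iota> x) n (\<iota> y) = 0) \<and>
     generated_by V (range \<iota>)"

definition sugawara ::
  "'g::complex_vector lie_sa \<Rightarrow> ('g \<Rightarrow> 'g \<Rightarrow> complex) \<Rightarrow> complex \<Rightarrow>
    'v::complex_vector vertex_sa \<Rightarrow> ('g \<Rightarrow> 'v) \<Rightarrow> 'v" where
  "sugawara g B k V \<iota> = (1 / (2 * (k + dual_coxeter g B))) *\<^sub>C
     (\<Sum>x\<in>some_basis g. nprod V (\<iota> (dual_vector g B x)) (- 1) (\<iota> x))"

text \<open>
  Modules are carried by subspaces of a vector space \<open>'m\<close>, which serves as the universe in which
  the categories below are formed; the operations are irrelevant outside the carrier.
  \<open>act M a n\<close> is the coefficient of \<open>z\<^bsup>-n-1\<^esup>\<close> in the field of \<open>a\<close>.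
\<close>

record ('v, 'm) vmod =
  carrier :: "'m set"
  mgrade :: "bit \<Rightarrow> 'm set"
  act :: "'v \<Rightarrow> int \<Rightarrow> 'm \<Rightarrow> 'm"

definition weak_module ::
  "'v::complex_vector vertex_sa \<Rightarrow> ('v, 'm::complex_vector) vmod \<Rightarrow> bool" where
  "weak_module V M \<longleftrightarrow>
     superspace (carrier M) (mgrade M) \<and>
     (\<forall>n a. clinear_on (carrier M) (act M a n)) \<and>
     (\<forall>n. \<forall>w\<in>carrier M. clinear_on UNIV (\<lambda>a. act M a n w)) \<and>
     (\<forall>p q n. \<forall>a\<in>vgrade V p. \<forall>w\<in>mgrade M q. act M a n w \<in> mgrade M (p + q)) \<and>
     (\<forall>a. \<forall>w\<in>carrier M. \<exists>N. \<forall>n\<ge>N. act M a n w = 0) \<and>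
     (\<forall>n. \<forall>w\<in>carrier M. act M (vac V) n w = (if n = - 1 then w else 0)) \<and>
     (\<forall>p q. \<forall>a\<in>vgrade V p. \<forall>b\<in>vgrade V q. \<forall>w\<in>carrier M.
        borcherds_identity (nprod V) (act M) p q a b w)"

definition submodule :: "('v, 'm::complex_vector) vmod \<Rightarrow> 'm set \<Rightarrow> bool" where
  "submodule M N \<longleftrightarrow> graded_subspace (mgrade M) N \<and> N \<subseteq> carrier M \<and>
     (\<forall>a n. \<forall>w\<in>N. act M a n w \<in> N)"

definition restrict_mod :: "('v, 'm::complex_vector) vmod \<Rightarrow> 'm set \<Rightarrow> ('v, 'm) vmod" where
  "restrict_mod M N = \<lparr> carrier = N, mgrade = (\<lambda>p. N \<inter> mgrade M p), act = act M \<rparr>"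

definition irreducible_mod :: "('v, 'm::complex_vector) vmod \<Rightarrow> bool" where
  "irreducible_mod M \<longleftrightarrow>
     carrier M \<noteq> {0} \<and> (\<forall>N. submodule M N \<longrightarrow> N = {0} \<or> N = carrier M)"

definition semisimple_category :: "('v, 'm::complex_vector) vmod set \<Rightarrow> bool" where
  "semisimple_category \<C> \<longleftrightarrow> (\<forall>M\<in>\<C>. \<exists>\<N>.
     (\<forall>N\<in>\<N>. submodule M N \<and> irreducible_mod (restrict_mod M N)) \<and>
     direct_sum_of (carrier M) \<N>)"


section \<open>Modules over the Lie superalgebra, extensions\<close>

record ('g, 'm) gmod =
  gcarrier :: "'m set"
  ggrade :: "bit \<Rightarrow> 'm set"
  gact :: "'g \<Rightarrow> 'm \<Rightarrow> 'm"

definition lie_module ::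
  "'g::complex_vector lie_sa \<Rightarrow> ('g, 'm::complex_vector) gmod \<Rightarrow> bool" where
  "lie_module g A \<longleftrightarrow>
     superspace (gcarrier A) (ggrade A) \<and>
     (\<forall>x. clinear_on (gcarrier A) (gact A x)) \<and>
     (\<forall>w\<in>gcarrier A. clinear_on UNIV (\<lambda>x. gact A x w)) \<and>
     (\<forall>p q. \<forall>x\<in>grade g p. \<forall>w\<in>ggrade A q. gact A x w \<in> ggrade A (p + q)) \<and>
     (\<forall>p q. \<forall>x\<in>grade g p. \<forall>y\<in>grade g q. \<forall>w\<in>gcarrier A.
        gact A (br g x y) w = gact A x (gact A y w) - koszul p q *\<^sub>C gact A y (gact A x w))"

definition gsubmodule :: "('g, 'm::complex_vector) gmod \<Rightarrow> 'm set \<Rightarrow> bool" where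
  "gsubmodule A N \<longleftrightarrow> graded_subspace (ggrade A) N \<and> N \<subseteq> gcarrier A \<and>
     (\<forall>x. \<forall>w\<in>N. gact A x w \<in> N)"

definition locally_finite :: "('g, 'm::complex_vector) gmod \<Rightarrow> bool" where
  "locally_finite A \<longleftrightarrow> (\<forall>w\<in>gcarrier A. \<exists>N. gsubmodule A N \<and> fin_dim N \<and> w \<in> N)"

definition fin_dim_module ::
  "'g::complex_vector lie_sa \<Rightarrow> ('g, 'm::complex_vector) gmod \<Rightarrow> bool" where
  "fin_dim_module g A \<longleftrightarrow> lie_module g A \<and> fin_dim (gcarrier A)"

definition gmod_hom ::
  "('g, 'm::complex_vector) gmod \<Rightarrow> ('g, 'n::complex_vector) gmod \<Rightarrow> ('m \<Rightarrow> 'n) \<Rightarrow> bool" where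
  "gmod_hom A C f \<longleftrightarrow> clinear_on (gcarrier A) f \<and> (\<forall>p. f ` ggrade A p \<subseteq> ggrade C p) \<and>
     (\<forall>x. \<forall>w\<in>gcarrier A. f (gact A x w) = gact C x (f w))"

text \<open>
  An extension \<open>(E, i, p)\<close> of \<open>A\<close> by \<open>C\<close> is a short exact sequence
  \<open>0 \<rightarrow> C \<rightarrow> E \<rightarrow> A \<rightarrow> 0\<close> of finite-dimensional modules. Its middle term is taken on a subspace
  of \<open>'c \<times> 'a\<close>, where every extension of \<open>A\<close> by \<open>C\<close> can be realized up to isomorphism.
\<close>

type_synonym ('g, 'a, 'c) ext_data =
  "('g, 'c \<times> 'a) gmod \<times> ('c \<Rightarrow> 'c \<times> 'a) \<times> ('c \<times> 'a \<Rightarrow> 'a)"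

definition extensions ::
  "'g::complex_vector lie_sa \<Rightarrow> ('g, 'a::complex_vector) gmod \<Rightarrow>
    ('g, 'c::complex_vector) gmod \<Rightarrow> ('g, 'a, 'c) ext_data set" where
  "extensions g A C = {(E, i, p).
     fin_dim_module g A \<and> fin_dim_module g C \<and> fin_dim_module g E \<and>
     gmod_hom C E i \<and> gmod_hom E A p \<and>
     inj_on i (gcarrier C) \<and> p ` gcarrier E = gcarrier A \<and>
     i ` gcarrier C = {w \<in> gcarrier E. p w = 0}}"

definition ext_equiv ::
  "'g::complex_vector lie_sa \<Rightarrow> ('g, 'a::complex_vector) gmod \<Rightarrow> ('g, 'c::complex_vector) gmod \<Rightarrow>
    (('g, 'a, 'c) ext_data \<times> ('g, 'a, 'c) ext_data) set" where
  "ext_equiv g A C = {((E, i, p), (E', i', p')).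
     (E, i, p) \<in> extensions g A C \<and> (E', i', p') \<in> extensions g A C \<and>
     (\<exists>f. gmod_hom E E' f \<and> bij_betw f (gcarrier E) (gcarrier E') \<and>
        (\<forall>w\<in>gcarrier C. f (i w) = i' w) \<and> (\<forall>w\<in>gcarrier E. p' (f w) = p w))}"

definition split_extension ::
  "('g, 'a::complex_vector) gmod \<Rightarrow> ('g, 'c::complex_vector) gmod \<Rightarrow> ('g, 'a, 'c) ext_data" where
  "split_extension A C =
     (\<lparr> gcarrier = gcarrier C \<times> gcarrier A, ggrade = (\<lambda>p. ggrade C p \<times> ggrade A p),
        gact = (\<lambda>x (c, a). (gact C x c, gact A x a)) \<rparr>,
      (\<lambda>c. (c, 0)), snd)"

definition Ext1 ::
  "'g::complex_vector lie_sa \<Rightarrow> ('g, 'a::complex_vector) gmod \<Rightarrow>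
    ('g, 'c::complex_vector) gmod \<Rightarrow> ('g, 'a, 'c) ext_data set set" where
  "Ext1 g A C = extensions g A C // ext_equiv g A C"

definition Ext1_zero ::
  "'g::complex_vector lie_sa \<Rightarrow> ('g, 'a::complex_vector) gmod \<Rightarrow>
    ('g, 'c::complex_vector) gmod \<Rightarrow> ('g, 'a, 'c) ext_data set" where
  "Ext1_zero g A C = ext_equiv g A C `` {split_extension A C}"


section \<open>The categories of modules\<close>

definition as_gmod :: "('g \<Rightarrow> 'v) \<Rightarrow> ('v, 'm) vmod \<Rightarrow> ('g, 'm) gmod" where
  "as_gmod \<iota> M = \<lparr> gcarrier = carrier M, ggrade = mgrade M, gact = (\<lambda>x. act M (\<iota> x) 0) \<rparr>"

definition L0 ::
  "'g::complex_vector lie_sa \<Rightarrow> ('g \<Rightarrow> 'g \<Rightarrow> complex) \<Rightarrow> complex \<Rightarrow>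
    'v::complex_vector vertex_sa \<Rightarrow> ('g \<Rightarrow> 'v) \<Rightarrow> ('v, 'm) vmod \<Rightarrow> 'm \<Rightarrow> 'm" where
  "L0 g B k V \<iota> M = act M (sugawara g B k V \<iota>) 1"

definition gen_eigenspace ::
  "'m::complex_vector set \<Rightarrow> ('m \<Rightarrow> 'm) \<Rightarrow> complex \<Rightarrow> 'm set" where
  "gen_eigenspace S T \<mu> = {w \<in> S. \<exists>n::nat. ((\<lambda>u. T u - \<mu> *\<^sub>C u) ^^ n) w = 0}"

text \<open>Complex eigenvalues are bounded below if their real parts are.\<close>

definition KL ::
  "'g::complex_vector lie_sa \<Rightarrow> ('g \<Rightarrow> 'g \<Rightarrow> complex) \<Rightarrow> complex \<Rightarrow>
    'v::complex_vector vertex_sa \<Rightarrow> ('g \<Rightarrow> 'v) \<Rightarrow> ('v, 'm::complex_vector) vmod set" where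
  "KL g B k V \<iota> = {M. weak_module V M \<and> locally_finite (as_gmod \<iota> M) \<and>
     carrier M = cvec.span (\<Union>\<mu>. gen_eigenspace (carrier M) (L0 g B k V \<iota> M) \<mu>) \<and>
     (\<exists>b::real. \<forall>\<mu>. gen_eigenspace (carrier M) (L0 g B k V \<iota> M) \<mu> \<noteq> {0} \<longrightarrow> b \<le> Re \<mu>)}"

text \<open>The triple \<open>(h, a, b)\<close> stands for the element \<open>h + a K + b d\<close> of the affine Lie superalgebra.\<close>

definition affine_cartan_act ::
  "'g::complex_vector lie_sa \<Rightarrow> ('g \<Rightarrow> 'g \<Rightarrow> complex) \<Rightarrow> complex \<Rightarrow>
    'v::complex_vector vertex_sa \<Rightarrow> ('g \<Rightarrow> 'v) \<Rightarrow> ('v, 'm::complex_vector) vmod \<Rightarrow>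
    'g \<times> complex \<times> complex \<Rightarrow> 'm \<Rightarrow> 'm" where
  "affine_cartan_act g B k V \<iota> M = (\<lambda>(h, a, b) w.
     act M (\<iota> h) 0 w + (a * k) *\<^sub>C w - b *\<^sub>C L0 g B k V \<iota> M w)"

definition KL_fin ::
  "'g::complex_vector lie_sa \<Rightarrow> 'g set \<Rightarrow> ('g \<Rightarrow> 'g \<Rightarrow> complex) \<Rightarrow> complex \<Rightarrow>
    'v::complex_vector vertex_sa \<Rightarrow> ('g \<Rightarrow> 'v) \<Rightarrow> ('v, 'm::complex_vector) vmod set" where
  "KL_fin g \<hh> B k V \<iota> = {M \<in> KL g B k V \<iota>.
     carrier M = cvec.span {w \<in> carrier M. \<exists>\<mu> :: 'g \<times> complex \<times> complex \<Rightarrow> complex.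
       \<forall>z \<in> \<hh> \<times> UNIV \<times> UNIV. affine_cartan_act g B k V \<iota> M z w = \<mu> z *\<^sub>C w}}"

text \<open>
  The lowest weight is the eigenvalue with least real part; it is unique for an irreducible
  module, whose eigenvalues all differ by integers.
\<close>

definition lowest_weight :: "'m::complex_vector set \<Rightarrow> ('m \<Rightarrow> 'm) \<Rightarrow> complex \<Rightarrow> bool" where
  "lowest_weight S T \<mu> \<longleftrightarrow> gen_eigenspace S T \<mu> \<noteq> {0} \<and>
     (\<forall>\<nu>. gen_eigenspace S T \<nu> \<noteq> {0} \<longrightarrow> Re \<mu> \<le> Re \<nu>)"

definition top_space ::
  "'g::complex_vector lie_sa \<Rightarrow> ('g \<Rightarrow> 'g \<Rightarrow> complex) \<Rightarrow> complex \<Rightarrow>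
    'v::complex_vector vertex_sa \<Rightarrow> ('g \<Rightarrow> 'v) \<Rightarrow> ('v, 'm::complex_vector) vmod \<Rightarrow> 'm set" where
  "top_space g B k V \<iota> M = {w \<in> carrier M. \<exists>\<mu>.
     lowest_weight (carrier M) (L0 g B k V \<iota> M) \<mu> \<and> L0 g B k V \<iota> M w = \<mu> *\<^sub>C w}"

definition top_component ::
  "'g::complex_vector lie_sa \<Rightarrow> ('g \<Rightarrow> 'g \<Rightarrow> complex) \<Rightarrow> complex \<Rightarrow>
    'v::complex_vector vertex_sa \<Rightarrow> ('g \<Rightarrow> 'v) \<Rightarrow> ('v, 'm::complex_vector) vmod \<Rightarrow>
    ('g, 'm) gmod" where
  "top_component g B k V \<iota> M =
     \<lparr> gcarrier = top_space g B k V \<iota> M,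
       ggrade = (\<lambda>p. top_space g B k V \<iota> M \<inter> mgrade M p),
       gact = (\<lambda>x. act M (\<iota> x) 0) \<rparr>"

end

theory Submission
  imports Defs "HOL-Computational_Algebra.Fundamental_Theorem_Algebra"
begin

text \<open>
  An object \<open>M\<close> of \<open>KL\<close> lies in \<open>KL_fin\<close> iff \<open>L0\<close> and the zero modes of \<open>\<hh>\<close> act without nilpotent
  parts: these operators commute, each of them is a sum of a semisimple and a locally nilpotent one
  (by definition of \<open>KL\<close> for \<open>L0\<close>, by local finiteness for \<open>\<hh>\<close>), and commuting diagonalizable
  operators are simultaneously diagonalizable. So everything rests on showing that the nilpotent
  parts vanish (\<open>joint_kernel_eq_carrier\<close>); then \<open>KL = KL_fin\<close>, and semisimplicity is the hypothesis.

  The nilpotent part \<open>T\<close> of such an operator is an endomorphism of the \<open>V\<close>-module \<open>M\<close> (\<open>nil_endo\<close>):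
  the currents are sums of operators homogeneous for the affine Cartan subalgebra, so \<open>T\<close> commutes
  with them, and the currents generate \<open>V\<close>. For \<open>L0\<close> this uses that the currents have conformal
  weight one for the Sugawara vector (\<open>current_sugawara_products\<close>), which rests on the invariance of
  the Casimir tensor and on Schur's lemma for the Casimir operator of \<open>g\<close>.

  Let \<open>U\<close> be the common kernel of the nilpotent parts. It is a submodule in \<open>KL_fin\<close>, hence
  semisimple. If \<open>U \<noteq> M\<close>, some submodule \<open>E\<close> strictly larger than \<open>U\<close> and some \<open>T\<close> satisfy
  \<open>T E \<subseteq> U\<close> and \<open>E \<inter> ker T = U\<close>. Choose a simple submodule \<open>N\<close> of \<open>T E\<close>, a complement \<open>N'\<close> of \<open>N\<close>
  in \<open>U\<close>, and let \<open>A\<close> be the top component of \<open>N\<close>. If \<open>E\<close> is shrunk to the preimage of \<open>N\<close> under \<open>T\<close>,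
  then \<open>E / N'\<close> is an extension of \<open>N\<close> by itself on which \<open>T\<close> does not vanish. Its top component is a self-extension of
  \<open>A\<close>, which splits by the hypothesis on \<open>Ext\<close>; but on a split extension \<open>T\<close> is zero. Indeed the
  elements of \<open>\<hh>\<close> act semisimply on \<open>A\<close>, and \<open>L0\<close> acts on a top component through the Casimir
  operator of \<open>g\<close>, so both act semisimply on a direct sum of copies of \<open>A\<close>.

  Quotients are avoided by working with a linear section \<open>s\<close> of \<open>T\<close> over \<open>A\<close>, with values in the
  generalized \<open>L0\<close>-eigenspace of the lowest weight of \<open>A\<close>. The failure of \<open>s\<close> to be \<open>g\<close>-linear,
  projected to \<open>N\<close> along \<open>N'\<close>, is a cocycle on \<open>A\<close> (\<open>cocycle_bracket\<close>); it defines an extension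
  carried by \<open>A \<times> A\<close>. A splitting makes the cocycle a coboundary (\<open>coboundary\<close>), which corrects \<open>s\<close> to
  a section that is \<open>g\<close>-linear modulo \<open>N'\<close>. An eigenvector \<open>a \<noteq> 0\<close> in \<open>A\<close> then lifts to an
  eigenvector modulo \<open>N'\<close>, and \<open>a = T (s a)\<close> falls into \<open>N \<inter> N' = 0\<close>.
\<close>


section \<open>Linear operators on a subspace\<close>

lemma clinear_onI:
  assumes "\<And>x y. x \<in> S \<Longrightarrow> y \<in> S \<Longrightarrow> f (x + y) = f x + f y"
    and "\<And>c x. x \<in> S \<Longrightarrow> f (c *\<^sub>C x) = c *\<^sub>C f x"
  shows "clinear_on S f"
  using assms by (auto simp: clinear_on_def)

lemma clinear_on_add: "clinear_on S f \<Longrightarrow> x \<in> S \<Longrightarrow> y \<in> S \<Longrightarrow> f (x + y) = f x + f y"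
  and clinear_on_scale: "clinear_on S f \<Longrightarrow> x \<in> S \<Longrightarrow> f (c *\<^sub>C x) = c *\<^sub>C f x"
  by (auto simp: clinear_on_def)

lemma clinear_on_subset: "clinear_on S f \<Longrightarrow> T \<subseteq> S \<Longrightarrow> clinear_on T f"
  unfolding clinear_on_def by blast

lemma clinear_on_zero:
  assumes "cvec.subspace S" "clinear_on S f"
  shows "f 0 = 0"
  using clinear_on_scale[OF assms(2) cvec.subspace_0[OF assms(1)], of 0] by simp

lemma clinear_on_diff:
  assumes "cvec.subspace S" "clinear_on S f" "x \<in> S" "y \<in> S"
  shows "f (x - y) = f x - f y"
proof -
  have "f (x - y + y) = f (x - y) + f y"
    using assms by (intro clinear_on_add[of S]) (auto intro: cvec.subspace_diff)
  then show ?thesis by simp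
qed

lemma clinear_on_sum:
  assumes "cvec.subspace S" "clinear_on S f" "\<And>i. i \<in> F \<Longrightarrow> g i \<in> S"
  shows "f (sum g F) = (\<Sum>i\<in>F. f (g i))"
  using assms(3)
proof (induction F rule: infinite_finite_induct)
  case (insert i F)
  have "f (g i + sum g F) = f (g i) + f (sum g F)"
    using insert.prems assms by (intro clinear_on_add[of S]) (auto intro: cvec.subspace_sum)
  then show ?case using insert by simp
qed (simp_all add: clinear_on_zero[OF assms(1,2)])

lemma subspace_image_clinear_on:
  assumes "cvec.subspace S" "clinear_on S f"
  shows "cvec.subspace (f ` S)"
proof (rule cvec.subspaceI)
  show "0 \<in> f ` S"
    using clinear_on_zero[OF assms] cvec.subspace_0[OF assms(1)] by force
next
  fix x y assume "x \<in> f ` S" "y \<in> f ` S"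
  then show "x + y \<in> f ` S"
    using clinear_on_add[OF assms(2)] cvec.subspace_add[OF assms(1)] by (force simp: image_iff)
next
  fix c x assume "x \<in> f ` S"
  then obtain u where u: "u \<in> S" "x = f u" by blast
  then have "c *\<^sub>C x = f (c *\<^sub>C u)"
    by (simp add: clinear_on_scale[OF assms(2)])
  then show "c *\<^sub>C x \<in> f ` S"
    using cvec.subspace_scale[OF assms(1) u(1)] by blast
qed

lemma subspace_vimage_clinear_on:
  assumes "cvec.subspace S" "clinear_on S f" "cvec.subspace N"
  shows "cvec.subspace {v \<in> S. f v \<in> N}"
  using assms(1,3) clinear_on_zero[OF assms(1,2)]
  by (auto simp: cvec.subspace_def clinear_on_add[OF assms(2)] clinear_on_scale[OF assms(2)])

lemma fin_dim_subspace:
  assumes "fin_dim S" "cvec.subspace U" "U \<subseteq> S"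
  shows "fin_dim U"
proof -
  obtain X where X: "finite X" "S = cvec.span X"
    using assms(1) by (auto simp: fin_dim_def)
  obtain Y where Y: "Y \<subseteq> U" "cvec.independent Y" "U \<subseteq> cvec.span Y"
    using cvec.maximal_independent_subset by blast
  have "finite Y"
    using cvec.independent_span_bound[OF X(1) Y(2)] Y(1) assms(3) X(2) by auto
  moreover have "U = cvec.span Y"
    using Y(1,3) cvec.span_minimal[OF _ assms(2)] by blast
  ultimately show ?thesis by (auto simp: fin_dim_def)
qed

lemma fin_dim_imp_subspace: "fin_dim S \<Longrightarrow> cvec.subspace S"
  by (auto simp: fin_dim_def)

text \<open>
  Preimages of a basis, chosen in the subspace \<open>U\<close>, extend to a linear section. Defining it on the
  whole type makes it easy to combine with other sections.
\<close>

lemma linear_section_exists: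
  fixes T :: "'a::complex_vector \<Rightarrow> 'a"
  assumes lin: "cvec.subspace U" "clinear_on U T" and A: "cvec.subspace A"
    and surj: "\<And>a. a \<in> A \<Longrightarrow> \<exists>u\<in>U. T u = a"
  obtains s where "clinear_on UNIV s" "\<And>a. a \<in> A \<Longrightarrow> s a \<in> U" "\<And>a. a \<in> A \<Longrightarrow> T (s a) = a"
proof -
  interpret vp: vector_space_pair "scaleC :: complex \<Rightarrow> 'a \<Rightarrow> 'a" "scaleC :: complex \<Rightarrow> 'a \<Rightarrow> 'a" ..
  obtain Y where Y: "Y \<subseteq> A" "cvec.independent Y" "A \<subseteq> cvec.span Y"
    using cvec.maximal_independent_subset by blast
  define h where "h y = (SOME u. u \<in> U \<and> T u = y)" for y
  have h: "h y \<in> U \<and> T (h y) = y" if "y \<in> Y" for y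
    unfolding h_def by (rule someI_ex) (use surj Y(1) that in blast)
  define s where "s = vp.construct Y h"
  have s: "Vector_Spaces.linear scaleC scaleC s"
    unfolding s_def using Y(2) by (rule vp.linear_construct)
  have sY: "s y = h y" if "y \<in> Y" for y
    unfolding s_def using Y(2) that by (rule vp.construct_basis)
  have lin_s: "clinear_on UNIV s"
    using s by (auto simp: clinear_on_def Vector_Spaces.linear_iff)
  have "s a \<in> U \<and> T (s a) = a" if "a \<in> A" for a
  proof -
    have "a \<in> cvec.span Y" using that Y by blast
    then show ?thesis
    proof (induction rule: cvec.span_induct_alt)
      case base
      have "s 0 = 0" using clinear_on_zero[OF _ lin_s] by simp
      then show ?case using cvec.subspace_0[OF lin(1)] clinear_on_zero[OF lin] by simp
    next
      case (step c x y)
      have "s (c *\<^sub>C x + y) = c *\<^sub>C h x + s y"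
        using lin_s sY[OF step(1)] by (simp add: clinear_on_def)
      then show ?case
        using h[OF step(1)] step(2) lin
        by (simp add: clinear_on_add[OF lin(2)] clinear_on_scale[OF lin(2)]
            cvec.subspace_add cvec.subspace_scale)
    qed
  qed
  then show ?thesis using that lin_s by blast
qed


section \<open>Generalized eigenspaces and the nilpotent part\<close>

definition invariant_subspace :: "('a::complex_vector \<Rightarrow> 'a) \<Rightarrow> 'a set \<Rightarrow> bool" where
  "invariant_subspace A N \<longleftrightarrow> cvec.subspace N \<and> (\<forall>v\<in>N. A v \<in> N)"

locale stable_operator =
  fixes S :: "'a::complex_vector set" and A :: "'a \<Rightarrow> 'a"
  assumes subspace: "cvec.subspace S"
    and linear: "clinear_on S A"
    and closed: "v \<in> S \<Longrightarrow> A v \<in> S"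
begin

abbreviation shift :: "complex \<Rightarrow> 'a \<Rightarrow> 'a" where
  "shift \<mu> \<equiv> \<lambda>u. A u - \<mu> *\<^sub>C u"

abbreviation geig :: "complex \<Rightarrow> 'a set" where
  "geig \<equiv> gen_eigenspace S A"

lemmas A_add = clinear_on_add[OF linear]
  and A_scale = clinear_on_scale[OF linear]
  and A_diff = clinear_on_diff[OF subspace linear]
  and A_zero = clinear_on_zero[OF subspace linear]
  and S_add = cvec.subspace_add[OF subspace]
  and S_diff = cvec.subspace_diff[OF subspace]
  and S_scale = cvec.subspace_scale[OF subspace]
  and S_zero = cvec.subspace_0[OF subspace]
  and S_sum = cvec.subspace_sum[OF subspace]

lemma shift_closed: "v \<in> S \<Longrightarrow> shift \<mu> v \<in> S"
  by (simp add: S_diff S_scale closed)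

lemma shift_linear: "clinear_on S (shift \<mu>)"
  by (rule clinear_onI) (simp_all add: A_add A_scale cvec.scale_right_distrib
      cvec.scale_right_diff_distrib mult.commute)

lemma shift_commute: "v \<in> S \<Longrightarrow> shift \<mu> (shift \<nu> v) = shift \<nu> (shift \<mu> v)"
  by (simp add: A_diff A_scale closed S_scale cvec.scale_right_diff_distrib mult.commute
      diff_diff_eq2 add.commute)

lemma shift_power_Suc: "(shift \<mu> ^^ Suc n) v = (shift \<mu> ^^ n) (shift \<mu> v)"
  by (simp only: funpow_Suc_right o_apply)

lemma shift_power_closed: "v \<in> S \<Longrightarrow> (shift \<mu> ^^ n) v \<in> S"
  by (induction n) (simp_all add: shift_closed)

lemma shift_power_linear: "clinear_on S (shift \<mu> ^^ n)"
proof (induction n)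
  case (Suc n)
  then show ?case
    using clinear_on_add[OF shift_linear] clinear_on_scale[OF shift_linear]
    by (auto intro!: clinear_onI simp: clinear_on_add[OF Suc] clinear_on_scale[OF Suc]
        shift_power_closed)
qed (simp add: clinear_on_def)

lemma shift_power_zero: "(shift \<mu> ^^ n) 0 = 0"
  using clinear_on_zero[OF subspace shift_power_linear] .

lemma shift_power_mono: "(shift \<mu> ^^ n) v = 0 \<Longrightarrow> n \<le> m \<Longrightarrow> (shift \<mu> ^^ m) v = 0"
  using funpow_add[of "m - n" n "shift \<mu>"] by (simp only: le_add_diff_inverse2 o_apply shift_power_zero)

lemma geig_subset: "geig \<mu> \<subseteq> S"
  by (auto simp: gen_eigenspace_def)

lemma geig_subspace: "cvec.subspace (geig \<mu>)"
proof (rule cvec.subspaceI)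
  show "0 \<in> geig \<mu>"
    by (auto simp: gen_eigenspace_def S_zero intro: exI[of _ 0])
next
  fix x y assume "x \<in> geig \<mu>" "y \<in> geig \<mu>"
  then obtain m n where mn: "x \<in> S" "y \<in> S" "(shift \<mu> ^^ m) x = 0" "(shift \<mu> ^^ n) y = 0"
    by (auto simp: gen_eigenspace_def)
  then have "(shift \<mu> ^^ max m n) x = 0" "(shift \<mu> ^^ max m n) y = 0"
    using shift_power_mono by (meson max.cobounded1 max.cobounded2)+
  then have "(shift \<mu> ^^ max m n) (x + y) = 0"
    using mn clinear_on_add[OF shift_power_linear] by simp
  then show "x + y \<in> geig \<mu>"
    using mn S_add by (auto simp: gen_eigenspace_def)
next
  fix c x assume "x \<in> geig \<mu>"
  then obtain m where m: "x \<in> S" "(shift \<mu> ^^ m) x = 0"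
    by (auto simp: gen_eigenspace_def)
  then have "(shift \<mu> ^^ m) (c *\<^sub>C x) = 0"
    using clinear_on_scale[OF shift_power_linear] by simp
  then show "c *\<^sub>C x \<in> geig \<mu>"
    using m S_scale by (auto simp: gen_eigenspace_def)
qed

lemma geig_restrict:
  "N \<subseteq> S \<Longrightarrow> gen_eigenspace N A \<mu> = N \<inter> geig \<mu>"
  by (auto simp: gen_eigenspace_def)

lemma eigenvector_in_geig: "v \<in> S \<Longrightarrow> A v = \<mu> *\<^sub>C v \<Longrightarrow> v \<in> geig \<mu>"
  unfolding gen_eigenspace_def by (auto intro: exI[of _ 1])

lemma shift_preimage_geig:
  assumes "v \<in> S" "shift \<mu> v \<in> geig \<mu>"
  shows "v \<in> geig \<mu>"
proof -
  obtain n where "(shift \<mu> ^^ n) (shift \<mu> v) = 0"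
    using assms by (auto simp: gen_eigenspace_def)
  then have "(shift \<mu> ^^ Suc n) v = 0"
    by (simp only: shift_power_Suc)
  then show ?thesis
    using assms(1) unfolding gen_eigenspace_def by blast
qed

text \<open>
  If \<open>X\<close> is homogeneous of degree \<open>c\<close> for the commutator with \<open>A\<close>, then
  \<open>(A - (\<mu> + c))\<^sup>n X = X (A - \<mu>)\<^sup>n\<close>.
\<close>

lemma homogeneous_geig:
  assumes X: "clinear_on S X" "\<And>v. v \<in> S \<Longrightarrow> X v \<in> S"
    and comm: "\<And>v. v \<in> S \<Longrightarrow> A (X v) = X (A v) + c *\<^sub>C X v"
    and v: "v \<in> geig \<mu>"
  shows "X v \<in> geig (\<mu> + c)"
proof -
  have "(shift (\<mu> + c) ^^ n) (X u) = X ((shift \<mu> ^^ n) u)" if "u \<in> S" for n u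
  proof (induction n)
    case (Suc n)
    let ?w = "(shift \<mu> ^^ n) u"
    have w: "?w \<in> S" by (simp add: shift_power_closed that)
    have "A (X ?w) - (\<mu> + c) *\<^sub>C X ?w = X (A ?w) - \<mu> *\<^sub>C X ?w"
      using comm[OF w] by (simp add: cvec.scale_left_distrib)
    also have "\<dots> = X (shift \<mu> ?w)"
      using w by (simp add: clinear_on_diff[OF subspace X(1)] clinear_on_scale[OF X(1)] closed S_scale)
    finally show ?case using Suc by simp
  qed simp
  moreover obtain n where "v \<in> S" "(shift \<mu> ^^ n) v = 0"
    using v by (auto simp: gen_eigenspace_def)
  ultimately have "(shift (\<mu> + c) ^^ n) (X v) = 0" "X v \<in> S"
    using clinear_on_zero[OF subspace X(1)] X(2) by auto
  then show ?thesis by (auto simp: gen_eigenspace_def)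
qed

lemma geig_closed:
  assumes "v \<in> geig \<mu>"
  shows "A v \<in> geig \<mu>"
proof -
  have "A v \<in> geig (\<mu> + 0)"
    by (rule homogeneous_geig[where X = A, OF linear closed _ assms]) simp_all
  then show ?thesis by simp
qed

text \<open>
  On the generalized eigenspace of \<open>\<mu>\<close> the operator \<open>A - \<nu>\<close> is the nonzero scalar \<open>\<mu> - \<nu>\<close> plus the
  locally nilpotent operator \<open>A - \<mu>\<close>, hence invertible on each invariant subspace.
\<close>

lemma invariant_shift_cancel:
  assumes N: "invariant_subspace A N" and u: "u \<in> geig \<mu>" and "\<nu> \<noteq> \<mu>" and uN: "shift \<nu> u \<in> N"
  shows "u \<in> N"
proof -
  have N_sub: "cvec.subspace N" and N_closed: "\<And>v. v \<in> N \<Longrightarrow> A v \<in> N"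
    using N by (auto simp: invariant_subspace_def)
  obtain m where "u \<in> S" "(shift \<mu> ^^ m) u = 0"
    using u by (auto simp: gen_eigenspace_def)
  then show ?thesis using uN
  proof (induction m arbitrary: u)
    case 0
    then show ?case using cvec.subspace_0[OF N_sub] by simp
  next
    case (Suc m)
    let ?u' = "shift \<mu> u"
    have shiftN: "shift \<mu> w \<in> N" if "w \<in> N" for w
      by (rule cvec.subspace_diff[OF N_sub N_closed[OF that] cvec.subspace_scale[OF N_sub that]])
    have "shift \<nu> ?u' \<in> N"
      by (subst shift_commute[OF Suc.prems(1)]) (rule shiftN[OF Suc.prems(3)])
    moreover have "(shift \<mu> ^^ m) ?u' = 0"
      using Suc.prems(2) by (simp only: shift_power_Suc)
    ultimately have u': "?u' \<in> N"
      using Suc.IH[OF shift_closed[OF Suc.prems(1)]] by blast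
    then have "shift \<nu> u - ?u' \<in> N"
      using Suc.prems(3) cvec.subspace_diff[OF N_sub] by blast
    moreover have "shift \<nu> u - ?u' = (\<mu> - \<nu>) *\<^sub>C u"
      by (simp add: cvec.scale_left_diff_distrib)
    ultimately have "(\<mu> - \<nu>) *\<^sub>C u \<in> N" by simp
    then have "(1 / (\<mu> - \<nu>)) *\<^sub>C ((\<mu> - \<nu>) *\<^sub>C u) \<in> N"
      by (rule cvec.subspace_scale[OF N_sub])
    then show ?case using \<open>\<nu> \<noteq> \<mu>\<close> by simp
  qed
qed

lemma invariant_shift_power_cancel:
  assumes "invariant_subspace A N" "u \<in> geig \<mu>" "\<nu> \<noteq> \<mu>" "(shift \<nu> ^^ n) u \<in> N"
  shows "u \<in> N"
  using assms(2,4)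
proof (induction n arbitrary: u)
  case 0
  from 0(2) show ?case by (simp only: funpow_0)
next
  case (Suc n)
  have "shift \<nu> u \<in> geig \<mu>"
    using Suc.prems(1)
    by (intro cvec.subspace_diff[OF geig_subspace] cvec.subspace_scale[OF geig_subspace] geig_closed)
  moreover have "(shift \<nu> ^^ n) (shift \<nu> u) \<in> N"
    using Suc.prems(2) by (simp only: shift_power_Suc)
  ultimately have "shift \<nu> u \<in> N"
    using Suc.IH by blast
  from invariant_shift_cancel[OF assms(1) Suc.prems(1) assms(3) this] show ?case .
qed

text \<open>
  A power of \<open>A - \<nu>\<close> kills the component at \<open>\<nu>\<close> and can be cancelled on all others, which allows an
  induction on the number of components. For \<open>N = 0\<close> this is the independence of generalized
  eigenspaces.
\<close>

lemma components_in_invariant: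
  assumes N: "invariant_subspace A N" and "finite F"
    and "\<And>\<mu>. \<mu> \<in> F \<Longrightarrow> f \<mu> \<in> geig \<mu>" and "sum f F \<in> N" and "\<mu> \<in> F"
  shows "f \<mu> \<in> N"
  using assms(2-5)
proof (induction F arbitrary: f \<mu> rule: finite_induct)
  case (insert \<nu> F)
  have N_sub: "cvec.subspace N" and N_closed: "\<And>v. v \<in> N \<Longrightarrow> A v \<in> N"
    using N by (auto simp: invariant_subspace_def)
  have fS: "f \<mu> \<in> S" if "\<mu> \<in> insert \<nu> F" for \<mu>
    using insert.prems(1)[OF that] geig_subset by blast
  obtain n where n: "(shift \<nu> ^^ n) (f \<nu>) = 0"
    using insert.prems(1)[of \<nu>] by (auto simp: gen_eigenspace_def)
  have shiftN: "(shift \<nu> ^^ n) v \<in> N" if "v \<in> N" for v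
    using that by (induction n) (auto simp: N_closed cvec.subspace_diff[OF N_sub]
        cvec.subspace_scale[OF N_sub])
  have powgeig: "(shift \<nu> ^^ n) v \<in> geig \<mu>" if "v \<in> geig \<mu>" for v \<mu>
    using that by (induction n) (auto simp: geig_closed cvec.subspace_diff[OF geig_subspace]
        cvec.subspace_scale[OF geig_subspace])
  have "(\<Sum>\<mu>\<in>insert \<nu> F. (shift \<nu> ^^ n) (f \<mu>)) \<in> N"
    using shiftN[OF insert.prems(2)] clinear_on_sum[OF subspace shift_power_linear, of "insert \<nu> F" f]
      fS by metis
  then have "(\<Sum>\<mu>\<in>F. (shift \<nu> ^^ n) (f \<mu>)) \<in> N"
    using insert.hyps n by simp
  then have "(shift \<nu> ^^ n) (f \<mu>) \<in> N" if "\<mu> \<in> F" for \<mu>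
    using insert.IH[of "\<lambda>\<mu>. (shift \<nu> ^^ n) (f \<mu>)"] insert.prems(1) powgeig that by blast
  then have F: "f \<mu> \<in> N" if "\<mu> \<in> F" for \<mu>
    using invariant_shift_power_cancel[OF N] insert.prems(1) insert.hyps(2) that
    by (metis insertCI)
  then have "sum f F \<in> N"
    by (auto intro: cvec.subspace_sum[OF N_sub])
  then have "sum f (insert \<nu> F) - sum f F \<in> N"
    using insert.prems(2) cvec.subspace_diff[OF N_sub] by blast
  then have "f \<nu> \<in> N" using insert.hyps by simp
  then show ?case using F insert.prems(3) by auto
qed simp

lemma components_zero:
  assumes "finite F" "\<And>\<mu>. \<mu> \<in> F \<Longrightarrow> f \<mu> \<in> geig \<mu>" "sum f F = 0" "\<mu> \<in> F"
  shows "f \<mu> = 0"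
proof -
  have "invariant_subspace A {0}"
    using A_zero by (auto simp: invariant_subspace_def)
  then show ?thesis
    using components_in_invariant[of "{0}"] assms by blast
qed

lemma geig_disjoint:
  assumes "v \<in> geig \<mu>" "v \<in> geig \<nu>" "v \<noteq> 0"
  shows "\<mu> = \<nu>"
proof (rule ccontr)
  assume "\<mu> \<noteq> \<nu>"
  moreover obtain n where "(shift \<nu> ^^ n) v = 0"
    using assms(2) by (auto simp: gen_eigenspace_def)
  moreover have "invariant_subspace A {0}"
    using A_zero by (auto simp: invariant_subspace_def)
  ultimately have "v \<in> {0}"
    using invariant_shift_power_cancel[of "{0}" v \<mu> \<nu> n] assms(1) by simp
  then show False using assms(3) by simp
qed

text \<open>
  This relation is the graph of the nilpotent part of \<open>A\<close>. As a span it is linear by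
  construction, and only single-valuedness has to be proved.
\<close>

definition nil_graph :: "('a \<times> 'a) set" where
  "nil_graph = cvec.span {(v, shift \<mu> v) |v \<mu>. v \<in> geig \<mu>}"

lemma nil_graph_components:
  assumes "z \<in> nil_graph"
  shows "\<exists>F f. finite F \<and> (\<forall>\<mu>. f \<mu> \<in> geig \<mu>) \<and> (\<forall>\<mu>. \<mu> \<notin> F \<longrightarrow> f \<mu> = 0) \<and>
    z = (\<Sum>\<mu>\<in>F. (f \<mu>, shift \<mu> (f \<mu>)))"
  using assms unfolding nil_graph_def
proof (induction rule: cvec.span_induct_alt)
  case base
  show ?case
    by (rule exI[of _ "{}"], rule exI[of _ "\<lambda>_. 0"]) (simp add: cvec.subspace_0[OF geig_subspace])
next
  case (step c x y)
  obtain v \<nu> where v: "v \<in> geig \<nu>" "x = (v, shift \<nu> v)" using step(1) by blast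
  obtain F f where f: "finite F" "\<forall>\<mu>. f \<mu> \<in> geig \<mu>" "\<forall>\<mu>. \<mu> \<notin> F \<longrightarrow> f \<mu> = 0"
      "y = (\<Sum>\<mu>\<in>F. (f \<mu>, shift \<mu> (f \<mu>)))"
    using step(2) by blast
  let ?h = "\<lambda>f \<mu>. (f \<mu>, shift \<mu> (f \<mu>))" and ?F = "insert \<nu> F"
  define f' where "f' = f(\<nu> := c *\<^sub>C v + f \<nu>)"
  have S: "v \<in> S" "f \<nu> \<in> S" using v(1) f(2) geig_subset by blast+
  have "y = sum (?h f) ?F"
    unfolding f(4) using f(1,3) by (intro sum.mono_neutral_left) (auto simp: A_zero zero_prod_def)
  also have "\<dots> = ?h f \<nu> + sum (?h f) (?F - {\<nu>})"
    using f(1) by (intro sum.remove) auto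
  also have "sum (?h f) (?F - {\<nu>}) = sum (?h f') (?F - {\<nu>})"
    by (intro sum.cong) (auto simp: f'_def)
  finally have y: "y = ?h f \<nu> + sum (?h f') (?F - {\<nu>})" .
  have "c *\<^sub>C x + ?h f \<nu> = ?h f' \<nu>"
    unfolding v(2) using S
    by (simp add: f'_def scaleC_prod_def clinear_on_add[OF shift_linear] clinear_on_scale[OF shift_linear]
        S_scale A_add A_scale cvec.scale_right_distrib cvec.scale_right_diff_distrib mult.commute)
  then have "c *\<^sub>C x + y = ?h f' \<nu> + sum (?h f') (?F - {\<nu>})"
    unfolding y by (simp only: add.assoc[symmetric])
  also have "\<dots> = sum (?h f') ?F"
    using f(1) by (intro sum.remove[symmetric]) auto
  finally have "c *\<^sub>C x + y = sum (?h f') ?F" .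
  moreover have "\<forall>\<mu>. f' \<mu> \<in> geig \<mu>"
    using f(2) v(1) by (auto simp: f'_def cvec.subspace_add[OF geig_subspace]
        cvec.subspace_scale[OF geig_subspace])
  moreover have "\<forall>\<mu>. \<mu> \<notin> ?F \<longrightarrow> f' \<mu> = 0"
    using f(3) by (auto simp: f'_def)
  ultimately show ?case using f(1) by blast
qed

lemma span_geig_graph:
  assumes "v \<in> cvec.span (\<Union>\<mu>. geig \<mu>)"
  shows "\<exists>u. (v, u) \<in> nil_graph"
  using assms
proof (induction rule: cvec.span_induct_alt)
  case base
  have "(0, 0) \<in> nil_graph" unfolding nil_graph_def using cvec.span_zero by (simp flip: zero_prod_def)
  then show ?case by blast
next
  case (step c x y)
  obtain u where u: "(y, u) \<in> nil_graph" using step(2) by blast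
  obtain \<mu> where "x \<in> geig \<mu>" using step(1) by blast
  then have "(x, shift \<mu> x) \<in> nil_graph"
    unfolding nil_graph_def by (intro cvec.span_base) blast
  then have "c *\<^sub>C (x, shift \<mu> x) + (y, u) \<in> nil_graph"
    using u unfolding nil_graph_def by (intro cvec.span_add cvec.span_scale)
  then show ?case by (auto simp: scaleC_prod_def)
qed

lemma span_geig_components:
  assumes "v \<in> cvec.span (\<Union>\<mu>. geig \<mu>)"
  obtains F f where "finite F" "\<And>\<mu>. f \<mu> \<in> geig \<mu>" "\<And>\<mu>. \<mu> \<notin> F \<Longrightarrow> f \<mu> = 0" "v = sum f F"
proof -
  obtain u where "(v, u) \<in> nil_graph" using span_geig_graph[OF assms] by blast
  then obtain F f where f: "finite F" "\<forall>\<mu>. f \<mu> \<in> geig \<mu>" "\<forall>\<mu>. \<mu> \<notin> F \<longrightarrow> f \<mu> = 0"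
      "(v, u) = (\<Sum>\<mu>\<in>F. (f \<mu>, shift \<mu> (f \<mu>)))"
    using nil_graph_components by blast
  have "v = sum f F" using arg_cong[OF f(4), of fst] by (simp add: fst_sum)
  with f(1-3) show ?thesis by (intro that[of F f]) simp_all
qed

lemma nil_graph_functional:
  assumes "(v, u) \<in> nil_graph" "(v, u') \<in> nil_graph"
  shows "u = u'"
proof -
  have "(v, u) - (v, u') \<in> nil_graph"
    using assms unfolding nil_graph_def by (rule cvec.span_diff)
  then obtain F f where f: "finite F" "\<forall>\<mu>. f \<mu> \<in> geig \<mu>"
      "(v, u) - (v, u') = (\<Sum>\<mu>\<in>F. (f \<mu>, shift \<mu> (f \<mu>)))"
    using nil_graph_components by blast
  have "sum f F = 0" "u - u' = (\<Sum>\<mu>\<in>F. shift \<mu> (f \<mu>))"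
    using arg_cong[OF f(3), of fst] arg_cong[OF f(3), of snd] by (simp_all add: fst_sum snd_sum)
  moreover from this(1) have "f \<mu> = 0" if "\<mu> \<in> F" for \<mu>
    using components_zero[OF f(1) _ _ that] f(2) by blast
  ultimately show ?thesis by (simp add: A_zero)
qed

end

text \<open>
  When the generalized eigenspaces span, \<open>A\<close> is locally a sum of a semisimple and a nilpotent
  operator.
\<close>

locale spectral_operator = stable_operator +
  assumes spanned: "S = cvec.span (\<Union>\<mu>. gen_eigenspace S A \<mu>)"
begin

lemma components:
  assumes "v \<in> S"
  obtains F f where "finite F" "\<And>\<mu>. f \<mu> \<in> geig \<mu>" "\<And>\<mu>. \<mu> \<notin> F \<Longrightarrow> f \<mu> = 0" "v = sum f F"
  using span_geig_components[of v] assms spanned by blast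

lemma components_of_invariant:
  assumes "invariant_subspace A N" "N \<subseteq> S" "v \<in> N"
  obtains F f where "finite F" "\<And>\<mu>. f \<mu> \<in> geig \<mu>" "\<And>\<mu>. f \<mu> \<in> N" "\<And>\<mu>. \<mu> \<notin> F \<Longrightarrow> f \<mu> = 0"
    "v = sum f F"
proof -
  obtain F f where f: "finite F" "\<And>\<mu>. f \<mu> \<in> geig \<mu>" "\<And>\<mu>. \<mu> \<notin> F \<Longrightarrow> f \<mu> = 0" "v = sum f F"
    using components assms by blast
  have "f \<mu> \<in> N" for \<mu>
  proof (cases "\<mu> \<in> F")
    case True
    then show ?thesis using components_in_invariant[OF assms(1) f(1)] f(2,4) assms(3) by blast
  next
    case False
    then show ?thesis
      using assms(1) f(3) by (simp add: invariant_subspace_def cvec.subspace_0)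
  qed
  with f show ?thesis by (intro that[of F f]) simp_all
qed

lemma linear_eq_on_geig:
  assumes "clinear_on S X" "clinear_on S Y" "\<And>\<mu> v. v \<in> geig \<mu> \<Longrightarrow> X v = Y v" "v \<in> S"
  shows "X v = Y v"
proof -
  obtain F f where f: "finite F" "\<And>\<mu>. f \<mu> \<in> geig \<mu>" "v = sum f F"
    using components[OF assms(4)] by metis
  have fS: "\<And>\<mu>. f \<mu> \<in> S" using f(2) geig_subset by blast
  show ?thesis
    unfolding f(3) using fS assms(3)[OF f(2)]
    by (simp add: clinear_on_sum[OF subspace assms(1)] clinear_on_sum[OF subspace assms(2)])
qed

definition nil_part :: "'a \<Rightarrow> 'a" where
  "nil_part v = (THE u. (v, u) \<in> nil_graph)"

lemma nil_part_eqI: "(v, u) \<in> nil_graph \<Longrightarrow> nil_part v = u"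
  unfolding nil_part_def using nil_graph_functional by blast

lemma nil_part_graph: "v \<in> S \<Longrightarrow> (v, nil_part v) \<in> nil_graph"
  using span_geig_graph[of v] spanned nil_part_eqI by blast

lemma nil_part_geig: "v \<in> geig \<mu> \<Longrightarrow> nil_part v = A v - \<mu> *\<^sub>C v"
  by (rule nil_part_eqI) (auto simp: nil_graph_def intro: cvec.span_base)

lemma nil_part_linear: "clinear_on S nil_part"
proof (rule clinear_onI; rule nil_part_eqI)
  fix x y assume x: "x \<in> S" and y: "y \<in> S"
  have "(x, nil_part x) + (y, nil_part y) \<in> nil_graph"
    using nil_part_graph[OF x] nil_part_graph[OF y] unfolding nil_graph_def by (rule cvec.span_add)
  then show "(x + y, nil_part x + nil_part y) \<in> nil_graph" by simp
next
  fix c x assume x: "x \<in> S"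
  have "c *\<^sub>C (x, nil_part x) \<in> nil_graph"
    using nil_part_graph[OF x] unfolding nil_graph_def by (rule cvec.span_scale)
  then show "(c *\<^sub>C x, c *\<^sub>C nil_part x) \<in> nil_graph" by (simp add: scaleC_prod_def)
qed

lemma nil_part_invariant:
  assumes N: "invariant_subspace A N" "N \<subseteq> S" and v: "v \<in> N"
  shows "nil_part v \<in> N"
proof -
  obtain F f where f: "\<And>\<mu>. f \<mu> \<in> geig \<mu>" "\<And>\<mu>. f \<mu> \<in> N" "v = sum f F"
    using components_of_invariant[OF N v] by metis
  have "nil_part v = (\<Sum>\<mu>\<in>F. A (f \<mu>) - \<mu> *\<^sub>C f \<mu>)"
    unfolding f(3) using f(1) geig_subset nil_part_geig[OF f(1)]
    by (subst clinear_on_sum[OF subspace nil_part_linear]) auto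
  then show ?thesis
    using N(1) f(2) by (auto simp: invariant_subspace_def
        intro!: cvec.subspace_sum cvec.subspace_diff cvec.subspace_scale)
qed

lemma nil_part_closed: "v \<in> S \<Longrightarrow> nil_part v \<in> S"
  using nil_part_invariant[of S v] subspace closed by (simp add: invariant_subspace_def)

lemma nil_part_commute:
  assumes X: "clinear_on S X" "\<And>v. v \<in> S \<Longrightarrow> X v \<in> S"
    and comm: "\<And>v. v \<in> S \<Longrightarrow> A (X v) = X (A v) + c *\<^sub>C X v" and v: "v \<in> S"
  shows "nil_part (X v) = X (nil_part v)"
proof (rule linear_eq_on_geig[OF _ _ _ v])
  show "clinear_on S (\<lambda>v. nil_part (X v))" "clinear_on S (\<lambda>v. X (nil_part v))"
    by (auto intro!: clinear_onI simp: clinear_on_add[OF X(1)] clinear_on_add[OF nil_part_linear]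
        clinear_on_scale[OF X(1)] clinear_on_scale[OF nil_part_linear] X(2) nil_part_closed)
next
  fix \<mu> v assume v: "v \<in> geig \<mu>"
  then have vS: "v \<in> S" using geig_subset by blast
  have "nil_part (X v) = A (X v) - (\<mu> + c) *\<^sub>C X v"
    using homogeneous_geig[OF X comm v] by (rule nil_part_geig)
  also have "\<dots> = X (A v) - \<mu> *\<^sub>C X v"
    using comm[OF vS] by (simp add: cvec.scale_left_distrib)
  also have "\<dots> = X (A v - \<mu> *\<^sub>C v)"
    using vS by (simp add: clinear_on_diff[OF subspace X(1)] clinear_on_scale[OF X(1)] closed S_scale)
  finally show "nil_part (X v) = X (nil_part v)"
    using nil_part_geig[OF v] by simp
qed

lemma nil_part_locally_nilpotent:
  assumes "v \<in> S"
  shows "\<exists>n. (nil_part ^^ n) v = 0"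
proof -
  have zero: "(nil_part ^^ n) 0 = 0" for n
    by (induction n) (simp_all add: clinear_on_zero[OF subspace nil_part_linear])
  have mono: "(nil_part ^^ m) v = 0" if "(nil_part ^^ n) v = 0" "n \<le> m" for n m v
    using that zero funpow_add[of "m - n" n nil_part] by simp
  have pow_closed: "(nil_part ^^ n) v \<in> S" if "v \<in> S" for n v
    using that by (induction n) (auto simp: nil_part_closed)
  have lin: "clinear_on S (nil_part ^^ n)" for n
  proof (induction n)
    case (Suc n)
    then show ?case
      by (auto intro!: clinear_onI simp: clinear_on_add[OF Suc] clinear_on_scale[OF Suc] pow_closed
          clinear_on_add[OF nil_part_linear] clinear_on_scale[OF nil_part_linear])
  qed (simp add: clinear_on_def)
  have geig: "\<exists>n. (nil_part ^^ n) u = 0" if u: "u \<in> geig \<mu>" for u \<mu>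
  proof -
    have "(nil_part ^^ n) u = (shift \<mu> ^^ n) u \<and> (shift \<mu> ^^ n) u \<in> geig \<mu>" for n
      by (induction n) (auto simp: u nil_part_geig geig_closed
          intro!: cvec.subspace_diff[OF geig_subspace] cvec.subspace_scale[OF geig_subspace])
    then show ?thesis using u by (auto simp: gen_eigenspace_def)
  qed
  have "v \<in> cvec.span (\<Union>\<mu>. geig \<mu>)" using assms spanned by blast
  then have "v \<in> S \<and> (\<exists>n. (nil_part ^^ n) v = 0)"
  proof (induction rule: cvec.span_induct_alt)
    case base
    show ?case using zero[of 0] S_zero by blast
  next
    case (step c x y)
    obtain m where m: "(nil_part ^^ m) x = 0" using geig step(1) by blast
    obtain n where n: "(nil_part ^^ n) y = 0" and y: "y \<in> S" using step(2) by blast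
    have x: "x \<in> S" using step(1) geig_subset by blast
    have "(nil_part ^^ max m n) x = 0" "(nil_part ^^ max m n) y = 0"
      using mono[OF m] mono[OF n] by auto
    then have "(nil_part ^^ max m n) (c *\<^sub>C x + y) = 0"
      using x y by (simp add: clinear_on_add[OF lin] clinear_on_scale[OF lin] S_scale)
    then show ?case using x y S_add S_scale by blast
  qed
  then show ?thesis by blast
qed

lemma geig_eigenvector: "v \<in> geig \<mu> \<Longrightarrow> nil_part v = 0 \<Longrightarrow> A v = \<mu> *\<^sub>C v"
  using nil_part_geig by fastforce

text \<open>
  An operator \<open>T\<close> commuting with \<open>A\<close> respects components, so that the component at \<open>\<mu>\<close> of an
  arbitrary preimage of \<open>T u\<close> is again a preimage.
\<close>

lemma preimage_in_geig:
  assumes T: "clinear_on S T" "\<And>v. v \<in> S \<Longrightarrow> T v \<in> S" "\<And>v. v \<in> S \<Longrightarrow> A (T v) = T (A v)"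
    and U: "invariant_subspace A U" "U \<subseteq> S" "u \<in> U" and a: "T u \<in> geig \<mu>"
  shows "\<exists>e \<in> U \<inter> geig \<mu>. T e = T u"
proof -
  obtain F f where f: "finite F" "\<And>\<mu>. f \<mu> \<in> geig \<mu>" "\<And>\<mu>. f \<mu> \<in> U" "\<And>\<mu>. \<mu> \<notin> F \<Longrightarrow> f \<mu> = 0"
      "u = sum f F"
    using components_of_invariant[OF U] by blast
  have u: "u = sum f (insert \<mu> F)"
    unfolding f(5) using f(1,4) by (intro sum.mono_neutral_left) auto
  have Tu: "T u = (\<Sum>\<nu>\<in>insert \<mu> F. T (f \<nu>))"
    unfolding u using f(3) U(2) by (intro clinear_on_sum[OF subspace T(1)]) auto
  define d where "d \<nu> = T (f \<nu>) - (if \<nu> = \<mu> then T u else 0)" for \<nu>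
  have "d \<mu> = 0"
  proof (rule components_zero[of "insert \<mu> F"])
    show "finite (insert \<mu> F)" using f by simp
    show "sum d (insert \<mu> F) = 0"
      using f(1) Tu by (simp add: d_def sum_subtractf)
    show "d \<nu> \<in> geig \<nu>" for \<nu>
      using homogeneous_geig[OF T(1,2), of 0] T(3) f(2) a
      by (auto simp: d_def cvec.subspace_diff[OF geig_subspace])
  qed simp
  then have "T (f \<mu>) = T u" by (simp add: d_def)
  then show ?thesis using f(2,3) by blast
qed

text \<open>
  The components of \<open>v\<close> at \<open>\<mu> \<noteq> c\<close> lie in \<open>N\<close>, since \<open>A - c\<close> can be cancelled there, and the nilpotent
  part kills them; at \<open>c\<close> the nilpotent part is \<open>A - c\<close> itself, which maps the component into \<open>N\<close>.
\<close>

lemma nil_part_of_eigenvector_modulo: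
  assumes N: "invariant_subspace A N" "N \<subseteq> S" and nil: "\<And>w. w \<in> N \<Longrightarrow> nil_part w = 0"
    and v: "v \<in> S" "A v - c *\<^sub>C v \<in> N"
  shows "nil_part v \<in> N"
proof -
  have N_sub: "cvec.subspace N" using N by (simp add: invariant_subspace_def)
  obtain F f where f: "finite F" "\<And>\<mu>. f \<mu> \<in> geig \<mu>" "v = sum f F"
    using components[OF v(1)] by metis
  have fS: "\<And>\<mu>. f \<mu> \<in> S" using f(2) geig_subset by blast
  have shifted: "shift c (f \<mu>) \<in> N" if "\<mu> \<in> F" for \<mu>
  proof (rule components_in_invariant[OF N(1) f(1) _ _ that, of "\<lambda>\<mu>. shift c (f \<mu>)"])
    show "shift c (f \<mu>) \<in> geig \<mu>" for \<mu>
      using f(2) by (simp add: geig_closed cvec.subspace_diff[OF geig_subspace]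
          cvec.subspace_scale[OF geig_subspace])
    show "(\<Sum>\<mu>\<in>F. shift c (f \<mu>)) \<in> N"
      using v(2) clinear_on_sum[OF subspace shift_linear, of F f c] fS f(3) by simp
  qed
  have "nil_part (f \<mu>) \<in> N" if "\<mu> \<in> F" for \<mu>
  proof (cases "\<mu> = c")
    case True
    then show ?thesis using nil_part_geig[OF f(2)] shifted that by metis
  next
    case False
    then have "f \<mu> \<in> N"
      using invariant_shift_cancel[OF N(1) f(2)] shifted that by metis
    then show ?thesis using nil cvec.subspace_0[OF N_sub] by simp
  qed
  then have "(\<Sum>\<mu>\<in>F. nil_part (f \<mu>)) \<in> N"
    by (auto intro: cvec.subspace_sum[OF N_sub])
  then show ?thesis
    unfolding f(3) clinear_on_sum[OF subspace nil_part_linear, of F f, OF fS] .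
qed

end


text \<open>
  Joint eigenspaces of some of the operators are invariant under the next one, and so contain the
  eigencomponents of their elements.
\<close>

lemma joint_eigenvectors_span:
  assumes "finite \<D>"
    and "\<And>D. D \<in> \<D> \<Longrightarrow> spectral_operator S D"
    and "\<And>D D' w. D \<in> \<D> \<Longrightarrow> D' \<in> \<D> \<Longrightarrow> w \<in> S \<Longrightarrow> D (D' w) = D' (D w)"
    and N: "cvec.subspace N" "N \<subseteq> S" and "\<And>D w. D \<in> \<D> \<Longrightarrow> w \<in> N \<Longrightarrow> D w \<in> N"
    and "\<And>D w. D \<in> \<D> \<Longrightarrow> w \<in> N \<Longrightarrow> spectral_operator.nil_part S D w = 0"
  shows "N \<subseteq> cvec.span {w \<in> N. \<forall>D\<in>\<D>. \<exists>\<mu>. D w = \<mu> *\<^sub>C w}"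
  using assms(1-3,6,7)
proof (induction \<D> rule: finite_induct)
  case empty
  then show ?case by (auto intro: cvec.span_base)
next
  case (insert D \<D>)
  interpret D: spectral_operator S D using insert.prems(1) by blast
  let ?P = "\<lambda>\<D>. {w \<in> N. \<forall>D\<in>\<D>. \<exists>\<mu>. D w = \<mu> *\<^sub>C w}"
  have IH: "N \<subseteq> cvec.span (?P \<D>)"
  proof (rule insert.IH)
    show "\<And>D. D \<in> \<D> \<Longrightarrow> spectral_operator S D" using insert.prems(1) by blast
    show "\<And>D D' w. D \<in> \<D> \<Longrightarrow> D' \<in> \<D> \<Longrightarrow> w \<in> S \<Longrightarrow> D (D' w) = D' (D w)"
      using insert.prems(2) by blast
    show "\<And>D w. D \<in> \<D> \<Longrightarrow> w \<in> N \<Longrightarrow> D w \<in> N" using insert.prems(3) by blast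
    show "\<And>D w. D \<in> \<D> \<Longrightarrow> w \<in> N \<Longrightarrow> spectral_operator.nil_part S D w = 0"
      using insert.prems(4) by blast
  qed
  have "?P \<D> \<subseteq> cvec.span (?P (insert D \<D>))"
  proof
    fix w assume "w \<in> ?P \<D>"
    then have wN: "w \<in> N" and "\<forall>D\<in>\<D>. \<exists>\<mu>. D w = \<mu> *\<^sub>C w" by auto
    then obtain \<mu> where \<mu>: "\<forall>D\<in>\<D>. D w = \<mu> D *\<^sub>C w" by metis
    define W where "W = {u \<in> N. \<forall>D\<in>\<D>. D u = \<mu> D *\<^sub>C u}"
    have W: "cvec.subspace W"
    proof (rule cvec.subspaceI)
      have op: "stable_operator S D'" if "D' \<in> \<D>" for D'
        using insert.prems(1) that spectral_operator.axioms(1) by blast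
      show "0 \<in> W"
        using cvec.subspace_0[OF N(1)] by (auto simp: W_def stable_operator.A_zero[OF op])
      show "x + y \<in> W" if "x \<in> W" "y \<in> W" for x y
        using that N cvec.subspace_add[OF N(1)]
        by (auto simp: W_def stable_operator.A_add[OF op] cvec.scale_right_distrib subset_iff)
      show "c *\<^sub>C x \<in> W" if "x \<in> W" for c x
        using that N cvec.subspace_scale[OF N(1)]
        by (auto simp: W_def stable_operator.A_scale[OF op] mult.commute subset_iff)
    qed
    have "D u \<in> W" if u: "u \<in> W" for u
    proof -
      have uN: "u \<in> N" and eig: "\<And>D'. D' \<in> \<D> \<Longrightarrow> D' u = \<mu> D' *\<^sub>C u"
        using u by (auto simp: W_def)
      have "D' (D u) = \<mu> D' *\<^sub>C D u" if D': "D' \<in> \<D>" for D'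
      proof -
        have "D' (D u) = D (D' u)" using insert.prems(2) D' uN N(2) by blast
        then show ?thesis using eig[OF D'] D.A_scale uN N(2) by auto
      qed
      then show ?thesis using insert.prems(3) uN by (auto simp: W_def)
    qed
    then have inv: "invariant_subspace D W" using W by (simp add: invariant_subspace_def)
    have "W \<subseteq> S" "w \<in> W" using N wN \<mu> by (auto simp: W_def)
    then obtain F f where f: "finite F" "\<And>\<nu>. f \<nu> \<in> D.geig \<nu>" "\<And>\<nu>. f \<nu> \<in> W" "w = sum f F"
      using D.components_of_invariant[OF inv] by metis
    have "f \<nu> \<in> ?P (insert D \<D>)" for \<nu>
    proof -
      have "f \<nu> \<in> N" "\<forall>D\<in>\<D>. D (f \<nu>) = \<mu> D *\<^sub>C f \<nu>" using f(3)[of \<nu>] by (auto simp: W_def)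
      moreover from this have "D (f \<nu>) = \<nu> *\<^sub>C f \<nu>"
        using D.geig_eigenvector[OF f(2)] insert.prems(4) by blast
      ultimately show ?thesis by blast
    qed
    then show "w \<in> cvec.span (?P (insert D \<D>))"
      unfolding f(4) by (intro cvec.span_sum cvec.span_base)
  qed
  then have "cvec.span (?P \<D>) \<subseteq> cvec.span (?P (insert D \<D>))"
    by (rule cvec.span_minimal) simp
  then show ?case using IH by blast
qed


section \<open>Locally finite operators\<close>

context stable_operator
begin

lemma A_power_closed: "v \<in> S \<Longrightarrow> (A ^^ n) v \<in> S"
  by (induction n) (simp_all add: closed)

definition poly_action :: "complex poly \<Rightarrow> 'a \<Rightarrow> 'a" where
  "poly_action p v = (\<Sum>i\<le>degree p. coeff p i *\<^sub>C (A ^^ i) v)"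

lemma poly_action_bound:
  "degree p \<le> n \<Longrightarrow> poly_action p v = (\<Sum>i\<le>n. coeff p i *\<^sub>C (A ^^ i) v)"
  unfolding poly_action_def by (intro sum.mono_neutral_left) (auto simp: coeff_eq_0)

lemma poly_action_linear_factor:
  assumes v: "v \<in> S"
  shows "poly_action ([:- \<mu>, 1:] * q) v = poly_action q (shift \<mu> v)"
proof -
  define n where "n = degree q"
  have deg: "degree ([:- \<mu>, 1:] * q) \<le> Suc n"
    unfolding n_def using degree_mult_le[of "[:- \<mu>, 1:]" q] by simp
  have pow_shift: "(A ^^ i) (shift \<mu> v) = (A ^^ Suc i) v - \<mu> *\<^sub>C (A ^^ i) v" for i
  proof (induction i)
    case (Suc i)
    then show ?case
      using A_power_closed[OF v, of i] A_power_closed[OF v, of "Suc i"]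
      by (simp add: A_diff A_scale S_scale closed)
  qed simp
  have co: "coeff ([:- \<mu>, 1:] * q) i = (if i = 0 then 0 else coeff q (i - 1)) - \<mu> * coeff q i" for i
    by (cases i) (auto simp: mult_pCons_left)
  have "poly_action ([:- \<mu>, 1:] * q) v = (\<Sum>i\<le>Suc n. coeff ([:- \<mu>, 1:] * q) i *\<^sub>C (A ^^ i) v)"
    using deg by (rule poly_action_bound)
  also have "\<dots> = (\<Sum>i\<le>Suc n. (if i = 0 then 0 else coeff q (i - 1)) *\<^sub>C (A ^^ i) v) -
      (\<Sum>i\<le>Suc n. (\<mu> * coeff q i) *\<^sub>C (A ^^ i) v)"
    by (simp only: co cvec.scale_left_diff_distrib sum_subtractf)
  also have "(\<Sum>i\<le>Suc n. (if i = 0 then 0 else coeff q (i - 1)) *\<^sub>C (A ^^ i) v) =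
      (\<Sum>i\<le>n. coeff q i *\<^sub>C (A ^^ Suc i) v)"
    by (subst sum.atMost_Suc_shift) simp
  also have "(\<Sum>i\<le>Suc n. (\<mu> * coeff q i) *\<^sub>C (A ^^ i) v) = (\<Sum>i\<le>n. (\<mu> * coeff q i) *\<^sub>C (A ^^ i) v)"
    by (simp add: n_def coeff_eq_0)
  also have "(\<Sum>i\<le>n. coeff q i *\<^sub>C (A ^^ Suc i) v) - (\<Sum>i\<le>n. (\<mu> * coeff q i) *\<^sub>C (A ^^ i) v) =
      (\<Sum>i\<le>n. coeff q i *\<^sub>C (A ^^ i) (shift \<mu> v))"
    by (simp add: pow_shift cvec.scale_right_diff_distrib sum_subtractf mult.commute)
  finally show ?thesis
    by (simp add: poly_action_def n_def)
qed

text \<open>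
  Split off a root \<open>\<mu>\<close> of the polynomial; by induction \<open>(A - \<mu>) v\<close> is a sum of generalized
  eigenvectors. Undo \<open>A - \<mu>\<close> on the components at \<open>\<nu> \<noteq> \<mu>\<close>, where it is invertible. What remains is
  mapped by \<open>A - \<mu>\<close> into the generalized eigenspace of \<open>\<mu>\<close> and so belongs to it.
\<close>

lemma killed_by_poly_in_span_geig:
  assumes "p \<noteq> 0" "v \<in> S" "poly_action p v = 0"
  shows "v \<in> cvec.span (\<Union>\<mu>. geig \<mu>)"
  using assms
proof (induction "degree p" arbitrary: p v)
  case 0
  then have "coeff p 0 *\<^sub>C v = 0" by (simp add: poly_action_def)
  then have "v = 0" using 0 by (metis cvec.scale_eq_0_iff leading_coeff_0_iff)
  then show ?case by (simp add: cvec.span_zero)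
next
  case (Suc d)
  let ?G = "cvec.span (\<Union>\<mu>. geig \<mu>)"
  obtain \<mu> where "poly p \<mu> = 0"
    using fundamental_theorem_of_algebra[of p] Suc.hyps(2) constant_degree[of p] by auto
  then obtain q where q: "p = [:- \<mu>, 1:] * q"
    using poly_eq_0_iff_dvd by (metis dvdE)
  have "q \<noteq> 0" using Suc.prems q by auto
  then have "degree q = d"
    using Suc.hyps(2) degree_mult_eq[of "[:- \<mu>, 1:]" q] by (simp add: q)
  then have "shift \<mu> v \<in> ?G"
    using Suc.hyps(1)[of q "shift \<mu> v"] \<open>q \<noteq> 0\<close> Suc.prems poly_action_linear_factor q shift_closed
    by auto
  then obtain F f where f: "finite F" "\<And>\<mu>. f \<mu> \<in> geig \<mu>" "shift \<mu> v = sum f F"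
    using span_geig_components by metis
  have inv: "\<exists>u \<in> geig \<nu>. shift \<mu> u = f \<nu>" if "\<nu> \<noteq> \<mu>" for \<nu>
  proof -
    define N where "N = shift \<mu> ` geig \<nu>"
    have "invariant_subspace A N"
    proof -
      have "cvec.subspace N"
        unfolding N_def using geig_subspace clinear_on_subset[OF shift_linear geig_subset]
        by (rule subspace_image_clinear_on)
      moreover have "A (shift \<mu> u) = shift \<mu> (A u)" if "u \<in> S" for u
        using that by (simp add: A_diff A_scale closed S_scale)
      ultimately show ?thesis
        unfolding invariant_subspace_def N_def using geig_closed geig_subset by fastforce
    qed
    moreover have "shift \<mu> (f \<nu>) \<in> N" using f(2) by (auto simp: N_def)
    ultimately have "f \<nu> \<in> N"
      using invariant_shift_cancel f(2) that by metis
    then show ?thesis by (auto simp: N_def)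
  qed
  define u where "u \<nu> = (SOME u. u \<in> geig \<nu> \<and> shift \<mu> u = f \<nu>)" for \<nu>
  have u: "u \<nu> \<in> geig \<nu> \<and> shift \<mu> (u \<nu>) = f \<nu>" if "\<nu> \<noteq> \<mu>" for \<nu>
    unfolding u_def by (rule someI_ex) (use inv that in blast)
  define w where "w = v - (\<Sum>\<nu>\<in>F - {\<mu>}. u \<nu>)"
  have uS: "u \<nu> \<in> S" if "\<nu> \<in> F - {\<mu>}" for \<nu> using u that geig_subset by blast
  have wS: "w \<in> S" using Suc.prems uS by (auto simp: w_def intro!: S_diff S_sum)
  have "shift \<mu> w = shift \<mu> v - shift \<mu> (\<Sum>\<nu>\<in>F - {\<mu>}. u \<nu>)"
    unfolding w_def using Suc.prems uS by (intro clinear_on_diff[OF subspace shift_linear] S_sum)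
  also have "shift \<mu> (\<Sum>\<nu>\<in>F - {\<mu>}. u \<nu>) = (\<Sum>\<nu>\<in>F - {\<mu>}. shift \<mu> (u \<nu>))"
    using uS by (rule clinear_on_sum[OF subspace shift_linear])
  also have "\<dots> = (\<Sum>\<nu>\<in>F - {\<mu>}. f \<nu>)" using u by (intro sum.cong) auto
  finally have "shift \<mu> w = sum f F - sum f (F - {\<mu>})" using f(3) by simp
  also have "\<dots> = sum f (F \<inter> {\<mu>})"
    using f(1) by (simp add: sum.Int_Diff[of F f "{\<mu>}"])
  also have "\<dots> \<in> geig \<mu>"
    using f(2) by (intro cvec.subspace_sum[OF geig_subspace]) auto
  finally have "w \<in> geig \<mu>" using wS shift_preimage_geig by blast
  then have "w \<in> ?G" by (auto intro: cvec.span_base)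
  moreover have "(\<Sum>\<nu>\<in>F - {\<mu>}. u \<nu>) \<in> ?G"
    using u by (intro cvec.span_sum) (auto intro: cvec.span_base)
  ultimately have "w + (\<Sum>\<nu>\<in>F - {\<mu>}. u \<nu>) \<in> ?G" by (rule cvec.span_add)
  then show ?case by (simp add: w_def)
qed

text \<open>
  A linear relation between \<open>v, A v, A\<^sup>2 v, \<dots>\<close> is a polynomial in \<open>A\<close> that kills \<open>v\<close>. If these vectors
  are not distinct, a repetition is such a relation; otherwise they are too many to be independent.
\<close>

lemma fin_dim_invariant_in_span_geig:
  assumes "fin_dim U" "invariant_subspace A U" "U \<subseteq> S" "v \<in> U"
  shows "v \<in> cvec.span (\<Union>\<mu>. geig \<mu>)"
proof -
  obtain X where X: "finite X" "U = cvec.span X"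
    using assms(1) by (auto simp: fin_dim_def)
  have pow: "(A ^^ i) v \<in> U" for i
    using assms(2,4) by (induction i) (auto simp: invariant_subspace_def)
  have "\<exists>c n. (\<exists>i\<le>n. c i \<noteq> 0) \<and> (\<Sum>i\<le>n. c i *\<^sub>C (A ^^ i) v) = 0"
  proof (cases "inj_on (\<lambda>i. (A ^^ i) v) {..card X}")
    case True
    let ?P = "(\<lambda>i. (A ^^ i) v) ` {..card X}"
    have "card ?P = Suc (card X)" using card_image[OF True] by simp
    moreover have "?P \<subseteq> cvec.span X" using pow X(2) by auto
    ultimately have "cvec.dependent ?P"
      using cvec.independent_span_bound[OF X(1)] by fastforce
    then obtain u where u: "\<exists>v\<in>?P. u v \<noteq> 0" "(\<Sum>v\<in>?P. u v *\<^sub>C v) = 0"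
      using cvec.dependent_finite[of ?P] by auto
    have "(\<Sum>i\<le>card X. u ((A ^^ i) v) *\<^sub>C (A ^^ i) v) = 0"
      using u(2) sum.reindex[OF True, of "\<lambda>v. u v *\<^sub>C v"] by simp
    then show ?thesis
      using u(1) by (intro exI[of _ "\<lambda>i. u ((A ^^ i) v)"] exI[of _ "card X"]) auto
  next
    case False
    then obtain i j where ij: "i \<le> card X" "j \<le> card X" "i \<noteq> j" "(A ^^ i) v = (A ^^ j) v"
      by (auto simp: inj_on_def)
    define c where "c l = (if l = i then 1 else 0) - (if l = j then 1 else (0::complex))" for l
    have "(\<Sum>l\<le>card X. c l *\<^sub>C (A ^^ l) v) =
        (\<Sum>l\<le>card X. (if l = i then (A ^^ i) v else 0) - (if l = j then (A ^^ j) v else 0))"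
      using ij by (intro sum.cong) (auto simp: c_def)
    also have "\<dots> = 0" using ij by (simp add: sum_subtractf)
    finally show ?thesis
      using ij by (intro exI[of _ c] exI[of _ "card X"]) (auto simp: c_def intro: exI[of _ i])
  qed
  then obtain c n where c: "\<exists>i\<le>n. c i \<noteq> 0" "(\<Sum>i\<le>n. c i *\<^sub>C (A ^^ i) v) = 0" by blast
  define p where "p = (\<Sum>i\<le>n. monom (c i) i)"
  have co: "coeff p i = (if i \<le> n then c i else 0)" for i
    by (simp add: p_def coeff_sum)
  have "p \<noteq> 0" using c(1) co by (metis coeff_0)
  moreover have "degree p \<le> n" using co by (intro degree_le) simp
  then have "poly_action p v = 0"
    using c(2) co by (simp add: poly_action_bound)
  ultimately show ?thesis
    using killed_by_poly_in_span_geig assms by blast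
qed

lemma fin_dim_invariant_eigenvector:
  assumes "fin_dim U" "invariant_subspace A U" "U \<subseteq> S" "U \<noteq> {0}"
  obtains c v where "v \<in> U" "v \<noteq> 0" "A v = c *\<^sub>C v"
proof -
  have U: "cvec.subspace U" "\<And>v. v \<in> U \<Longrightarrow> A v \<in> U"
    using assms(2) by (auto simp: invariant_subspace_def)
  obtain w where w: "w \<in> U" "w \<noteq> 0"
    using assms(4) cvec.subspace_0[OF U(1)] by auto
  obtain F f where f: "finite F" "\<And>\<mu>. f \<mu> \<in> geig \<mu>" "w = sum f F"
    using span_geig_components[OF fin_dim_invariant_in_span_geig[OF assms(1-3) w(1)]] by metis
  obtain \<mu> where \<mu>: "\<mu> \<in> F" "f \<mu> \<noteq> 0"
    using w(2) f(3) by (meson sum.neutral)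
  have fU: "f \<mu> \<in> U"
    using components_in_invariant[OF assms(2) f(1)] f(2,3) w(1) \<mu>(1) by blast
  define n where "n = (LEAST n. (shift \<mu> ^^ n) (f \<mu>) = 0)"
  have ex: "\<exists>n. (shift \<mu> ^^ n) (f \<mu>) = 0"
    using f(2) by (auto simp: gen_eigenspace_def)
  have n: "(shift \<mu> ^^ n) (f \<mu>) = 0"
    unfolding n_def using ex by (rule LeastI_ex)
  then have "n \<noteq> 0" using \<mu>(2) by (metis funpow_0)
  then obtain m where m: "n = Suc m" using not0_implies_Suc by blast
  define v where "v = (shift \<mu> ^^ m) (f \<mu>)"
  have "v \<noteq> 0"
    using not_less_Least[of m "\<lambda>n. (shift \<mu> ^^ n) (f \<mu>) = 0"] m by (auto simp: v_def n_def)
  moreover have "v \<in> U"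
    unfolding v_def
    by (induction m) (auto intro!: fU cvec.subspace_diff[OF U(1)] cvec.subspace_scale[OF U(1)] U(2))
  moreover have "A v = \<mu> *\<^sub>C v"
    using n by (simp add: m v_def)
  ultimately show ?thesis using that by blast
qed

end

section \<open>Superspaces\<close>

lemma bit_eq_0_or_1: "p = 0 \<or> p = 1" for p :: bit
  by (cases p) auto

lemma bit_add_cancel: "q + (q + p) = p" for p q :: bit
proof -
  have "q + q = 0" using bit_eq_0_or_1[of q] by auto
  then have "q + q + p = p" by (simp only: add_0)
  then show ?thesis by (simp only: add.assoc)
qed

lemma koszul_square [simp]: "koszul p q * koszul p q = 1"
  by (simp add: koszul_def)

lemma koszul_commute: "koszul p q = koszul q p"
  by (auto simp: koszul_def)

lemma koszul_zero [simp]: "koszul 0 q = 1" "koszul p 0 = 1"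
  by (auto simp: koszul_def)

lemma superspace_subspace:
  assumes "superspace S G"
  shows "cvec.subspace S" "cvec.subspace (G p)" "G p \<subseteq> S"
proof -
  have S: "S = {x + y |x y. x \<in> G 0 \<and> y \<in> G 1}" and sub': "cvec.subspace (G 0)" "cvec.subspace (G 1)"
    using assms unfolding superspace_def by blast+
  show "cvec.subspace S" using assms unfolding superspace_def by blast
  show sub: "cvec.subspace (G p)" for p
    using sub' bit_eq_0_or_1[of p] by auto
  show "G p \<subseteq> S"
  proof
    fix x assume x: "x \<in> G p"
    have "x = x + 0" "x = 0 + x" by simp_all
    then show "x \<in> S"
      unfolding S using bit_eq_0_or_1[of p] x cvec.subspace_0[OF sub] by blast
  qed
qed

lemma superspace_decompose:
  assumes "superspace S G" "x \<in> S"
  obtains x0 x1 where "x0 \<in> G 0" "x1 \<in> G 1" "x = x0 + x1"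
  using assms unfolding superspace_def by blast

lemma superspace_unique:
  assumes "superspace S G" "x0 \<in> G 0" "x1 \<in> G 1" "y0 \<in> G 0" "y1 \<in> G 1" "x0 + x1 = y0 + y1"
  shows "x0 = y0" "x1 = y1"
proof -
  have "x0 - y0 = y1 - x1" using assms(6) by (simp add: algebra_simps)
  then have "x0 - y0 \<in> G 0 \<inter> G 1"
    using cvec.subspace_diff[OF superspace_subspace(2)[OF assms(1)]] assms(2-5) by (metis IntI)
  then have "x0 - y0 = 0" using assms(1) unfolding superspace_def by blast
  then show "x0 = y0" "x1 = y1" using assms(6) by auto
qed

lemma superspace_sum_zero:
  assumes "superspace S G" "x0 \<in> G 0" "x1 \<in> G 1" "x0 + x1 = 0"
  shows "x0 = 0" "x1 = 0"
proof -
  have "0 \<in> G p" for p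
    by (rule cvec.subspace_0[OF superspace_subspace(2)[OF assms(1)]])
  moreover have "x0 + x1 = 0 + 0" using assms(4) by simp
  ultimately show "x0 = 0" "x1 = 0"
    using superspace_unique[OF assms(1-3)] by blast+
qed

lemma graded_subspaceI:
  assumes G: "superspace S G" and N: "cvec.subspace N" "N \<subseteq> S"
    and comp: "\<And>x0 x1. x0 \<in> G 0 \<Longrightarrow> x1 \<in> G 1 \<Longrightarrow> x0 + x1 \<in> N \<Longrightarrow> x0 \<in> N"
  shows "graded_subspace G N"
  unfolding graded_subspace_def superspace_def
proof (intro conjI)
  show "cvec.subspace N" by (rule N(1))
  show "cvec.subspace (N \<inter> G 0)" "cvec.subspace (N \<inter> G 1)"
    by (rule cvec.subspace_inter[OF N(1) superspace_subspace(2)[OF G]])+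
  have "G 0 \<inter> G 1 = {0}" using G by (simp add: superspace_def)
  moreover have "0 \<in> N" by (rule cvec.subspace_0[OF N(1)])
  ultimately show "N \<inter> G 0 \<inter> (N \<inter> G 1) = {0}" by blast
  show "N = {x + y |x y. x \<in> N \<inter> G 0 \<and> y \<in> N \<inter> G 1}"
  proof (intro set_eqI iffI)
    fix x assume x: "x \<in> N"
    obtain x0 x1 where x01: "x0 \<in> G 0" "x1 \<in> G 1" "x = x0 + x1"
      by (rule superspace_decompose[OF G subsetD[OF N(2) x]])
    then have x0: "x0 \<in> N" using comp x by blast
    have "x1 = x - x0" by (simp add: x01)
    then have "x1 \<in> N" using cvec.subspace_diff[OF N(1) x x0] by simp
    then show "x \<in> {x + y |x y. x \<in> N \<inter> G 0 \<and> y \<in> N \<inter> G 1}" using x0 x01 by blast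
  next
    fix x assume "x \<in> {x + y |x y. x \<in> N \<inter> G 0 \<and> y \<in> N \<inter> G 1}"
    then show "x \<in> N" using cvec.subspace_add[OF N(1)] by blast
  qed
qed

lemma graded_subspace_component:
  assumes G: "superspace S G" and N: "graded_subspace G N"
    and x: "x0 \<in> G 0" "x1 \<in> G 1" "x0 + x1 \<in> N"
  shows "x0 \<in> N" "x1 \<in> N"
proof -
  obtain y0 y1 where "y0 \<in> N \<inter> G 0" "y1 \<in> N \<inter> G 1" "x0 + x1 = y0 + y1"
    using superspace_decompose[of N "\<lambda>p. N \<inter> G p"] N x(3) unfolding graded_subspace_def by metis
  then show "x0 \<in> N" "x1 \<in> N"
    using superspace_unique[OF G x(1,2)] by auto
qed

lemma graded_subspace_Int:
  assumes G: "superspace S G" and N: "graded_subspace G N" "graded_subspace G N'" "N \<subseteq> S"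
  shows "graded_subspace G (N \<inter> N')"
proof (rule graded_subspaceI[OF G])
  show "cvec.subspace (N \<inter> N')"
    using N by (intro cvec.subspace_inter) (auto simp: graded_subspace_def superspace_def)
  show "x0 \<in> N \<inter> N'" if "x0 \<in> G 0" "x1 \<in> G 1" "x0 + x1 \<in> N \<inter> N'" for x0 x1
    using that graded_subspace_component[OF G N(1)] graded_subspace_component[OF G N(2)] by blast
qed (use N in auto)


definition even_part :: "(bit \<Rightarrow> 'a::complex_vector set) \<Rightarrow> 'a \<Rightarrow> 'a" where
  "even_part G w = (THE x. x \<in> G 0 \<and> w - x \<in> G 1)"

lemma even_part_eq:
  assumes G: "superspace S G" and x: "x0 \<in> G 0" "x1 \<in> G 1"
  shows "even_part G (x0 + x1) = x0"
  unfolding even_part_def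
proof (rule the_equality)
  show "x0 \<in> G 0 \<and> x0 + x1 - x0 \<in> G 1" using x by simp
next
  fix y assume y: "y \<in> G 0 \<and> x0 + x1 - y \<in> G 1"
  have "y + (x0 + x1 - y) = x0 + x1" by simp
  then show "y = x0" using superspace_unique(1)[OF G _ _ x] y by blast
qed

lemma even_part_linear:
  assumes G: "superspace S G"
  shows "clinear_on S (even_part G)"
proof (rule clinear_onI)
  note sub = superspace_subspace(2)[OF G]
  fix x y assume "x \<in> S" "y \<in> S"
  obtain x0 x1 where x: "x0 \<in> G 0" "x1 \<in> G 1" "x = x0 + x1"
    by (rule superspace_decompose[OF G \<open>x \<in> S\<close>])
  obtain y0 y1 where y: "y0 \<in> G 0" "y1 \<in> G 1" "y = y0 + y1"
    by (rule superspace_decompose[OF G \<open>y \<in> S\<close>])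
  have "x + y = (x0 + y0) + (x1 + y1)" by (simp add: x(3) y(3))
  then have "even_part G (x + y) = x0 + y0"
    using even_part_eq[OF G cvec.subspace_add[OF sub x(1) y(1)] cvec.subspace_add[OF sub x(2) y(2)]]
    by simp
  then show "even_part G (x + y) = even_part G x + even_part G y"
    unfolding x(3) y(3) even_part_eq[OF G x(1,2)] even_part_eq[OF G y(1,2)] .
next
  note sub = superspace_subspace(2)[OF G]
  fix c x assume "x \<in> S"
  obtain x0 x1 where x: "x0 \<in> G 0" "x1 \<in> G 1" "x = x0 + x1"
    by (rule superspace_decompose[OF G \<open>x \<in> S\<close>])
  have "even_part G (c *\<^sub>C x) = c *\<^sub>C x0"
    unfolding x(3) cvec.scale_right_distrib
    by (rule even_part_eq[OF G cvec.subspace_scale[OF sub x(1)] cvec.subspace_scale[OF sub x(2)]])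
  then show "even_part G (c *\<^sub>C x) = c *\<^sub>C even_part G x"
    unfolding x(3) even_part_eq[OF G x(1,2)] .
qed

text \<open>Sections over the even and the odd part add up to an even section.\<close>

lemma graded_section_exists:
  fixes T :: "'a::complex_vector \<Rightarrow> 'a"
  assumes G: "superspace A G"
    and U: "\<And>p. cvec.subspace (U p)" "\<And>p. clinear_on (U p) T"
    and surj: "\<And>p a. a \<in> G p \<Longrightarrow> \<exists>u\<in>U p. T u = a"
  obtains s where "clinear_on A s" "\<And>p a. a \<in> G p \<Longrightarrow> s a \<in> U p \<and> T (s a) = a"
proof -
  have "\<exists>s. clinear_on UNIV s \<and> (\<forall>a\<in>G p. s a \<in> U p \<and> T (s a) = a)" for p
    using linear_section_exists[OF U(1)[of p] U(2)[of p] superspace_subspace(2)[OF G] surj] by metis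
  then obtain s where s: "\<And>p. clinear_on UNIV (s p)" "\<And>p a. a \<in> G p \<Longrightarrow> s p a \<in> U p \<and> T (s p a) = a"
    by metis
  have s_zero: "s p 0 = 0" for p using clinear_on_zero[OF cvec.subspace_UNIV s(1)] .
  define t where "t a = s 0 (even_part G a) + s 1 (a - even_part G a)" for a
  have "clinear_on A t"
  proof (rule clinear_onI)
    note e = even_part_linear[OF G]
    fix x y assume xy: "x \<in> A" "y \<in> A"
    have odd: "x + y - even_part G (x + y) = (x - even_part G x) + (y - even_part G y)"
      by (simp add: clinear_on_add[OF e xy])
    show "t (x + y) = t x + t y"
      unfolding t_def by (subst odd) (simp add: clinear_on_add[OF s(1)] clinear_on_add[OF e xy])
  next
    note e = even_part_linear[OF G]
    fix c x assume x: "x \<in> A"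
    have "c *\<^sub>C x - even_part G (c *\<^sub>C x) = c *\<^sub>C (x - even_part G x)"
      by (simp add: clinear_on_scale[OF e x] cvec.scale_right_diff_distrib)
    then show "t (c *\<^sub>C x) = c *\<^sub>C t x"
      by (simp only: t_def clinear_on_scale[OF e x] clinear_on_scale[OF s(1) UNIV_I]
          cvec.scale_right_distrib)
  qed
  moreover have "t a \<in> U p \<and> T (t a) = a" if a: "a \<in> G p" for p a
  proof -
    have zero: "0 \<in> G q" for q by (rule cvec.subspace_0[OF superspace_subspace(2)[OF G]])
    consider "p = 0" | "p = 1" using bit_eq_0_or_1 by blast
    then have "t a = s p a"
    proof cases
      case 1
      then have "even_part G (a + 0) = a" using a zero by (intro even_part_eq[OF G]) auto
      then show ?thesis by (simp add: t_def s_zero 1)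
    next
      case 2
      then have "even_part G (0 + a) = 0" using a zero by (intro even_part_eq[OF G]) auto
      then show ?thesis by (simp add: t_def s_zero 2)
    qed
    then show ?thesis using s(2)[OF a] by simp
  qed
  ultimately show ?thesis using that by blast
qed

lemma fin_dim_Times:
  assumes "fin_dim A" "fin_dim C"
  shows "fin_dim (A \<times> C)"
proof -
  obtain X where X: "finite X" "A = cvec.span X" using assms(1) by (auto simp: fin_dim_def)
  obtain Y where Y: "finite Y" "C = cvec.span Y" using assms(2) by (auto simp: fin_dim_def)
  let ?Z = "(\<lambda>x. (x, 0)) ` X \<union> (\<lambda>y. (0, y)) ` Y"
  have "A \<times> C \<subseteq> cvec.span ?Z"
  proof
    fix z assume "z \<in> A \<times> C"
    then obtain a c where z: "z = (a, c)" "a \<in> cvec.span X" "c \<in> cvec.span Y"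
      using X(2) Y(2) by blast
    have "(a, 0) \<in> cvec.span ?Z"
      using z(2)
    proof (induction rule: cvec.span_induct_alt)
      case base
      show ?case using cvec.span_zero[of ?Z] by (simp add: zero_prod_def)
    next
      case (step l x y)
      have eq: "(l *\<^sub>C x + y, 0) = l *\<^sub>C (x, 0) + (y, 0)" by (simp add: scaleC_prod_def)
      have "(x, 0) \<in> cvec.span ?Z" using step(1) by (intro cvec.span_base) blast
      then show ?case
        unfolding eq using step(2) by (intro cvec.span_add cvec.span_scale)
    qed
    moreover have "(0, c) \<in> cvec.span ?Z"
      using z(3)
    proof (induction rule: cvec.span_induct_alt)
      case base
      show ?case using cvec.span_zero[of ?Z] by (simp add: zero_prod_def)
    next
      case (step l x y)
      have eq: "(0, l *\<^sub>C x + y) = l *\<^sub>C (0, x) + (0, y)" by (simp add: scaleC_prod_def)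
      have "(0, x) \<in> cvec.span ?Z" using step(1) by (intro cvec.span_base) blast
      then show ?case
        unfolding eq using step(2) by (intro cvec.span_add cvec.span_scale)
    qed
    ultimately have "(a, 0) + (0, c) \<in> cvec.span ?Z" by (rule cvec.span_add)
    then show "z \<in> cvec.span ?Z" by (simp add: z(1))
  qed
  moreover have "cvec.subspace (A \<times> C)"
    using fin_dim_imp_subspace[OF assms(1)] fin_dim_imp_subspace[OF assms(2)]
    by (auto simp: cvec.subspace_def zero_prod_def scaleC_prod_def)
  moreover have "?Z \<subseteq> A \<times> C"
    unfolding X(2) Y(2) by (auto intro: cvec.span_base cvec.span_zero)
  ultimately have "A \<times> C = cvec.span ?Z"
    using cvec.span_minimal by blast
  then show ?thesis
    unfolding fin_dim_def using X(1) Y(1) by (intro exI[of _ ?Z]) simp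
qed

lemma superspace_Times:
  assumes "superspace A G" "superspace C H"
  shows "superspace (A \<times> C) (\<lambda>p. G p \<times> H p)"
proof -
  have sub: "cvec.subspace (P \<times> Q)" if "cvec.subspace P" "cvec.subspace Q"
    for P :: "'a set" and Q :: "'b set"
    using that by (auto simp: cvec.subspace_def zero_prod_def scaleC_prod_def)
  note A = superspace_subspace[OF assms(1)] and C = superspace_subspace[OF assms(2)]
  have "G 0 \<inter> G 1 = {0}" "H 0 \<inter> H 1 = {0}" using assms by (simp_all only: superspace_def)
  then have "G 0 \<times> H 0 \<inter> G 1 \<times> H 1 = {0}" by (auto simp: zero_prod_def)
  moreover have "A \<times> C = {x + y |x y. x \<in> G 0 \<times> H 0 \<and> y \<in> G 1 \<times> H 1}"
  proof (intro set_eqI iffI)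
    fix z assume "z \<in> A \<times> C"
    then obtain a c where z: "z = (a, c)" "a \<in> A" "c \<in> C" by blast
    obtain a0 a1 where a: "a0 \<in> G 0" "a1 \<in> G 1" "a = a0 + a1"
      by (rule superspace_decompose[OF assms(1) z(2)])
    obtain c0 c1 where c: "c0 \<in> H 0" "c1 \<in> H 1" "c = c0 + c1"
      by (rule superspace_decompose[OF assms(2) z(3)])
    have "z = (a0, c0) + (a1, c1)" by (simp add: z(1) a(3) c(3))
    then show "z \<in> {x + y |x y. x \<in> G 0 \<times> H 0 \<and> y \<in> G 1 \<times> H 1}" using a c by blast
  next
    fix z assume "z \<in> {x + y |x y. x \<in> G 0 \<times> H 0 \<and> y \<in> G 1 \<times> H 1}"
    then obtain a0 c0 a1 c1 where "a0 \<in> G 0" "c0 \<in> H 0" "a1 \<in> G 1" "c1 \<in> H 1" "z = (a0, c0) + (a1, c1)"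
      by blast
    then show "z \<in> A \<times> C"
      using A(3)[of 0] A(3)[of 1] C(3)[of 0] C(3)[of 1] cvec.subspace_add[OF A(1)] cvec.subspace_add[OF C(1)]
      by (simp add: subset_iff)
  qed
  ultimately show ?thesis
    unfolding superspace_def by (intro conjI sub A C)
qed


section \<open>The Casimir operator of a basic Lie superalgebra\<close>

definition bilinear_map :: "('a::complex_vector \<Rightarrow> 'b::complex_vector \<Rightarrow> 'c::complex_vector) \<Rightarrow> bool" where
  "bilinear_map f \<longleftrightarrow> (\<forall>x. clinear_on UNIV (f x)) \<and> (\<forall>y. clinear_on UNIV (\<lambda>x. f x y))"

lemma bilinear_map_sum:
  assumes "bilinear_map f"
  shows "f (\<Sum>i\<in>F. c i *\<^sub>C u i) y = (\<Sum>i\<in>F. c i *\<^sub>C f (u i) y)"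
    and "f x (\<Sum>i\<in>F. c i *\<^sub>C u' i) = (\<Sum>i\<in>F. c i *\<^sub>C f x (u' i))"
  using assms clinear_on_sum[OF cvec.subspace_UNIV, of "\<lambda>x. f x y" F "\<lambda>i. c i *\<^sub>C u i"]
    clinear_on_sum[OF cvec.subspace_UNIV, of "f x" F "\<lambda>i. c i *\<^sub>C u' i"]
  by (auto simp: bilinear_map_def clinear_on_def)

locale basic_superalgebra =
  fixes g :: "'g::complex_vector lie_sa" and B :: "'g \<Rightarrow> 'g \<Rightarrow> complex"
  assumes basic: "basic_lie_superalgebra g" and form: "basic_form g B"
begin

abbreviation brac :: "'g \<Rightarrow> 'g \<Rightarrow> 'g" where "brac \<equiv> br g"
abbreviation gr :: "bit \<Rightarrow> 'g set" where "gr \<equiv> grade g"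
abbreviation X :: "'g set" where "X \<equiv> some_basis g"
abbreviation dv :: "'g \<Rightarrow> 'g" where "dv \<equiv> dual_vector g B"

lemma lsa: "lie_superalgebra g" and simple: "simple_lie_sa g" and fin: "fin_dim (UNIV :: 'g set)"
  using basic by (auto simp: basic_lie_superalgebra_def simple_lie_sa_def)

lemma gr_super: "superspace UNIV gr"
  using lsa by (simp add: lie_superalgebra_def)

lemma brac_bilinear: "bilinear_map brac"
  using lsa by (auto simp: lie_superalgebra_def bilinear_map_def)

lemma brac_add: "brac x (y + z) = brac x y + brac x z" "brac (x + y) z = brac x z + brac y z"
  and brac_scale: "brac x (c *\<^sub>C y) = c *\<^sub>C brac x y" "brac (c *\<^sub>C x) y = c *\<^sub>C brac x y"
  using brac_bilinear by (auto simp: bilinear_map_def clinear_on_def)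

lemma brac_zero [simp]: "brac x 0 = 0" "brac 0 x = 0"
  using brac_scale(1)[where c = 0 and y = 0] brac_scale(2)[where c = 0 and x = 0] by auto

lemma brac_minus: "brac x (- y) = - brac x y" "brac (- x) y = - brac x y"
  using brac_scale(1)[where c = "-1"] brac_scale(2)[where c = "-1"] by auto

lemma brac_grade: "x \<in> gr p \<Longrightarrow> y \<in> gr q \<Longrightarrow> brac x y \<in> gr (p + q)"
  and brac_skew: "x \<in> gr p \<Longrightarrow> y \<in> gr q \<Longrightarrow> brac x y = - (koszul p q *\<^sub>C brac y x)"
  and jacobi: "x \<in> gr p \<Longrightarrow> y \<in> gr q \<Longrightarrow>
    brac x (brac y z) = brac (brac x y) z + koszul p q *\<^sub>C brac y (brac x z)"
proof -
  note axioms = lsa[unfolded lie_superalgebra_def]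
  have "\<forall>p q. \<forall>x\<in>gr p. \<forall>y\<in>gr q. brac x y \<in> gr (p + q)"
    using axioms by (elim conjE)
  then show "x \<in> gr p \<Longrightarrow> y \<in> gr q \<Longrightarrow> brac x y \<in> gr (p + q)" by blast
  have "\<forall>p q. \<forall>x\<in>gr p. \<forall>y\<in>gr q. brac x y = - (koszul p q *\<^sub>C brac y x)"
    using axioms by (elim conjE)
  then show "x \<in> gr p \<Longrightarrow> y \<in> gr q \<Longrightarrow> brac x y = - (koszul p q *\<^sub>C brac y x)" by blast
  have "\<forall>p q. \<forall>x\<in>gr p. \<forall>y\<in>gr q. \<forall>z.
      brac x (brac y z) = brac (brac x y) z + koszul p q *\<^sub>C brac y (brac x z)"
    using axioms by (elim conjE)
  then show "x \<in> gr p \<Longrightarrow> y \<in> gr q \<Longrightarrow>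
    brac x (brac y z) = brac (brac x y) z + koszul p q *\<^sub>C brac y (brac x z)" by blast
qed

lemma B_add: "B (x + y) z = B x z + B y z" "B z (x + y) = B z x + B z y"
  and B_scale: "B (c *\<^sub>C x) y = c * B x y" "B x (c *\<^sub>C y) = c * B x y"
  and B_invariant: "B (brac x y) z = B x (brac y z)"
  using form by (auto simp: basic_form_def)

lemma B_nondegenerate: "(\<And>y. B x y = 0) \<Longrightarrow> x = 0"
  and B_cross: "x \<in> gr 0 \<Longrightarrow> y \<in> gr 1 \<Longrightarrow> B x y = 0" "x \<in> gr 0 \<Longrightarrow> y \<in> gr 1 \<Longrightarrow> B y x = 0"
  using form by (auto simp: basic_form_def)

lemma B_super: "x \<in> gr p \<Longrightarrow> y \<in> gr q \<Longrightarrow> B x y = koszul p q * B y x"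
proof -
  have "\<forall>p q. \<forall>x\<in>gr p. \<forall>y\<in>gr q. B x y = koszul p q * B y x"
    using form[unfolded basic_form_def] by (elim conjE)
  then show "x \<in> gr p \<Longrightarrow> y \<in> gr q \<Longrightarrow> B x y = koszul p q * B y x" by blast
qed

lemma B_zero [simp]: "B 0 x = 0" "B x 0 = 0"
  using B_scale(1)[where c = 0 and x = 0] B_scale(2)[where c = 0 and y = 0] by auto

lemma B_diff: "B x (y - z) = B x y - B x z"
  using B_add(2)[where z = x and x = "y - z" and y = z] by simp

lemma B_sum: "B (\<Sum>i\<in>F. u i) y = (\<Sum>i\<in>F. B (u i) y)" "B y (\<Sum>i\<in>F. u i) = (\<Sum>i\<in>F. B y (u i))"
  by (induction F rule: infinite_finite_induct) (auto simp: B_add)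

lemma B_nondegenerate_right:
  assumes "\<And>w. B w z = 0"
  shows "z = 0"
proof (rule B_nondegenerate)
  fix w
  obtain z0 z1 where z: "z0 \<in> gr 0" "z1 \<in> gr 1" "z = z0 + z1"
    using superspace_decompose[OF gr_super UNIV_I] by blast
  obtain w0 w1 where w: "w0 \<in> gr 0" "w1 \<in> gr 1" "w = w0 + w1"
    using superspace_decompose[OF gr_super UNIV_I] by blast
  have "B z w0 = B w0 z"
    using z(1,2) w(1) B_cross[of w0 z1] B_super[of z0 0 w0 0] by (simp add: z(3) B_add)
  moreover have "B z w1 = - B w1 z"
    using z(1,2) w(2) B_cross[of z0 w1] B_super[of z1 1 w1 1] by (simp add: z(3) B_add koszul_def)
  ultimately show "B z w = 0" using assms by (simp add: w(3) B_add)
qed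

lemma homogeneous_basis_exists: "\<exists>S. homogeneous_basis g S"
proof -
  obtain Y0 where Y0: "Y0 \<subseteq> gr 0" "cvec.independent Y0" "gr 0 \<subseteq> cvec.span Y0"
    using cvec.maximal_independent_subset by blast
  obtain Y where Y: "Y0 \<subseteq> Y" "Y \<subseteq> gr 0 \<union> gr 1" "cvec.independent Y"
      "gr 0 \<union> gr 1 \<subseteq> cvec.span Y"
    using cvec.maximal_independent_subset_extend[of Y0 "gr 0 \<union> gr 1"] Y0 by blast
  have "x \<in> cvec.span Y" for x
  proof -
    obtain x0 x1 where "x0 \<in> gr 0" "x1 \<in> gr 1" "x = x0 + x1"
      using superspace_decompose[OF gr_super UNIV_I] by blast
    then show ?thesis using Y(4) by (auto intro: cvec.span_add)
  qed
  then show ?thesis using Y by (auto simp: homogeneous_basis_def)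
qed

lemma X_basis: "homogeneous_basis g X"
  unfolding some_basis_def using homogeneous_basis_exists by (rule someI_ex)

lemma X_independent: "cvec.independent X" and X_span: "cvec.span X = UNIV"
  and X_homogeneous: "X \<subseteq> gr 0 \<union> gr 1"
  using X_basis by (auto simp: homogeneous_basis_def)

lemma X_finite: "finite X"
proof -
  obtain Z where "finite Z" "(UNIV :: 'g set) = cvec.span Z"
    using fin by (auto simp: fin_dim_def)
  then show ?thesis using cvec.independent_span_bound[OF _ X_independent] by blast
qed

lemma X_coefficients:
  obtains u where "z = (\<Sum>x\<in>X. u x *\<^sub>C x)"
  using X_span cvec.span_finite[OF X_finite] by (metis (no_types, lifting) UNIV_I imageE)

text \<open>
  The map \<open>z \<mapsto> \<Sum> (x | z) x\<close> is injective because the form is nondegenerate, hence surjective; dual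
  vectors are the preimages of the basis vectors.
\<close>

lemma dual_vector_pairing:
  assumes "y \<in> X" "x \<in> X"
  shows "B x (dv y) = (if x = y then 1 else 0)"
proof -
  interpret fd: finite_dimensional_vector_space "scaleC :: complex \<Rightarrow> 'g \<Rightarrow> 'g" X
    using X_finite X_independent X_span by unfold_locales auto
  define \<Phi> where "\<Phi> z = (\<Sum>x\<in>X. B x z *\<^sub>C x)" for z
  have lin: "Vector_Spaces.linear scaleC scaleC \<Phi>"
    by (simp add: Vector_Spaces.linear_iff cvec.vector_space_axioms \<Phi>_def B_add B_scale
        cvec.scale_left_distrib sum.distrib cvec.scale_sum_right)
  have zero: "z = 0" if "\<And>x. x \<in> X \<Longrightarrow> B x z = 0" for z
  proof (rule B_nondegenerate_right)
    fix w
    obtain u where "w = (\<Sum>x\<in>X. u x *\<^sub>C x)" using X_coefficients by blast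
    then show "B w z = 0" using that by (simp add: B_sum B_scale)
  qed
  have coeff: "B x z = c x" if "\<Phi> z = (\<Sum>x\<in>X. c x *\<^sub>C x)" "x \<in> X" for z c x
  proof -
    have "(\<Sum>x\<in>X. (B x z - c x) *\<^sub>C x) = 0"
      using that(1) by (simp add: \<Phi>_def cvec.scale_left_diff_distrib sum_subtractf)
    then have "B x z - c x = 0"
      using cvec.independentD[OF X_independent X_finite order_refl, of "\<lambda>x. B x z - c x"] that(2) by blast
    then show ?thesis by simp
  qed
  have "inj \<Phi>"
  proof (rule injI)
    fix z w assume "\<Phi> z = \<Phi> w"
    then have "B x z = B x w" if "x \<in> X" for x
      using coeff[of z "\<lambda>x. B x w"] that by (simp add: \<Phi>_def)
    then have "z - w = 0" by (intro zero) (simp add: B_diff)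
    then show "z = w" by simp
  qed
  then have "surj \<Phi>" by (rule fd.linear_inj_imp_surj[OF lin])
  then obtain z where "\<Phi> z = (\<Sum>x\<in>X. (if x = y then 1 else 0) *\<^sub>C x)" by (metis surjD)
  then have z: "\<forall>x\<in>X. B x z = (if x = y then 1 else 0)"
    using coeff[of z "\<lambda>x. if x = y then 1 else 0"] by simp
  have "\<exists>!z. \<forall>x\<in>X. B x z = (if x = y then 1 else 0)"
  proof (rule ex1I[of _ z])
    fix w assume "\<forall>x\<in>X. B x w = (if x = y then 1 else 0)"
    then have "w - z = 0" using z by (intro zero) (simp add: B_diff)
    then show "w = z" by simp
  qed (rule z)
  then have "\<forall>x\<in>X. B x (dv y) = (if x = y then 1 else 0)"
    unfolding dual_vector_def by (rule theI')
  then show ?thesis using assms(2) by blast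
qed

lemma basis_expansion: "(\<Sum>x\<in>X. B z (dv x) *\<^sub>C x) = z"
proof -
  obtain u where u: "z = (\<Sum>x\<in>X. u x *\<^sub>C x)" using X_coefficients by blast
  have "B z (dv y) = u y" if y: "y \<in> X" for y
  proof -
    have "B z (dv y) = (\<Sum>x\<in>X. if x = y then u x else 0)"
      unfolding u B_sum B_scale by (rule sum.cong) (simp_all add: dual_vector_pairing[OF y])
    then show ?thesis using X_finite y by simp
  qed
  then show ?thesis by (simp add: u)
qed

lemma dual_basis_expansion: "(\<Sum>x\<in>X. B x z *\<^sub>C dv x) = z"
proof -
  let ?w = "(\<Sum>x\<in>X. B x z *\<^sub>C dv x) - z"
  have basis: "B y ?w = 0" if y: "y \<in> X" for y
  proof -
    have "B y (\<Sum>x\<in>X. B x z *\<^sub>C dv x) = (\<Sum>x\<in>X. if x = y then B x z else 0)"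
      unfolding B_sum B_scale by (rule sum.cong) (auto simp: dual_vector_pairing[OF _ y])
    also have "\<dots> = B y z" using X_finite y by simp
    finally show ?thesis by (simp add: B_diff)
  qed
  have "?w = 0"
  proof (rule B_nondegenerate_right)
    fix w
    obtain u where "w = (\<Sum>x\<in>X. u x *\<^sub>C x)" using X_coefficients by blast
    then show "B w ?w = 0" using basis by (simp add: B_sum(1) B_scale)
  qed
  then show ?thesis by simp
qed

text \<open>
  Expand one factor in the basis and use \<open>(a | [x, b]) = ([a, x] | b)\<close>; in this form no signs occur.
  With the universal bilinear map for \<open>f\<close>, this is the invariance of \<open>\<Sum> x\<^sup>* \<otimes> x\<close>.
\<close>

lemma casimir_tensor_invariant:
  assumes f: "bilinear_map f"
  shows "(\<Sum>i\<in>X. f (brac x (dv i)) i) = (\<Sum>i\<in>X. f (dv i) (brac i x))"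
proof -
  have "(\<Sum>i\<in>X. f (brac x (dv i)) i) = (\<Sum>i\<in>X. f (\<Sum>j\<in>X. B j (brac x (dv i)) *\<^sub>C dv j) i)"
    by (simp only: dual_basis_expansion)
  also have "\<dots> = (\<Sum>i\<in>X. \<Sum>j\<in>X. B (brac j x) (dv i) *\<^sub>C f (dv j) i)"
    by (simp add: bilinear_map_sum[OF f] B_invariant)
  also have "\<dots> = (\<Sum>j\<in>X. \<Sum>i\<in>X. B (brac j x) (dv i) *\<^sub>C f (dv j) i)"
    by (rule sum.swap)
  also have "\<dots> = (\<Sum>j\<in>X. f (dv j) (\<Sum>i\<in>X. B (brac j x) (dv i) *\<^sub>C i))"
    by (simp add: bilinear_map_sum[OF f])
  also have "\<dots> = (\<Sum>j\<in>X. f (dv j) (brac j x))"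
    by (simp only: basis_expansion)
  finally show ?thesis .
qed

text \<open>
  The component of the wrong parity is orthogonal to all basis vectors: to those of the parity of
  \<open>i\<close> because the form is even, to the others because \<open>i\<close> is not among them.
\<close>

lemma dual_vector_parity:
  assumes i: "i \<in> X" "i \<in> gr q"
  shows "dv i \<in> gr q"
proof -
  obtain d0 d1 where d: "d0 \<in> gr 0" "d1 \<in> gr 1" "dv i = d0 + d1"
    using superspace_decompose[OF gr_super UNIV_I] by blast
  have nz: "i \<noteq> 0" using X_independent i(1) cvec.dependent_zero by blast
  have wrong: "d = 0" if "d \<in> gr r" "r \<noteq> q" "d' \<in> gr q" "dv i = d + d'" for d d' r
  proof (rule B_nondegenerate_right)
    fix w
    have cross: "B j e = 0" if "j \<in> gr s" "e \<in> gr s'" "s \<noteq> s'" for j e s s'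
      using that B_cross bit_eq_0_or_1[of s] bit_eq_0_or_1[of s'] by auto
    have "B j d = 0" if j: "j \<in> X" for j
    proof -
      obtain s where s: "j \<in> gr s" using j X_homogeneous by blast
      show ?thesis
      proof (cases "s = r")
        case False
        then show ?thesis using cross s that(1) j \<open>d \<in> gr r\<close> by blast
      next
        case True
        then have "j \<noteq> i"
          using s i(2) nz gr_super \<open>r \<noteq> q\<close> bit_eq_0_or_1[of q] bit_eq_0_or_1[of r]
          unfolding superspace_def by auto
        then have "B j (dv i) = 0" using dual_vector_pairing[OF i(1) j] by simp
        moreover have "B j d' = 0" using cross s True \<open>r \<noteq> q\<close> \<open>d' \<in> gr q\<close> by blast
        ultimately show ?thesis using \<open>dv i = d + d'\<close> by (simp add: B_add)
      qed
    qed
    then show "B w d = 0"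
      using X_coefficients[of w] by (metis (no_types, lifting) B_scale(1) B_sum(1) mult_zero_right sum.neutral)
  qed
  show ?thesis
  proof (cases "q = 0")
    case True
    then have "d1 = 0" using wrong[of d1 1 d0] d by (simp add: add.commute)
    then show ?thesis using d True by simp
  next
    case False
    then have "q = 1" using bit_eq_0_or_1 by blast
    then have "d0 = 0" using wrong[of d0 0 d1] d by simp
    then show ?thesis using d \<open>q = 1\<close> by simp
  qed
qed

lemma basis_parity:
  assumes "i \<in> X"
  obtains q where "i \<in> gr q" "dv i \<in> gr q"
  using assms X_homogeneous dual_vector_parity by blast

lemma casimir_linear: "clinear_on UNIV (casimir_adj g B)"
  by (rule clinear_onI)
    (simp_all add: casimir_adj_def brac_add brac_scale sum.distrib cvec.scale_sum_right)

text \<open>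
  The Jacobi identity moves \<open>x\<close> to the right through both factors; the two commutator terms cancel by
  the invariance of the tensor.
\<close>

lemma casimir_commutes_homogeneous:
  assumes x: "x \<in> gr p"
  shows "brac x (casimir_adj g B y) = casimir_adj g B (brac x y)"
proof -
  define f where "f a b = brac a (brac b y)" for a b
  have f: "bilinear_map f"
    by (auto simp: bilinear_map_def f_def brac_add brac_scale intro!: clinear_onI)
  have "brac x (casimir_adj g B y) = (\<Sum>i\<in>X. brac x (brac (dv i) (brac i y)))"
    unfolding casimir_adj_def using bilinear_map_sum(2)[OF brac_bilinear, where c = "\<lambda>_. 1"] by simp
  also have "\<dots> = (\<Sum>i\<in>X. f (brac x (dv i)) i - f (dv i) (brac i x) + brac (dv i) (brac i (brac x y)))"
  proof (rule sum.cong[OF refl])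
    fix i assume "i \<in> X"
    then obtain q where q: "i \<in> gr q" "dv i \<in> gr q" using basis_parity by blast
    have "koszul p q *\<^sub>C brac (brac x i) y = - brac (brac i x) y"
      using brac_skew[OF x q(1)] koszul_commute[of p q]
      by (simp add: brac_minus brac_scale brac_skew[OF q(1) x])
    then have "koszul p q *\<^sub>C brac x (brac i y) = - brac (brac i x) y + brac i (brac x y)"
      by (simp add: jacobi[OF x q(1)] cvec.scale_right_distrib)
    then have "koszul p q *\<^sub>C brac (dv i) (brac x (brac i y)) =
        - brac (dv i) (brac (brac i x) y) + brac (dv i) (brac i (brac x y))"
      by (metis brac_add(1) brac_minus(1) brac_scale(1))
    then show "brac x (brac (dv i) (brac i y)) =
        f (brac x (dv i)) i - f (dv i) (brac i x) + brac (dv i) (brac i (brac x y))"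
      by (simp add: jacobi[OF x q(2)] f_def)
  qed
  also have "\<dots> = casimir_adj g B (brac x y)"
    using casimir_tensor_invariant[OF f, of x]
    by (simp add: sum.distrib sum_subtractf casimir_adj_def)
  finally show ?thesis .
qed

lemma casimir_even: "y \<in> gr p \<Longrightarrow> casimir_adj g B y \<in> gr p"
proof -
  assume y: "y \<in> gr p"
  have "brac (dv i) (brac i y) \<in> gr p" if i: "i \<in> X" for i
  proof -
    obtain q where "i \<in> gr q" "dv i \<in> gr q" using basis_parity[OF i] by metis
    then have "brac (dv i) (brac i y) \<in> gr (q + (q + p))"
      using brac_grade y by blast
    then show ?thesis by (simp only: bit_add_cancel)
  qed
  then show ?thesis
    unfolding casimir_adj_def by (intro cvec.subspace_sum superspace_subspace(2)[OF gr_super])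
qed

text \<open>
  Schur's lemma: an eigenspace of the Casimir operator is a nonzero graded ideal, so it is
  everything.
\<close>

lemma casimir_scalar: "casimir_adj g B y = (2 * dual_coxeter g B) *\<^sub>C y"
proof -
  let ?C = "casimir_adj g B"
  interpret C: stable_operator UNIV ?C
    by unfold_locales (auto simp: casimir_linear)
  obtain a b where "brac a b \<noteq> 0" using simple by (auto simp: simple_lie_sa_def)
  then have nontrivial: "(UNIV :: 'g set) \<noteq> {0}" by blast
  obtain c v where v: "v \<noteq> 0" "?C v = c *\<^sub>C v"
  proof -
    have "invariant_subspace ?C UNIV" by (simp add: invariant_subspace_def)
    from C.fin_dim_invariant_eigenvector[OF fin this subset_UNIV nontrivial] that
    show ?thesis by metis
  qed
  define I where "I = {y. ?C y = c *\<^sub>C y}"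
  have I: "cvec.subspace I"
    unfolding I_def by (rule cvec.subspaceI)
      (auto simp: C.A_zero C.A_add C.A_scale cvec.scale_right_distrib mult.commute)
  have "graded_subspace gr I"
  proof (rule graded_subspaceI[OF gr_super I subset_UNIV])
    fix x0 x1 assume x: "x0 \<in> gr 0" "x1 \<in> gr 1" "x0 + x1 \<in> I"
    then have "(?C x0 - c *\<^sub>C x0) + (?C x1 - c *\<^sub>C x1) = 0"
      by (simp add: I_def C.A_add cvec.scale_right_distrib algebra_simps)
    moreover have "?C x0 - c *\<^sub>C x0 \<in> gr 0" "?C x1 - c *\<^sub>C x1 \<in> gr 1"
      using x casimir_even superspace_subspace(2)[OF gr_super]
      by (auto intro!: cvec.subspace_diff cvec.subspace_scale)
    ultimately have "?C x0 - c *\<^sub>C x0 = 0" using superspace_sum_zero[OF gr_super] by blast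
    then show "x0 \<in> I" by (simp add: I_def)
  qed
  moreover have "brac x y \<in> I" if y: "y \<in> I" for x y
  proof -
    obtain x0 x1 where x: "x0 \<in> gr 0" "x1 \<in> gr 1" "x = x0 + x1"
      using superspace_decompose[OF gr_super UNIV_I] by blast
    have "brac x' y \<in> I" if "x' \<in> gr p" for x' p
      using casimir_commutes_homogeneous[OF that, of y] y by (simp add: I_def brac_scale)
    then show ?thesis using x cvec.subspace_add[OF I] by (simp add: brac_add)
  qed
  moreover have "I \<noteq> {0}" using v by (auto simp: I_def)
  ultimately have "I = UNIV" using simple unfolding simple_lie_sa_def by blast
  then have C: "?C y = (2 * (c / 2)) *\<^sub>C y" for y by (auto simp: I_def)
  have "dual_coxeter g B = c / 2"
    unfolding dual_coxeter_def
  proof (rule the_equality)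
    fix d assume "\<forall>y. ?C y = (2 * d) *\<^sub>C y"
    then have "(2 * d) *\<^sub>C v = (2 * (c / 2)) *\<^sub>C v" using C by metis
    then have "2 * d = 2 * (c / 2)" using v(1) cvec.scale_cancel_right by blast
    then show "d = c / 2" by (metis mult_cancel_left zero_neq_numeral)
  qed (use C in blast)
  then show ?thesis using C[of y] by (simp only:)
qed

end

section \<open>Modules over vertex superalgebras\<close>

lemma Sum_any_eq_sum_lessThan:
  fixes f :: "nat \<Rightarrow> 'a::comm_monoid_add"
  assumes "\<And>j. j \<ge> J \<Longrightarrow> f j = 0"
  shows "Sum_any f = (\<Sum>j<J. f j)"
proof -
  have "{j. f j \<noteq> 0} \<subseteq> {..<J}"
    using assms not_less by blast
  then show ?thesis by (intro Sum_any.expand_superset) auto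
qed

definition adjoint_module :: "'v vertex_sa \<Rightarrow> ('v, 'v) vmod" where
  "adjoint_module V = \<lparr> carrier = UNIV, mgrade = vgrade V, act = nprod V \<rparr>"

lemma adjoint_module_simps:
  "carrier (adjoint_module V) = UNIV" "mgrade (adjoint_module V) = vgrade V"
  "act (adjoint_module V) = nprod V"
  by (simp_all add: adjoint_module_def)

lemma adjoint_weak_module:
  assumes "vertex_superalgebra V"
  shows "weak_module V (adjoint_module V)"
  using assms unfolding vertex_superalgebra_def weak_module_def adjoint_module_def by simp

lemma minus_one_gbinomial: "(- 1) ^ j * (of_int (- 1) gchoose j) = (1 :: complex)"
proof -
  have "((- 1 :: complex) gchoose j) = (- 1) ^ j * (of_nat j gchoose j)"
    using gbinomial_minus[of "1 :: complex" j] by simp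
  also have "(of_nat j gchoose j :: complex) = 1"
    using binomial_gbinomial[of j j, where 'a = complex] by simp
  finally show ?thesis by (simp flip: power_add mult_2)
qed

locale vertex_module =
  fixes V :: "'v::complex_vector vertex_sa" and M :: "('v, 'm::complex_vector) vmod"
  assumes va: "vertex_superalgebra V" and weak: "weak_module V M"
begin

abbreviation a_mode :: "'v \<Rightarrow> int \<Rightarrow> 'm \<Rightarrow> 'm" where "a_mode \<equiv> act M"
abbreviation S :: "'m set" where "S \<equiv> carrier M"

lemma V_super: "superspace UNIV (vgrade V)"
  using va by (simp add: vertex_superalgebra_def)

lemma M_super: "superspace S (mgrade M)"
  using weak by (simp add: weak_module_def)

lemmas S_subspace = superspace_subspace(1)[OF M_super]
  and grade_subspace = superspace_subspace(2)[OF M_super]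
  and grade_subset = superspace_subspace(3)[OF M_super]

lemma mode_linear: "clinear_on S (a_mode a n)"
  and mode_linear_left: "w \<in> S \<Longrightarrow> clinear_on UNIV (\<lambda>a. a_mode a n w)"
  and mode_vac: "w \<in> S \<Longrightarrow> a_mode (vac V) n w = (if n = - 1 then w else 0)"
  and mode_truncation: "w \<in> S \<Longrightarrow> \<exists>N. \<forall>n\<ge>N. a_mode a n w = 0"
  using weak by (auto simp: weak_module_def)

lemma mode_grade: "a \<in> vgrade V p \<Longrightarrow> w \<in> mgrade M q \<Longrightarrow> a_mode a n w \<in> mgrade M (p + q)"
proof -
  have "\<forall>p q n. \<forall>a\<in>vgrade V p. \<forall>w\<in>mgrade M q. a_mode a n w \<in> mgrade M (p + q)"
    using weak[unfolded weak_module_def] by (elim conjE)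
  then show "a \<in> vgrade V p \<Longrightarrow> w \<in> mgrade M q \<Longrightarrow> a_mode a n w \<in> mgrade M (p + q)" by blast
qed

lemma borcherds: "a \<in> vgrade V p \<Longrightarrow> b \<in> vgrade V q \<Longrightarrow> w \<in> S \<Longrightarrow>
  borcherds_identity (nprod V) a_mode p q a b w"
proof -
  have "\<forall>p q. \<forall>a\<in>vgrade V p. \<forall>b\<in>vgrade V q. \<forall>w\<in>S. borcherds_identity (nprod V) a_mode p q a b w"
    using weak[unfolded weak_module_def] by (elim conjE)
  then show "a \<in> vgrade V p \<Longrightarrow> b \<in> vgrade V q \<Longrightarrow> w \<in> S \<Longrightarrow>
    borcherds_identity (nprod V) a_mode p q a b w" by blast
qed

lemma mode_closed:
  assumes w: "w \<in> S"
  shows "a_mode a n w \<in> S"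
proof -
  obtain a0 a1 where a: "a0 \<in> vgrade V 0" "a1 \<in> vgrade V 1" "a = a0 + a1"
    by (rule superspace_decompose[OF V_super UNIV_I])
  obtain w0 w1 where w': "w0 \<in> mgrade M 0" "w1 \<in> mgrade M 1" "w = w0 + w1"
    by (rule superspace_decompose[OF M_super w])
  have w01: "w0 \<in> S" "w1 \<in> S" using w' grade_subset by blast+
  have "a_mode a' n w' \<in> S" if "a' \<in> vgrade V p" "w' \<in> mgrade M q" for a' w' p q
    using mode_grade[OF that] grade_subset by blast
  moreover have "a_mode a n w = (a_mode a0 n w0 + a_mode a0 n w1) + (a_mode a1 n w0 + a_mode a1 n w1)"
    using w w01 clinear_on_add[OF mode_linear_left[OF w], of a0 a1 n]
    by (simp add: a(3)) (simp add: w'(3) clinear_on_add[OF mode_linear])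
  ultimately show ?thesis
    using a w' by (simp add: cvec.subspace_add[OF S_subspace])
qed

lemma mode_sum_left:
  assumes "w \<in> S"
  shows "a_mode (\<Sum>i\<in>F. u i) n w = (\<Sum>i\<in>F. a_mode (u i) n w)"
  using clinear_on_sum[OF cvec.subspace_UNIV mode_linear_left[OF assms]] by simp

lemma mode_add_left: "w \<in> S \<Longrightarrow> a_mode (a + b) n w = a_mode a n w + a_mode b n w"
  and mode_scale_left: "w \<in> S \<Longrightarrow> a_mode (c *\<^sub>C a) n w = c *\<^sub>C a_mode a n w"
  using clinear_on_add[OF mode_linear_left] clinear_on_scale[OF mode_linear_left] by auto

lemma mode_zero_left: "w \<in> S \<Longrightarrow> a_mode 0 n w = 0"
  using mode_scale_left[of w 0 0 n] by simp

lemmas mode_add = clinear_on_add[OF mode_linear]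
  and mode_diff = clinear_on_diff[OF S_subspace mode_linear]
  and mode_scale = clinear_on_scale[OF mode_linear]
  and mode_zero = clinear_on_zero[OF S_subspace mode_linear]

text \<open>The Borcherds identity with \<open>n = 0\<close>, where only \<open>j = 0\<close> survives on the right.\<close>

lemma commutator_formula:
  assumes ab: "a \<in> vgrade V p" "b \<in> vgrade V q" and w: "w \<in> S"
    and J: "\<And>j. j \<ge> J \<Longrightarrow> nprod V a (int j) b = 0"
  shows "a_mode a m (a_mode b l w) = koszul p q *\<^sub>C a_mode b l (a_mode a m w) +
    (\<Sum>j<J. (of_int m gchoose j) *\<^sub>C a_mode (nprod V a (int j) b) (m + l - int j) w)"
proof -
  have "Sum_any (\<lambda>j::nat. (of_int m gchoose j) *\<^sub>C a_mode (nprod V a (0 + int j) b) (m + l - int j) w) =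
     Sum_any (\<lambda>j::nat. ((- 1) ^ j * (of_int 0 gchoose j)) *\<^sub>C
       (a_mode a (m + 0 - int j) (a_mode b (l + int j) w) -
        (koszul p q * (- 1) powi 0) *\<^sub>C a_mode b (0 + l - int j) (a_mode a (m + int j) w)))"
    using borcherds[OF ab w] unfolding borcherds_identity_def by blast
  moreover have "Sum_any (\<lambda>j::nat. ((- 1) ^ j * (of_int 0 gchoose j)) *\<^sub>C
       (a_mode a (m + 0 - int j) (a_mode b (l + int j) w) -
        (koszul p q * (- 1) powi 0) *\<^sub>C a_mode b (0 + l - int j) (a_mode a (m + int j) w))) =
      a_mode a m (a_mode b l w) - koszul p q *\<^sub>C a_mode b l (a_mode a m w)"
    by (subst Sum_any_eq_sum_lessThan[of 1]) (auto simp: gbinomial_0_left)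
  moreover have "Sum_any (\<lambda>j::nat. (of_int m gchoose j) *\<^sub>C a_mode (nprod V a (0 + int j) b) (m + l - int j) w) =
      (\<Sum>j<J. (of_int m gchoose j) *\<^sub>C a_mode (nprod V a (int j) b) (m + l - int j) w)"
    by (subst Sum_any_eq_sum_lessThan[of J]) (auto simp: J mode_zero_left[OF w])
  ultimately have "a_mode a m (a_mode b l w) - koszul p q *\<^sub>C a_mode b l (a_mode a m w) =
      (\<Sum>j<J. (of_int m gchoose j) *\<^sub>C a_mode (nprod V a (int j) b) (m + l - int j) w)"
    by simp
  then show ?thesis by (simp only: diff_eq_eq add.commute)
qed

text \<open>
  The Borcherds identity with \<open>m = 0\<close>. The bound on the summation is left flexible, so that sums for
  different vectors can be given the same range.
\<close>

lemma iterate_formula: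
  assumes ab: "a \<in> vgrade V p" "b \<in> vgrade V q" and w: "w \<in> S"
  shows "\<exists>J. \<forall>K\<ge>J. a_mode (nprod V a n b) l w =
    (\<Sum>j<K. ((- 1) ^ j * (of_int n gchoose j)) *\<^sub>C
      (a_mode a (n - int j) (a_mode b (l + int j) w) -
        (koszul p q * (- 1) powi n) *\<^sub>C a_mode b (n + l - int j) (a_mode a (int j) w)))"
proof -
  obtain N1 where N1: "\<And>m. m \<ge> N1 \<Longrightarrow> a_mode b m w = 0" using mode_truncation[OF w] by blast
  obtain N2 where N2: "\<And>m. m \<ge> N2 \<Longrightarrow> a_mode a m w = 0" using mode_truncation[OF w] by blast
  define J where "J = nat (max (N1 - l) N2)"
  let ?f = "\<lambda>j::nat. ((- 1) ^ j * (of_int n gchoose j)) *\<^sub>C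
      (a_mode a (n - int j) (a_mode b (l + int j) w) -
        (koszul p q * (- 1) powi n) *\<^sub>C a_mode b (n + l - int j) (a_mode a (int j) w))"
  have zero: "?f j = 0" if "j \<ge> J" for j
  proof -
    have "l + int j \<ge> N1" "int j \<ge> N2" using that by (auto simp: J_def)
    then show ?thesis by (simp add: N1 N2 mode_zero)
  qed
  have "Sum_any (\<lambda>j::nat. (of_int 0 gchoose j) *\<^sub>C a_mode (nprod V a (n + int j) b) (0 + l - int j) w) =
     Sum_any (\<lambda>j::nat. ((- 1) ^ j * (of_int n gchoose j)) *\<^sub>C
       (a_mode a (0 + n - int j) (a_mode b (l + int j) w) -
        (koszul p q * (- 1) powi n) *\<^sub>C a_mode b (n + l - int j) (a_mode a (0 + int j) w)))"
    using borcherds[OF ab w] unfolding borcherds_identity_def by blast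
  moreover have "Sum_any (\<lambda>j::nat. (of_int 0 gchoose j) *\<^sub>C a_mode (nprod V a (n + int j) b) (0 + l - int j) w) =
      a_mode (nprod V a n b) l w"
    by (subst Sum_any_eq_sum_lessThan[of 1]) (auto simp: gbinomial_0_left)
  ultimately have "a_mode (nprod V a n b) l w = Sum_any ?f" by simp
  moreover have "Sum_any ?f = (\<Sum>j<K. ?f j)" if "K \<ge> J" for K
    using zero that by (intro Sum_any_eq_sum_lessThan) auto
  ultimately show ?thesis by auto
qed

end


text \<open>
  The consequences of the Borcherds identity concern homogeneous elements only, while generation is
  about subspaces closed under all products. The sums of homogeneous elements of \<open>Q\<close> are closed
  under all products, so it suffices to treat homogeneous ones.
\<close>

lemma vertex_algebra_induct:
  assumes va: "vertex_superalgebra V" and gen: "generated_by V (range \<iota>)"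
    and \<iota>: "clinear_on UNIV \<iota>" "\<And>p. \<iota> ` grade g p \<subseteq> vgrade V p" "superspace UNIV (grade g)"
    and Q: "cvec.subspace Q" "vac V \<in> Q" "\<And>x. \<iota> x \<in> Q"
    and prod: "\<And>p q n a b. a \<in> vgrade V p \<Longrightarrow> b \<in> vgrade V q \<Longrightarrow> a \<in> Q \<Longrightarrow> b \<in> Q \<Longrightarrow> nprod V a n b \<in> Q"
  shows "Q = UNIV"
proof -
  interpret ad: vertex_module V "adjoint_module V"
    using va adjoint_weak_module by unfold_locales
  define W where "W = {a + b |a b. a \<in> vgrade V 0 \<inter> Q \<and> b \<in> vgrade V 1 \<inter> Q}"
  have WI: "a \<in> W" if "a \<in> vgrade V p" "a \<in> Q" for a p
  proof -
    have "0 \<in> vgrade V q \<inter> Q" for q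
      using cvec.subspace_0[OF ad.grade_subspace[of q]] cvec.subspace_0[OF Q(1)] by (simp add: adjoint_module_simps)
    moreover have "a = a + 0" "a = 0 + a" by simp_all
    ultimately show ?thesis
      unfolding W_def using bit_eq_0_or_1[of p] that by blast
  qed
  have W: "cvec.subspace W"
    unfolding W_def using ad.grade_subspace Q(1)
    by (intro cvec.subspace_sums cvec.subspace_inter) (simp_all add: adjoint_module_simps)
  have "W = UNIV"
  proof (rule gen[unfolded generated_by_def, rule_format], intro conjI allI ballI)
    show "cvec.subspace W" by (rule W)
    have "vac V \<in> vgrade V 0" using va by (simp add: vertex_superalgebra_def)
    then show "vac V \<in> W" using WI Q(2) by blast
    show "range \<iota> \<subseteq> W"
    proof
      fix a assume "a \<in> range \<iota>"
      then obtain x where a: "a = \<iota> x" by blast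
      obtain x0 x1 where x: "x0 \<in> grade g 0" "x1 \<in> grade g 1" "x = x0 + x1"
        by (rule superspace_decompose[OF \<iota>(3) UNIV_I])
      have "\<iota> x0 \<in> W" "\<iota> x1 \<in> W" using WI Q(3) \<iota>(2) x(1,2) by blast+
      moreover have "a = \<iota> x0 + \<iota> x1"
        unfolding a x(3) by (rule clinear_on_add[OF \<iota>(1)]) simp_all
      ultimately show "a \<in> W" using cvec.subspace_add[OF W] by blast
    qed
    fix n a b assume a: "a \<in> W" and b: "b \<in> W"
    have prodW: "nprod V a n b \<in> W" if "a \<in> vgrade V p \<inter> Q" "b \<in> vgrade V q \<inter> Q" for a b p q
      using that WI[OF ad.mode_grade[unfolded adjoint_module_simps], of a p b q n] prod by blast
    obtain a0 a1 where a': "a0 \<in> vgrade V 0 \<inter> Q" "a1 \<in> vgrade V 1 \<inter> Q" "a = a0 + a1"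
      using a unfolding W_def by blast
    obtain b0 b1 where b': "b0 \<in> vgrade V 0 \<inter> Q" "b1 \<in> vgrade V 1 \<inter> Q" "b = b0 + b1"
      using b unfolding W_def by blast
    have "nprod V a n b = (nprod V a0 n b0 + nprod V a1 n b0) + (nprod V a0 n b1 + nprod V a1 n b1)"
      unfolding a'(3) b'(3)
      using ad.mode_add[unfolded adjoint_module_simps] ad.mode_add_left[unfolded adjoint_module_simps] by simp
    then show "nprod V a n b \<in> W"
      using prodW[OF a'(1) b'(1)] prodW[OF a'(1) b'(2)] prodW[OF a'(2) b'(1)] prodW[OF a'(2) b'(2)]
      by (simp only: cvec.subspace_add[OF W])
  qed
  moreover have "W \<subseteq> Q" unfolding W_def using cvec.subspace_add[OF Q(1)] by blast
  ultimately show ?thesis by blast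
qed


section \<open>The affine vertex algebra and its Sugawara vector\<close>

locale affine_algebra = basic_superalgebra g B
  for g :: "'g::complex_vector lie_sa" and B +
  fixes k :: complex and V :: "'v::complex_vector vertex_sa" and \<iota> :: "'g \<Rightarrow> 'v"
  assumes noncritical: "k \<noteq> - dual_coxeter g B"
    and affine: "simple_affine_vertex_algebra g B k V \<iota>"
begin

abbreviation \<omega> :: 'v where "\<omega> \<equiv> sugawara g B k V \<iota>"

lemma va: "vertex_superalgebra V"
  using affine by (simp add: simple_affine_vertex_algebra_def simple_vertex_sa_def)

lemma \<iota>_linear: "clinear_on UNIV \<iota>" and \<iota>_grade: "x \<in> gr p \<Longrightarrow> \<iota> x \<in> vgrade V p"
  and \<iota>_even: "\<iota> ` gr p \<subseteq> vgrade V p"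
  and \<iota>_nprod: "nprod V (\<iota> x) 0 (\<iota> y) = \<iota> (brac x y)" "nprod V (\<iota> x) 1 (\<iota> y) = (k * B x y) *\<^sub>C vac V"
    "n \<ge> 2 \<Longrightarrow> nprod V (\<iota> x) n (\<iota> y) = 0"
  and gen: "generated_by V (range \<iota>)"
  using affine by (auto simp: simple_affine_vertex_algebra_def)

lemma \<iota>_add: "\<iota> (x + y) = \<iota> x + \<iota> y" and \<iota>_scale: "\<iota> (c *\<^sub>C x) = c *\<^sub>C \<iota> x"
  using \<iota>_linear by (auto simp: clinear_on_def)

lemma \<iota>_zero: "\<iota> 0 = 0" and \<iota>_minus: "\<iota> (- x) = - \<iota> x"
  using \<iota>_scale[of 0 0] \<iota>_scale[of "-1" x] by auto

lemma \<iota>_sum: "\<iota> (sum u F) = (\<Sum>i\<in>F. \<iota> (u i))"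
  using clinear_on_sum[OF cvec.subspace_UNIV \<iota>_linear] by simp

end

locale affine_module = affine_algebra g B k V \<iota> + vertex_module V M
  for g :: "'g::complex_vector lie_sa" and B k and V :: "'v::complex_vector vertex_sa" and \<iota>
    and M :: "('v, 'm::complex_vector) vmod"
begin

abbreviation cur :: "'g \<Rightarrow> int \<Rightarrow> 'm \<Rightarrow> 'm" where
  "cur x n \<equiv> act M (\<iota> x) n"

lemma cur_add: "w \<in> S \<Longrightarrow> cur (x + y) n w = cur x n w + cur y n w"
  and cur_scale: "w \<in> S \<Longrightarrow> cur (c *\<^sub>C x) n w = c *\<^sub>C cur x n w"
  by (simp_all add: \<iota>_add \<iota>_scale mode_add_left mode_scale_left)

lemma cur_grade: "x \<in> gr p \<Longrightarrow> w \<in> mgrade M q \<Longrightarrow> cur x n w \<in> mgrade M (p + q)"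
  using mode_grade \<iota>_grade by blast

lemma current_commutator:
  assumes x: "x \<in> gr p" and y: "y \<in> gr q" and w: "w \<in> S"
  shows "cur x m (cur y l w) = koszul p q *\<^sub>C cur y l (cur x m w) + cur (brac x y) (m + l) w +
    (if m + l = 0 then (of_int m * k * B x y) *\<^sub>C w else 0)"
proof -
  have J: "nprod V (\<iota> x) (int j) (\<iota> y) = 0" if "j \<ge> 2" for j
    using that by (intro \<iota>_nprod(3)) simp
  have "(\<Sum>j<2. (of_int m gchoose j) *\<^sub>C act M (nprod V (\<iota> x) (int j) (\<iota> y)) (m + l - int j) w) =
      cur (brac x y) (m + l) w + of_int m *\<^sub>C act M ((k * B x y) *\<^sub>C vac V) (m + l - 1) w"
    by (simp add: numeral_2_eq_2 \<iota>_nprod)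
  also have "of_int m *\<^sub>C act M ((k * B x y) *\<^sub>C vac V) (m + l - 1) w =
      (if m + l = 0 then (of_int m * k * B x y) *\<^sub>C w else 0)"
    by (simp add: mode_scale_left[OF w] mode_vac[OF w] mult.assoc)
  finally show ?thesis
    using commutator_formula[OF \<iota>_grade[OF x] \<iota>_grade[OF y] w J] by (simp add: add.assoc)
qed

text \<open>
  The modes of \<open>a\<^sub>(\<^sub>n\<^sub>) b\<close> are sums of products of modes of \<open>a\<close> and \<open>b\<close>, and the currents generate
  \<open>V\<close>. So stability under the currents is stability under \<open>V\<close>, and likewise for commutation.
\<close>

lemma stable_under_currents:
  assumes N: "cvec.subspace N" "N \<subseteq> S" and cur: "\<And>x n w. w \<in> N \<Longrightarrow> cur x n w \<in> N"
    and w: "w \<in> N"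
  shows "act M a n w \<in> N"
proof -
  define Q where "Q = {a. \<forall>n. \<forall>w\<in>N. act M a n w \<in> N}"
  have "Q = UNIV"
  proof (rule vertex_algebra_induct[OF va gen \<iota>_linear \<iota>_even gr_super])
    show "cvec.subspace Q"
      unfolding Q_def using N(2)
      by (intro cvec.subspaceI) (auto simp: mode_zero_left mode_add_left mode_scale_left subset_iff
          cvec.subspace_0[OF N(1)] cvec.subspace_add[OF N(1)] cvec.subspace_scale[OF N(1)])
    show "vac V \<in> Q"
      unfolding Q_def using N(2) by (auto simp: mode_vac subset_iff cvec.subspace_0[OF N(1)])
    show "\<iota> x \<in> Q" for x by (auto simp: Q_def cur)
    fix p q n a b assume ab: "a \<in> vgrade V p" "b \<in> vgrade V q" "a \<in> Q" "b \<in> Q"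
    have "act M (nprod V a n b) l w \<in> N" if w: "w \<in> N" for l w
    proof -
      obtain J where J: "\<forall>K\<ge>J. act M (nprod V a n b) l w = (\<Sum>j<K. ((- 1) ^ j * (of_int n gchoose j)) *\<^sub>C
        (act M a (n - int j) (act M b (l + int j) w) -
          (koszul p q * (- 1) powi n) *\<^sub>C act M b (n + l - int j) (act M a (int j) w)))"
        using iterate_formula[OF ab(1,2)] w N(2) by blast
      have abN: "act M a i u \<in> N" "act M b i u \<in> N" if "u \<in> N" for i u
        using ab(3,4) that by (auto simp: Q_def)
      show ?thesis
        unfolding J[rule_format, OF order_refl]
        by (intro cvec.subspace_sum[OF N(1)] cvec.subspace_scale[OF N(1)] cvec.subspace_diff[OF N(1)] abN w)
    qed
    then show "nprod V a n b \<in> Q" by (simp add: Q_def)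
  qed
  then show ?thesis using w by (auto simp: Q_def)
qed

lemma commuting_with_currents:
  assumes T: "clinear_on S T" "\<And>w. w \<in> S \<Longrightarrow> T w \<in> S"
    and cur: "\<And>x n w. w \<in> S \<Longrightarrow> T (cur x n w) = cur x n (T w)"
    and w: "w \<in> S"
  shows "T (act M a n w) = act M a n (T w)"
proof -
  define Q where "Q = {a. \<forall>n. \<forall>w\<in>S. T (act M a n w) = act M a n (T w)}"
  have "Q = UNIV"
  proof (rule vertex_algebra_induct[OF va gen \<iota>_linear \<iota>_even gr_super])
    show "cvec.subspace Q"
      unfolding Q_def
      by (intro cvec.subspaceI) (auto simp: mode_zero_left mode_add_left mode_scale_left mode_closed
          T(2) clinear_on_zero[OF S_subspace T(1)] clinear_on_add[OF T(1)] clinear_on_scale[OF T(1)])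
    show "vac V \<in> Q"
      unfolding Q_def by (auto simp: mode_vac T(2) clinear_on_zero[OF S_subspace T(1)])
    show "\<iota> x \<in> Q" for x by (auto simp: Q_def cur)
    fix p q n a b assume ab: "a \<in> vgrade V p" "b \<in> vgrade V q" "a \<in> Q" "b \<in> Q"
    have "T (act M (nprod V a n b) l w) = act M (nprod V a n b) l (T w)" if w: "w \<in> S" for l w
    proof -
      let ?f = "\<lambda>w j. ((- 1) ^ j * (of_int n gchoose j)) *\<^sub>C
        (act M a (n - int j) (act M b (l + int j) w) -
          (koszul p q * (- 1) powi n) *\<^sub>C act M b (n + l - int j) (act M a (int j) w))"
      obtain J where J: "\<forall>K\<ge>J. act M (nprod V a n b) l w = (\<Sum>j<K. ?f w j)"
        using iterate_formula[OF ab(1,2) w] by blast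
      obtain J' where J': "\<forall>K\<ge>J'. act M (nprod V a n b) l (T w) = (\<Sum>j<K. ?f (T w) j)"
        using iterate_formula[OF ab(1,2) T(2)[OF w]] by blast
      define K where "K = max J J'"
      have abT: "T (act M a i u) = act M a i (T u)" "T (act M b i u) = act M b i (T u)" if "u \<in> S" for i u
        using ab(3,4) that by (auto simp: Q_def)
      have "T (act M (nprod V a n b) l w) = T (\<Sum>j<K. ?f w j)"
        using J[rule_format, of K] by (simp only: K_def max.cobounded1)
      also have "\<dots> = (\<Sum>j<K. T (?f w j))"
        by (intro clinear_on_sum[OF S_subspace T(1)] cvec.subspace_scale[OF S_subspace]
            cvec.subspace_diff[OF S_subspace] mode_closed w)
      also have "\<dots> = (\<Sum>j<K. ?f (T w) j)"
        using w by (simp add: clinear_on_scale[OF T(1)] clinear_on_diff[OF S_subspace T(1)] abT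
            mode_closed cvec.subspace_diff[OF S_subspace] cvec.subspace_scale[OF S_subspace])
      also have "\<dots> = act M (nprod V a n b) l (T w)"
        using J'[rule_format, of K] by (simp only: K_def max.cobounded2)
      finally show ?thesis .
    qed
    then show "nprod V a n b \<in> Q" by (simp add: Q_def)
  qed
  then show ?thesis using w by (auto simp: Q_def)
qed

end

context affine_algebra
begin

text \<open>
  The currents are primary of weight one for the Sugawara vector \<open>\<omega>\<close>, up to a multiple of the
  vacuum that does not affect the commutators with \<open>L0\<close>. Each product \<open>x\<^sub>(\<^sub>n\<^sub>) x\<^sub>i\<^sup>*\<^sub>(\<^sub>-\<^sub>1\<^sub>) x\<^sub>i\<close> is
  computed by commuting \<open>x\<^sub>(\<^sub>n\<^sub>)\<close> to the right. For \<open>n = 0\<close> the sum vanishes by the invariance of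
  \<open>\<Sum> x\<^sub>i\<^sup>* \<otimes> x\<^sub>i\<close>; for \<open>n = 1\<close> the central terms give \<open>2 k x\<close> and the double brackets add up to the
  Casimir operator on \<open>x\<close>, which is \<open>2 h x\<close>.
\<close>

lemma current_sugawara_products:
  assumes x: "x \<in> gr p"
  shows "nprod V (\<iota> x) 0 \<omega> = 0" "nprod V (\<iota> x) 1 \<omega> = \<iota> x"
    "\<exists>e. nprod V (\<iota> x) 2 \<omega> = e *\<^sub>C vac V" "n \<ge> 3 \<Longrightarrow> nprod V (\<iota> x) n \<omega> = 0"
proof -
  let ?h = "dual_coxeter g B"
  interpret ad: affine_module g B k V \<iota> "adjoint_module V"
    using va adjoint_weak_module by unfold_locales
  note comm = ad.current_commutator[unfolded adjoint_module_simps, OF _ _ UNIV_I]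
  note add = ad.mode_add_left[unfolded adjoint_module_simps, OF UNIV_I] ad.mode_add[unfolded adjoint_module_simps, OF UNIV_I UNIV_I]
  note scale = ad.mode_scale_left[unfolded adjoint_module_simps, OF UNIV_I] ad.mode_scale[unfolded adjoint_module_simps, OF UNIV_I]
  note zero = ad.mode_zero[unfolded adjoint_module_simps]
  note sum_right = clinear_on_sum[OF ad.S_subspace ad.mode_linear, unfolded adjoint_module_simps, OF UNIV_I]
  have vac_right: "nprod V a (- 1) (vac V) = a" "n \<ge> 0 \<Longrightarrow> nprod V a n (vac V) = 0" for a n
    using va by (auto simp: vertex_superalgebra_def)
  define c where "c = 1 / (2 * (k + ?h))"
  have c: "c * (2 * (k + ?h)) = 1"
    using noncritical by (simp add: c_def add_eq_0_iff2)
  define f where "f u v = nprod V (\<iota> u) (- 1) (\<iota> v)" for u v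
  have f: "bilinear_map f"
    unfolding bilinear_map_def f_def
    by (auto intro!: clinear_onI simp: \<iota>_add \<iota>_scale add scale)
  have f_right: "f u (a *\<^sub>C v) = a *\<^sub>C f u v" for u a v
    by (simp add: f_def \<iota>_scale scale)
  have \<omega>: "nprod V (\<iota> x) n \<omega> = c *\<^sub>C (\<Sum>i\<in>X. nprod V (\<iota> x) n (f (dv i) i))" for n
    unfolding sugawara_def by (simp add: c_def f_def scale sum_right)
  have product: "nprod V (\<iota> x) m (f (dv i) i) = koszul p q *\<^sub>C nprod V (\<iota> (dv i)) (- 1) (nprod V (\<iota> x) m (\<iota> i)) +
      nprod V (\<iota> (brac x (dv i))) (m - 1) (\<iota> i) + (if m = 1 then (k * B x (dv i)) *\<^sub>C \<iota> i else 0)"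
    if "dv i \<in> gr q" for m i q
    unfolding f_def by (subst comm[OF x that]) simp
  show "nprod V (\<iota> x) 0 \<omega> = 0"
  proof -
    have "nprod V (\<iota> x) 0 (f (dv i) i) = f (brac x (dv i)) i - f (dv i) (brac i x)" if i: "i \<in> X" for i
    proof -
      obtain q where q: "i \<in> gr q" "dv i \<in> gr q" using basis_parity[OF i] by metis
      have "- brac i x = koszul p q *\<^sub>C brac x i"
        unfolding brac_skew[OF q(1) x] koszul_commute[of q p] by simp
      then have "koszul p q *\<^sub>C f (dv i) (brac x i) = f (dv i) (- brac i x)"
        unfolding f_def by (simp only: \<iota>_scale scale)
      also have "\<dots> = - f (dv i) (brac i x)"
        using f_right[of "dv i" "-1" "brac i x"] by simp
      finally have "koszul p q *\<^sub>C f (dv i) (brac x i) = - f (dv i) (brac i x)" .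
      then show ?thesis
        using product[OF q(2), of 0] by (simp add: \<iota>_nprod f_def)
    qed
    then show ?thesis
      unfolding \<omega> using casimir_tensor_invariant[OF f, of x] by (simp add: sum_subtractf)
  qed
  show "nprod V (\<iota> x) 1 \<omega> = \<iota> x"
  proof -
    have summand: "nprod V (\<iota> x) 1 (f (dv i) i) =
        \<iota> ((k * B i x) *\<^sub>C dv i + brac (brac x (dv i)) i + (k * B x (dv i)) *\<^sub>C i)" if i: "i \<in> X" for i
    proof -
      obtain q where q: "i \<in> gr q" "dv i \<in> gr q" using basis_parity[OF i] by metis
      have "koszul p q *\<^sub>C nprod V (\<iota> (dv i)) (- 1) (nprod V (\<iota> x) 1 (\<iota> i)) =
          (k * (koszul p q * B x i)) *\<^sub>C \<iota> (dv i)"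
        by (simp add: \<iota>_nprod scale vac_right mult.left_commute)
      also have "koszul p q * B x i = B i x"
        using B_super[OF q(1) x] koszul_commute[of p q] by simp
      finally show ?thesis
        using product[OF q(2), of 1] by (simp add: \<iota>_nprod \<iota>_add \<iota>_scale)
    qed
    have "(\<Sum>i\<in>X. brac (brac x (dv i)) i) = casimir_adj g B x"
      using casimir_tensor_invariant[OF brac_bilinear, of x] by (simp add: casimir_adj_def)
    then have casimir: "(\<Sum>i\<in>X. brac (brac x (dv i)) i) = (2 * ?h) *\<^sub>C x"
      by (simp add: casimir_scalar)
    have "(\<Sum>i\<in>X. (k * B i x) *\<^sub>C dv i) = k *\<^sub>C x"
      using dual_basis_expansion[of x] by (simp flip: cvec.scale_scale cvec.scale_sum_right)
    moreover have "(\<Sum>i\<in>X. (k * B x (dv i)) *\<^sub>C i) = k *\<^sub>C x"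
      using basis_expansion[of x] by (simp flip: cvec.scale_scale cvec.scale_sum_right)
    ultimately have "(\<Sum>i\<in>X. (k * B i x) *\<^sub>C dv i + brac (brac x (dv i)) i + (k * B x (dv i)) *\<^sub>C i) =
        (2 * (k + ?h)) *\<^sub>C x"
      using casimir by (simp add: sum.distrib algebra_simps flip: cvec.scale_left_distrib)
    then have "nprod V (\<iota> x) 1 \<omega> = c *\<^sub>C \<iota> ((2 * (k + ?h)) *\<^sub>C x)"
      unfolding \<omega> using summand by (simp flip: \<iota>_sum)
    also have "\<dots> = \<iota> x"
      using c by (simp add: \<iota>_scale)
    finally show ?thesis .
  qed
  have high: "nprod V (\<iota> x) n (f (dv i) i) = nprod V (\<iota> (brac x (dv i))) (n - 1) (\<iota> i)"
    if i: "i \<in> X" and "n \<ge> 2" for i n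
  proof -
    obtain q where "dv i \<in> gr q" using basis_parity[OF i] by metis
    then show ?thesis using product[of i q n] \<open>n \<ge> 2\<close> by (simp add: \<iota>_nprod zero)
  qed
  show "\<exists>e. nprod V (\<iota> x) 2 \<omega> = e *\<^sub>C vac V"
  proof
    show "nprod V (\<iota> x) 2 \<omega> = (c * (\<Sum>i\<in>X. k * B (brac x (dv i)) i)) *\<^sub>C vac V"
      unfolding \<omega> using high[of _ 2] by (simp add: \<iota>_nprod flip: cvec.scale_sum_left)
  qed
  show "nprod V (\<iota> x) n \<omega> = 0" if "n \<ge> 3"
    unfolding \<omega> using high[of _ n] that by (simp add: \<iota>_nprod)
qed

end

context affine_algebra
begin

lemma sugawara_even: "\<omega> \<in> vgrade V 0"
proof -
  interpret ad: vertex_module V "adjoint_module V"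
    using va adjoint_weak_module by unfold_locales
  have sub: "cvec.subspace (vgrade V 0)"
    using ad.grade_subspace[of 0] by (simp add: adjoint_module_def)
  have "nprod V (\<iota> (dv i)) (- 1) (\<iota> i) \<in> vgrade V 0" if i: "i \<in> X" for i
  proof -
    obtain q where "i \<in> gr q" "dv i \<in> gr q" using basis_parity[OF i] by metis
    then have "nprod V (\<iota> (dv i)) (- 1) (\<iota> i) \<in> vgrade V (q + q)"
      using ad.mode_grade[of "\<iota> (dv i)" q "\<iota> i" q "- 1"] \<iota>_grade by (simp add: adjoint_module_def)
    moreover have "q + q = 0" using bit_add_cancel[of q 0] by (simp only: add_0_right)
    ultimately show ?thesis by (simp only:)
  qed
  then show ?thesis
    unfolding sugawara_def by (intro cvec.subspace_scale[OF sub] cvec.subspace_sum[OF sub])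
qed

end

context affine_module
begin

abbreviation L :: "'m \<Rightarrow> 'm" where "L \<equiv> L0 g B k V \<iota> M"

lemma L_closed: "w \<in> S \<Longrightarrow> L w \<in> S" and L_linear: "clinear_on S L"
  by (simp_all add: L0_def[abs_def] mode_closed mode_linear)

lemma L_even: "w \<in> mgrade M p \<Longrightarrow> L w \<in> mgrade M p"
  unfolding L0_def using mode_grade[OF sugawara_even, of w p 1] by (simp only: add_0)

lemma L_current_homogeneous:
  assumes x: "x \<in> gr p" and w: "w \<in> S"
  shows "L (cur x n w) = cur x n (L w) - of_int n *\<^sub>C cur x n w"
proof -
  obtain e where e: "nprod V (\<iota> x) 2 \<omega> = e *\<^sub>C vac V"
    using current_sugawara_products(3)[OF x] by blast
  have J: "nprod V (\<iota> x) (int j) \<omega> = 0" if "j \<ge> 3" for j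
    using that by (intro current_sugawara_products(4)[OF x]) simp
  have "{..<3} = {0, 1, 2 :: nat}" by auto
  then have "(\<Sum>j<3. (of_int n gchoose j) *\<^sub>C act M (nprod V (\<iota> x) (int j) \<omega>) (n + 1 - int j) w) =
      of_int n *\<^sub>C cur x n w + (of_int n gchoose 2) *\<^sub>C act M (e *\<^sub>C vac V) (n - 1) w"
    using current_sugawara_products(1,2)[OF x] by (simp add: e mode_zero_left[OF w])
  \<comment> \<open>The mode \<open>n - 1\<close> of the vacuum is nonzero only for \<open>n = 0\<close>, where the binomial vanishes.\<close>
  also have "(of_int n gchoose 2) *\<^sub>C act M (e *\<^sub>C vac V) (n - 1) w = 0"
    by (auto simp: mode_scale_left[OF w] mode_vac[OF w] gbinomial_0_left)
  finally show ?thesis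
    using commutator_formula[OF \<iota>_grade[OF x] sugawara_even w J, where m = n and l = 1]
    by (simp add: L0_def)
qed

lemma L_current:
  assumes w: "w \<in> S"
  shows "L (cur x n w) = cur x n (L w) + (- of_int n) *\<^sub>C cur x n w"
proof -
  obtain x0 x1 where x: "x0 \<in> gr 0" "x1 \<in> gr 1" "x = x0 + x1"
    by (rule superspace_decompose[OF gr_super UNIV_I])
  have "L (cur x n w) = L (cur x0 n w) + L (cur x1 n w)"
    unfolding x(3) cur_add[OF w] by (rule clinear_on_add[OF L_linear]) (simp_all add: mode_closed w)
  then show ?thesis
    unfolding L_current_homogeneous[OF x(1) w] L_current_homogeneous[OF x(2) w] x(3)
      cur_add[OF w] cur_add[OF L_closed[OF w]]
    by (simp add: cvec.scale_right_distrib)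
qed

lemma zero_mode_commutator:
  assumes h: "h \<in> gr 0" and w: "w \<in> S"
  shows "cur h 0 (cur x n w) = cur x n (cur h 0 w) + cur (brac h x) n w"
proof -
  obtain x0 x1 where x: "x0 \<in> gr 0" "x1 \<in> gr 1" "x = x0 + x1"
    by (rule superspace_decompose[OF gr_super UNIV_I])
  have hom: "cur h 0 (cur y n w) = cur y n (cur h 0 w) + cur (brac h y) n w" if "y \<in> gr q" for y q
    using current_commutator[OF h that w, of 0 n] by simp
  have "cur h 0 (cur x n w) = cur h 0 (cur x0 n w) + cur h 0 (cur x1 n w)"
    unfolding x(3) cur_add[OF w] by (rule mode_add) (simp_all add: mode_closed w)
  then show ?thesis
    unfolding hom[OF x(1)] hom[OF x(2)] x(3) brac_add cur_add[OF w] cur_add[OF mode_closed[OF w]]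
    by simp
qed

text \<open>
  The Casimir operator of \<open>g\<close> in the normalization of \<open>L0\<close>. In normally ordered products the second
  factor comes first, whence the order of the factors and the sign of their parity.
\<close>

definition casimir_zero_modes :: "'m \<Rightarrow> 'm" where
  "casimir_zero_modes w = (1 / (2 * (k + dual_coxeter g B))) *\<^sub>C
     (\<Sum>i\<in>X. (if i \<in> gr 1 then - 1 else 1) *\<^sub>C cur i 0 (cur (dv i) 0 w))"

text \<open>
  Of the terms of \<open>(x\<^sup>*\<^sub>(\<^sub>-\<^sub>1\<^sub>) x)\<^sub>(\<^sub>1\<^sub>)\<close> all but one have a positive mode on the right, which sends \<open>w\<close>
  into \<open>N\<close>. With \<open>N = 0\<close> this is the action of \<open>L0\<close> on singular vectors; in general it avoids passing
  to the quotient by \<open>N\<close>.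
\<close>

lemma L_casimir_modulo:
  assumes N: "cvec.subspace N" "N \<subseteq> S" "\<And>x n w. w \<in> N \<Longrightarrow> cur x n w \<in> N"
    and w: "w \<in> S" and pos: "\<And>x n. n \<ge> 1 \<Longrightarrow> cur x n w \<in> N"
  shows "L w - casimir_zero_modes w \<in> N"
proof -
  let ?c = "1 / (2 * (k + dual_coxeter g B))"
  let ?t = "\<lambda>i. (if i \<in> gr 1 then - 1 else 1) *\<^sub>C cur i 0 (cur (dv i) 0 w)"
  have "L w = ?c *\<^sub>C (\<Sum>i\<in>X. act M (nprod V (\<iota> (dv i)) (- 1) (\<iota> i)) 1 w)"
    unfolding L0_def sugawara_def by (simp add: mode_scale_left[OF w] mode_sum_left[OF w])
  then have eq: "L w - casimir_zero_modes w =
      ?c *\<^sub>C (\<Sum>i\<in>X. act M (nprod V (\<iota> (dv i)) (- 1) (\<iota> i)) 1 w - ?t i)"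
    by (simp add: casimir_zero_modes_def cvec.scale_right_diff_distrib sum_subtractf)
  have "act M (nprod V (\<iota> (dv i)) (- 1) (\<iota> i)) 1 w - ?t i \<in> N" if i: "i \<in> X" for i
  proof -
    obtain q where q: "i \<in> gr q" "dv i \<in> gr q" using basis_parity[OF i] by metis
    have "i \<noteq> 0" using i X_independent cvec.dependent_zero by blast
    then have kos: "koszul q q = (if i \<in> gr 1 then - 1 else 1)"
      using q(1) gr_super bit_eq_0_or_1[of q] unfolding superspace_def koszul_def by auto
    let ?g = "\<lambda>j::nat. cur (dv i) (- 1 - int j) (cur i (1 + int j) w)"
    let ?h = "\<lambda>j::nat. koszul q q *\<^sub>C cur i (- int j) (cur (dv i) (int j) w)"
    obtain J where J: "\<forall>K\<ge>J. act M (nprod V (\<iota> (dv i)) (- 1) (\<iota> i)) 1 w =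
      (\<Sum>j<K. ((- 1) ^ j * (of_int (- 1) gchoose j)) *\<^sub>C
        (cur (dv i) (- 1 - int j) (cur i (1 + int j) w) -
        (koszul q q * (- 1) powi (- 1)) *\<^sub>C cur i (- 1 + 1 - int j) (cur (dv i) (int j) w)))"
      using iterate_formula[OF \<iota>_grade[OF q(2)] \<iota>_grade[OF q(1)] w] by blast
    have "act M (nprod V (\<iota> (dv i)) (- 1) (\<iota> i)) 1 w = (\<Sum>j<Suc J. ?g j + ?h j)"
      unfolding J[rule_format, of "Suc J", OF le_SucI[OF order_refl]] minus_one_gbinomial
      by (rule sum.cong) (simp_all add: power_int_minus)
    also have "\<dots> = (\<Sum>j<Suc J. ?g j) + (?h 0 + (\<Sum>j<J. ?h (Suc j)))"
      by (simp only: sum.distrib sum.lessThan_Suc_shift)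
    also have "\<dots> = ?t i + ((\<Sum>j<Suc J. ?g j) + (\<Sum>j<J. ?h (Suc j)))"
      by (simp add: kos)
    finally have "act M (nprod V (\<iota> (dv i)) (- 1) (\<iota> i)) 1 w - ?t i =
        (\<Sum>j<Suc J. ?g j) + (\<Sum>j<J. ?h (Suc j))"
      by simp
    moreover have "(\<Sum>j<Suc J. ?g j) \<in> N"
      by (intro cvec.subspace_sum[OF N(1)] N(3) pos) simp
    moreover have "(\<Sum>j<J. ?h (Suc j)) \<in> N"
      by (intro cvec.subspace_sum[OF N(1)] cvec.subspace_scale[OF N(1)] N(3) pos) simp
    ultimately show ?thesis using cvec.subspace_add[OF N(1)] by simp
  qed
  then show ?thesis
    unfolding eq by (intro cvec.subspace_scale[OF N(1)] cvec.subspace_sum[OF N(1)])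
qed


section \<open>Submodules and endomorphisms\<close>

lemma submoduleD:
  assumes "submodule M N"
  shows "cvec.subspace N" "N \<subseteq> S" "w \<in> N \<Longrightarrow> act M a n w \<in> N" "graded_subspace (mgrade M) N"
proof -
  have N: "graded_subspace (mgrade M) N" "N \<subseteq> S" "\<forall>a n. \<forall>w\<in>N. act M a n w \<in> N"
    using assms[unfolded submodule_def] by blast+
  show "cvec.subspace N" using superspace_subspace(1)[OF N(1)[unfolded graded_subspace_def]] .
  show "N \<subseteq> S" "graded_subspace (mgrade M) N" by (rule N)+
  show "act M a n w \<in> N" if "w \<in> N" using N(3) that by blast
qed

lemma submoduleI:
  assumes "cvec.subspace N" "N \<subseteq> S" "\<And>x n w. w \<in> N \<Longrightarrow> cur x n w \<in> N"
    and "\<And>x0 x1. x0 \<in> mgrade M 0 \<Longrightarrow> x1 \<in> mgrade M 1 \<Longrightarrow> x0 + x1 \<in> N \<Longrightarrow> x0 \<in> N"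
  shows "submodule M N"
  unfolding submodule_def
proof (intro conjI allI ballI)
  show "graded_subspace (mgrade M) N" by (rule graded_subspaceI[OF M_super assms(1,2,4)])
  show "act M a n w \<in> N" if "w \<in> N" for a n w by (rule stable_under_currents[OF assms(1-3) that])
qed (rule assms(2))

lemma submodule_component:
  assumes "submodule M N" "x0 \<in> mgrade M 0" "x1 \<in> mgrade M 1" "x0 + x1 \<in> N"
  shows "x0 \<in> N" "x1 \<in> N"
  using graded_subspace_component[OF M_super submoduleD(4)[OF assms(1)] assms(2-4)] by blast+

lemma submodule_zero: "submodule M {0}"
proof (rule submoduleI)
  show "x0 \<in> {0}" if "x0 \<in> mgrade M 0" "x1 \<in> mgrade M 1" "x0 + x1 \<in> {0}" for x0 x1
    using superspace_sum_zero[OF M_super that(1,2)] that(3) by simp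
qed (auto simp: mode_zero cvec.subspace_0[OF S_subspace])

lemma submodule_carrier: "submodule M S"
proof (rule submoduleI)
  show "x0 \<in> S" if "x0 \<in> mgrade M 0" for x0
    using that grade_subset by blast
qed (auto simp: mode_closed S_subspace)

lemma submodule_Int:
  assumes "submodule M N" "submodule M N'"
  shows "submodule M (N \<inter> N')"
  using submoduleD[OF assms(1)] submoduleD[OF assms(2)]
    graded_subspace_Int[OF M_super, of N N'] unfolding submodule_def by blast

lemma submodule_sum:
  assumes N: "submodule M N" and N': "submodule M N'"
  shows "submodule M {x + y |x y. x \<in> N \<and> y \<in> N'}"
proof (rule submoduleI)
  note D = submoduleD[OF N] and D' = submoduleD[OF N']
  show "cvec.subspace {x + y |x y. x \<in> N \<and> y \<in> N'}"
    by (rule cvec.subspace_sums[OF D(1) D'(1)])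
  show "{x + y |x y. x \<in> N \<and> y \<in> N'} \<subseteq> S"
    using D(2) D'(2) cvec.subspace_add[OF S_subspace] by blast
  fix x n w assume "w \<in> {x + y |x y. x \<in> N \<and> y \<in> N'}"
  then obtain u v where uv: "u \<in> N" "v \<in> N'" "w = u + v" by blast
  then have "cur x n w = cur x n u + cur x n v"
    using D(2) D'(2) mode_add by blast
  then show "cur x n w \<in> {x + y |x y. x \<in> N \<and> y \<in> N'}"
    using D(3)[OF uv(1)] D'(3)[OF uv(2)] by blast
next
  fix x0 x1 assume x: "x0 \<in> mgrade M 0" "x1 \<in> mgrade M 1" "x0 + x1 \<in> {x + y |x y. x \<in> N \<and> y \<in> N'}"
  then obtain u v where uv: "u \<in> N" "v \<in> N'" "x0 + x1 = u + v" by blast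
  have uS: "u \<in> S" and vS: "v \<in> S" using uv submoduleD(2)[OF N] submoduleD(2)[OF N'] by blast+
  obtain u0 u1 where u: "u0 \<in> mgrade M 0" "u1 \<in> mgrade M 1" "u = u0 + u1"
    by (rule superspace_decompose[OF M_super uS])
  obtain v0 v1 where v: "v0 \<in> mgrade M 0" "v1 \<in> mgrade M 1" "v = v0 + v1"
    by (rule superspace_decompose[OF M_super vS])
  have "u0 \<in> N" "v0 \<in> N'"
    using submodule_component[OF N u(1,2)] submodule_component[OF N' v(1,2)] uv u(3) v(3) by auto
  moreover have "x0 = u0 + v0"
    using uv(3) unfolding u(3) v(3)
    by (intro superspace_unique(1)[OF M_super x(1,2), of "u0 + v0" "u1 + v1"]
        cvec.subspace_add[OF grade_subspace] u v) simp
  ultimately show "x0 \<in> {x + y |x y. x \<in> N \<and> y \<in> N'}" by blast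
qed

definition even_endo :: "('m \<Rightarrow> 'm) \<Rightarrow> bool" where
  "even_endo T \<longleftrightarrow> clinear_on S T \<and> (\<forall>p. T ` mgrade M p \<subseteq> mgrade M p) \<and>
     (\<forall>a n. \<forall>w\<in>S. T (act M a n w) = act M a n (T w))"

lemma even_endoD:
  assumes "even_endo T"
  shows "clinear_on S T" "w \<in> mgrade M p \<Longrightarrow> T w \<in> mgrade M p"
    "w \<in> S \<Longrightarrow> T (act M a n w) = act M a n (T w)" "w \<in> S \<Longrightarrow> T w \<in> S"
proof -
  show lin: "clinear_on S T" and gr: "\<And>w p. w \<in> mgrade M p \<Longrightarrow> T w \<in> mgrade M p"
    and "w \<in> S \<Longrightarrow> T (act M a n w) = act M a n (T w)"
    using assms unfolding even_endo_def by blast+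
  assume w: "w \<in> S"
  obtain w0 w1 where w': "w0 \<in> mgrade M 0" "w1 \<in> mgrade M 1" "w = w0 + w1"
    by (rule superspace_decompose[OF M_super w])
  have "T w = T w0 + T w1"
    unfolding w'(3) using w' grade_subset by (intro clinear_on_add[OF lin]) blast+
  then show "T w \<in> S"
    using gr[OF w'(1)] gr[OF w'(2)] grade_subset cvec.subspace_add[OF S_subspace] by fastforce
qed

lemma even_endo_component:
  assumes T: "even_endo T" and x: "x0 \<in> mgrade M 0" "x1 \<in> mgrade M 1"
  shows "T (x0 + x1) = T x0 + T x1" "T x0 \<in> mgrade M 0" "T x1 \<in> mgrade M 1"
  using clinear_on_add[OF even_endoD(1)[OF T]] even_endoD(2)[OF T] x grade_subset by blast+

lemma submodule_vimage:
  assumes T: "even_endo T" and U: "submodule M U" and N: "submodule M N"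
  shows "submodule M {w \<in> U. T w \<in> N}"
proof (rule submoduleI)
  note D = submoduleD[OF U] and D' = submoduleD[OF N]
  show "cvec.subspace {w \<in> U. T w \<in> N}"
    by (rule subspace_vimage_clinear_on[OF D(1) clinear_on_subset[OF even_endoD(1)[OF T] D(2)] D'(1)])
  show "{w \<in> U. T w \<in> N} \<subseteq> S" using D(2) by blast
  fix x n w assume w: "w \<in> {w \<in> U. T w \<in> N}"
  then have "T (cur x n w) = cur x n (T w)"
    using even_endoD(3)[OF T] D(2) by blast
  then show "cur x n w \<in> {w \<in> U. T w \<in> N}" using w D(3) D'(3) by simp
next
  fix x0 x1 assume x: "x0 \<in> mgrade M 0" "x1 \<in> mgrade M 1" "x0 + x1 \<in> {w \<in> U. T w \<in> N}"
  then have "x0 \<in> U" using submodule_component[OF U x(1,2)] by blast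
  moreover have "T x0 \<in> N"
    using submodule_component[OF N, of "T x0" "T x1"] even_endo_component[OF T x(1,2)] x(3) by simp
  ultimately show "x0 \<in> {w \<in> U. T w \<in> N}" by blast
qed

lemma submodule_image:
  assumes T: "even_endo T" and U: "submodule M U"
  shows "submodule M (T ` U)"
proof (rule submoduleI)
  note D = submoduleD[OF U]
  show "cvec.subspace (T ` U)"
    by (rule subspace_image_clinear_on[OF D(1) clinear_on_subset[OF even_endoD(1)[OF T] D(2)]])
  show "T ` U \<subseteq> S" using D(2) even_endoD(4)[OF T] by blast
  show "cur x n w \<in> T ` U" if "w \<in> T ` U" for x n w
  proof -
    obtain u where u: "u \<in> U" "w = T u" using \<open>w \<in> T ` U\<close> by blast
    then have "cur x n w = T (cur x n u)"
      using even_endoD(3)[OF T] D(2) by (metis subsetD)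
    then show ?thesis using D(3)[OF u(1)] by blast
  qed
next
  fix x0 x1 assume x: "x0 \<in> mgrade M 0" "x1 \<in> mgrade M 1" "x0 + x1 \<in> T ` U"
  then obtain u where u: "u \<in> U" "x0 + x1 = T u" by blast
  have uS: "u \<in> S" using u(1) submoduleD(2)[OF U] by blast
  obtain u0 u1 where u': "u0 \<in> mgrade M 0" "u1 \<in> mgrade M 1" "u = u0 + u1"
    by (rule superspace_decompose[OF M_super uS])
  have "x0 = T u0"
    using even_endo_component[OF T u'(1,2)] u(2) u'(3)
    by (intro superspace_unique(1)[OF M_super x(1,2), of "T u0" "T u1"]) auto
  moreover have "u0 \<in> U" using submodule_component[OF U u'(1,2)] u(1) u'(3) by blast
  ultimately show "x0 \<in> T ` U" by blast
qed

end


section \<open>Nilpotent parts of the weight operators\<close>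

locale KL_object = affine_module g B k V \<iota> M
  for g :: "'g::complex_vector lie_sa" and B k and V :: "'v::complex_vector vertex_sa" and \<iota>
    and M :: "('v, 'm::complex_vector) vmod" +
  fixes \<hh> :: "'g set"
  assumes toral: "toral g \<hh>" and M_KL: "M \<in> KL g B k V \<iota>"
begin

lemma \<hh>_even: "h \<in> \<hh> \<Longrightarrow> h \<in> gr 0" and \<hh>_abelian: "h \<in> \<hh> \<Longrightarrow> h' \<in> \<hh> \<Longrightarrow> brac h h' = 0"
  and root_spaces_span: "cvec.span (\<Union>\<alpha>. root_space g \<hh> \<alpha>) = UNIV"
  using toral by (auto simp: toral_def)

lemma L_spectral: "spectral_operator S L"
  using M_KL S_subspace L_linear L_closed by unfold_locales (auto simp: KL_def)

text \<open>Each vector lies in a finite-dimensional \<open>g\<close>-submodule.\<close>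

lemma zero_mode_spectral: "spectral_operator S (cur x 0)"
proof -
  interpret x: stable_operator S "cur x 0"
    using S_subspace mode_linear mode_closed by unfold_locales
  have "w \<in> cvec.span (\<Union>\<mu>. x.geig \<mu>)" if w: "w \<in> S" for w
  proof -
    have "locally_finite (as_gmod \<iota> M)" using M_KL by (simp add: KL_def)
    then obtain N where N: "gsubmodule (as_gmod \<iota> M) N" "fin_dim N" "w \<in> N"
      using w by (auto simp: locally_finite_def as_gmod_def)
    then have "invariant_subspace (cur x 0) N" "N \<subseteq> S"
      using fin_dim_imp_subspace[OF N(2)]
      by (auto simp: gsubmodule_def as_gmod_def invariant_subspace_def)
    then show ?thesis using x.fin_dim_invariant_in_span_geig N by blast
  qed
  moreover have "cvec.span (\<Union>\<mu>. x.geig \<mu>) \<subseteq> S"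
    using x.geig_subset S_subspace by (intro cvec.span_minimal) blast
  ultimately show ?thesis by unfold_locales blast
qed

definition weight_operators :: "('m \<Rightarrow> 'm) set" where
  "weight_operators = insert L ((\<lambda>h. cur h 0) ` \<hh>)"

abbreviation nil :: "('m \<Rightarrow> 'm) \<Rightarrow> 'm \<Rightarrow> 'm" where
  "nil D \<equiv> spectral_operator.nil_part S D"

lemma weight_operator_cases:
  assumes "D \<in> weight_operators"
  obtains "D = L" | h where "h \<in> \<hh>" "D = cur h 0"
  using assms unfolding weight_operators_def by blast

lemma weight_operator_spectral: "D \<in> weight_operators \<Longrightarrow> spectral_operator S D"
  by (erule weight_operator_cases) (simp_all add: L_spectral zero_mode_spectral)

lemma weight_operator_even:
  assumes "D \<in> weight_operators" "w \<in> mgrade M p"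
  shows "D w \<in> mgrade M p"
  using assms(1)
proof (cases rule: weight_operator_cases)
  case (2 h)
  then show ?thesis using cur_grade[OF \<hh>_even assms(2), of h 0] by (simp only: add_0)
qed (use L_even assms(2) in simp)

lemma weight_operator_mode:
  assumes "D \<in> weight_operators"
  obtains a n where "D = act M a n"
  using assms by (cases rule: weight_operator_cases) (auto simp: L0_def[abs_def])

lemma weight_operators_commute:
  assumes D: "D \<in> weight_operators" "D' \<in> weight_operators" and w: "w \<in> S"
  shows "D (D' w) = D' (D w)"
proof -
  have hh: "cur h 0 (cur h' 0 w) = cur h' 0 (cur h 0 w)" if "h \<in> \<hh>" "h' \<in> \<hh>" for h h'
    using zero_mode_commutator[OF \<hh>_even[OF that(1)] w] \<hh>_abelian[OF that]
    by (simp add: \<iota>_zero mode_zero_left[OF w])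
  have Lh: "L (cur h 0 w) = cur h 0 (L w)" for h
    using L_current[OF w, of h 0] by simp
  from D(1) show ?thesis
  proof (cases rule: weight_operator_cases)
    case 1
    from D(2) show ?thesis
    proof (cases rule: weight_operator_cases)
      case (2 h)
      show ?thesis unfolding 1 2 by (rule Lh)
    qed (simp add: 1)
  next
    case h: (2 h)
    from D(2) show ?thesis
    proof (cases rule: weight_operator_cases)
      case 1
      show ?thesis unfolding 1 h by (rule Lh[symmetric])
    next
      case (2 h')
      show ?thesis unfolding h 2 by (rule hh[OF h(1) 2(1)])
    qed
  qed
qed

lemma nil_current:
  assumes D: "D \<in> weight_operators" and w: "w \<in> S"
  shows "nil D (cur x n w) = cur x n (nil D w)"
  using D
proof (cases rule: weight_operator_cases)
  case 1
  interpret L: spectral_operator S L by (rule L_spectral)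
  show ?thesis
    unfolding 1 by (rule L.nil_part_commute[OF mode_linear mode_closed L_current w])
next
  case (2 h)
  interpret h: spectral_operator S "cur h 0" by (rule zero_mode_spectral)
  have "x \<in> cvec.span (\<Union>\<alpha>. root_space g \<hh> \<alpha>)" using root_spaces_span by blast
  then have "h.nil_part (cur x n w) = cur x n (h.nil_part w)"
  proof (induction rule: cvec.span_induct_alt)
    case base
    show ?case
      using clinear_on_zero[OF S_subspace h.nil_part_linear] h.nil_part_closed[OF w]
      by (simp add: \<iota>_zero mode_zero_left w)
  next
    case (step c x y)
    obtain \<alpha> where \<alpha>: "brac h x = \<alpha> h *\<^sub>C x" using step(1) 2(1) by (auto simp: root_space_def)
    have "h.nil_part (cur x n w) = cur x n (h.nil_part w)"
    proof (rule h.nil_part_commute[OF mode_linear mode_closed _ w])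
      show "cur h 0 (cur x n v) = cur x n (cur h 0 v) + \<alpha> h *\<^sub>C cur x n v" if "v \<in> S" for v
        using zero_mode_commutator[OF \<hh>_even[OF 2(1)] that] \<alpha> cur_scale[OF that] by simp
    qed
    then show ?case
      using step(2) w h.nil_part_closed[OF w]
      by (simp add: cur_add cur_scale clinear_on_add[OF h.nil_part_linear]
          clinear_on_scale[OF h.nil_part_linear] mode_closed cvec.subspace_scale[OF S_subspace])
  qed
  then show ?thesis unfolding 2 .
qed

text \<open>
  The currents are sums of operators homogeneous for the commutator with \<open>D\<close>, and the nilpotent part
  of \<open>D\<close> commutes with homogeneous operators.
\<close>

lemma nil_endo:
  assumes D: "D \<in> weight_operators"
  shows "even_endo (nil D)"
proof -
  interpret D: spectral_operator S D by (rule weight_operator_spectral[OF D])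
  have "nil D (act M a n w) = act M a n (nil D w)" if "w \<in> S" for a n w
    using commuting_with_currents[OF D.nil_part_linear D.nil_part_closed nil_current[OF D] that] .
  moreover have "nil D w \<in> mgrade M p" if "w \<in> mgrade M p" for w p
    using that D grade_subset grade_subspace weight_operator_even
    by (intro D.nil_part_invariant) (auto simp: invariant_subspace_def)
  ultimately show ?thesis
    using D.nil_part_linear unfolding even_endo_def by blast
qed

definition joint_kernel :: "('m \<Rightarrow> 'm) set \<Rightarrow> 'm set" where
  "joint_kernel \<D> = {w \<in> S. \<forall>D\<in>\<D>. nil D w = 0}"

lemma joint_kernel_empty: "joint_kernel {} = S"
  and joint_kernel_insert: "joint_kernel (insert D \<D>) = {w \<in> joint_kernel \<D>. nil D w \<in> {0}}"
  by (auto simp: joint_kernel_def)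

lemma joint_kernel_submodule:
  assumes "finite \<D>" "\<D> \<subseteq> weight_operators"
  shows "submodule M (joint_kernel \<D>)"
  using assms
proof (induction \<D> rule: finite_induct)
  case empty
  then show ?case by (simp add: joint_kernel_empty submodule_carrier)
next
  case (insert D \<D>)
  then show ?case
    unfolding joint_kernel_insert using submodule_vimage[OF nil_endo _ submodule_zero] by simp
qed

end

section \<open>Submodules as objects of the categories\<close>

lemma restrict_mod_simps [simp]:
  "carrier (restrict_mod M N) = N" "mgrade (restrict_mod M N) = (\<lambda>p. N \<inter> mgrade M p)"
  "act (restrict_mod M N) = act M" "L0 g B k V \<iota> (restrict_mod M N) = L0 g B k V \<iota> M"
  by (simp_all add: restrict_mod_def L0_def[abs_def])

lemma restrict_restrict_mod: "N' \<subseteq> N \<Longrightarrow> restrict_mod (restrict_mod M N) N' = restrict_mod M N'"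
  by (auto simp: restrict_mod_def)

context affine_module
begin

lemma restrict_mod_carrier: "restrict_mod M S = M"
  using grade_subset by (simp add: restrict_mod_def Int_absorb1)

lemma submodule_restrict_iff:
  assumes "submodule M N"
  shows "submodule (restrict_mod M N) N' \<longleftrightarrow> submodule M N' \<and> N' \<subseteq> N"
proof -
  have "graded_subspace (mgrade (restrict_mod M N)) N' \<longleftrightarrow> graded_subspace (mgrade M) N'" if "N' \<subseteq> N"
  proof -
    have "N' \<inter> (N \<inter> mgrade M p) = N' \<inter> mgrade M p" for p using that by blast
    then show ?thesis by (simp add: graded_subspace_def)
  qed
  then show ?thesis using submoduleD(2)[OF assms] unfolding submodule_def by auto
qed

lemma restrict_weak_module:
  assumes N: "submodule M N"
  shows "weak_module V (restrict_mod M N)"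
proof -
  note D = submoduleD[OF N]
  show ?thesis
    unfolding weak_module_def restrict_mod_simps
  proof (intro conjI allI ballI)
    show "superspace N (\<lambda>p. N \<inter> mgrade M p)" using D(4) by (simp only: graded_subspace_def)
    show "clinear_on N (act M a n)" for a n
      by (rule clinear_on_subset[OF mode_linear D(2)])
    show "clinear_on UNIV (\<lambda>a. act M a n w)" if "w \<in> N" for n w
      using mode_linear_left that D(2) by blast
    show "act M a n w \<in> N \<inter> mgrade M (p + q)" if "a \<in> vgrade V p" "w \<in> N \<inter> mgrade M q" for a n w p q
      using mode_grade[OF that(1), of w q n] that(2) D(3) by blast
    show "\<exists>m. \<forall>n\<ge>m. act M a n w = 0" if "w \<in> N" for a w
      using mode_truncation that D(2) by blast
    show "act M (vac V) n w = (if n = - 1 then w else 0)" if "w \<in> N" for n w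
      using mode_vac that D(2) by blast
    show "borcherds_identity (nprod V) (act M) p q a b w"
      if "a \<in> vgrade V p" "b \<in> vgrade V q" "w \<in> N" for p q a b w
      using borcherds that D(2) by blast
  qed
qed

end

context KL_object
begin

lemma submodule_weight_invariant:
  assumes "submodule M N" "D \<in> weight_operators"
  shows "invariant_subspace D N"
proof -
  obtain a n where "D = act M a n" by (rule weight_operator_mode[OF assms(2)])
  then show ?thesis using submoduleD[OF assms(1)] by (simp add: invariant_subspace_def)
qed

lemma L_weight_operator: "L \<in> weight_operators"
  by (simp add: weight_operators_def)

lemma restrict_KL:
  assumes N: "submodule M N"
  shows "restrict_mod M N \<in> KL g B k V \<iota>"
proof -
  note D = submoduleD[OF N]
  interpret L: spectral_operator S L by (rule L_spectral)
  have geig: "gen_eigenspace N L \<mu> = N \<inter> L.geig \<mu>" for \<mu> by (rule L.geig_restrict[OF D(2)])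
  have "locally_finite (as_gmod \<iota> (restrict_mod M N))"
    unfolding locally_finite_def
  proof
    fix w assume "w \<in> gcarrier (as_gmod \<iota> (restrict_mod M N))"
    then have w: "w \<in> N" by (simp add: as_gmod_def)
    have "locally_finite (as_gmod \<iota> M)" using M_KL by (simp add: KL_def)
    then obtain U where U: "gsubmodule (as_gmod \<iota> M) U" "fin_dim U" "w \<in> U"
      using w D(2) by (auto simp: locally_finite_def as_gmod_def)
    have U': "graded_subspace (mgrade M) U" "\<And>x u. u \<in> U \<Longrightarrow> cur x 0 u \<in> U"
      using U(1) by (auto simp: gsubmodule_def as_gmod_def)
    have gr: "graded_subspace (mgrade M) (N \<inter> U)"
      by (rule graded_subspace_Int[OF M_super D(4) U'(1) D(2)])
    have "(N \<inter> U) \<inter> (N \<inter> mgrade M p) = (N \<inter> U) \<inter> mgrade M p" for p by blast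
    then have "graded_subspace (\<lambda>p. N \<inter> mgrade M p) (N \<inter> U)"
      using gr by (simp add: graded_subspace_def)
    then have "gsubmodule (as_gmod \<iota> (restrict_mod M N)) (N \<inter> U)"
      using U'(2) D(3) by (simp add: gsubmodule_def as_gmod_def)
    moreover have "fin_dim (N \<inter> U)"
      by (rule fin_dim_subspace[OF U(2) cvec.subspace_inter[OF D(1) fin_dim_imp_subspace[OF U(2)]]]) simp
    ultimately show "\<exists>N'. gsubmodule (as_gmod \<iota> (restrict_mod M N)) N' \<and> fin_dim N' \<and> w \<in> N'"
      using w U(3) by blast
  qed
  moreover have "N = cvec.span (\<Union>\<mu>. gen_eigenspace N L \<mu>)"
  proof
    show "cvec.span (\<Union>\<mu>. gen_eigenspace N L \<mu>) \<subseteq> N"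
      unfolding geig by (rule cvec.span_minimal[OF _ D(1)]) blast
    show "N \<subseteq> cvec.span (\<Union>\<mu>. gen_eigenspace N L \<mu>)"
    proof
      fix w assume "w \<in> N"
      then obtain F f where f: "finite F" "\<And>\<mu>. f \<mu> \<in> L.geig \<mu>" "\<And>\<mu>. f \<mu> \<in> N" "w = sum f F"
        using L.components_of_invariant[OF submodule_weight_invariant[OF N L_weight_operator] D(2)] by metis
      show "w \<in> cvec.span (\<Union>\<mu>. gen_eigenspace N L \<mu>)"
        unfolding f(4) geig using f(2,3) by (intro cvec.span_sum cvec.span_base) blast
    qed
  qed
  moreover obtain b :: real where b: "\<And>\<mu>. L.geig \<mu> \<noteq> {0} \<Longrightarrow> b \<le> Re \<mu>"
    using M_KL by (auto simp: KL_def)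
  have "b \<le> Re \<mu>" if "gen_eigenspace N L \<mu> \<noteq> {0}" for \<mu>
  proof (rule b)
    have "0 \<in> gen_eigenspace N L \<mu>"
      unfolding geig using cvec.subspace_0[OF D(1)] cvec.subspace_0[OF L.geig_subspace] by blast
    then show "L.geig \<mu> \<noteq> {0}" using that unfolding geig by blast
  qed
  ultimately show ?thesis
    using restrict_weak_module[OF N] unfolding KL_def by auto
qed

text \<open>
  On \<open>N\<close> the finitely many operators in question are simultaneously diagonalizable, and a joint
  eigenvector for them is a weight vector for the whole affine Cartan subalgebra.
\<close>

lemma restrict_KL_fin:
  assumes Y: "finite Y" "\<hh> = cvec.span Y" and N: "submodule M N"
    and ker: "N \<subseteq> joint_kernel (insert L ((\<lambda>h. cur h 0) ` Y))"
  shows "restrict_mod M N \<in> KL_fin g \<hh> B k V \<iota>"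
proof -
  note D = submoduleD[OF N]
  let ?\<D> = "insert L ((\<lambda>h. cur h 0) ` Y)"
  let ?P = "{w \<in> N. \<exists>\<mu> :: 'g \<times> complex \<times> complex \<Rightarrow> complex.
       \<forall>z \<in> \<hh> \<times> UNIV \<times> UNIV. affine_cartan_act g B k V \<iota> (restrict_mod M N) z w = \<mu> z *\<^sub>C w}"
  have "Y \<subseteq> \<hh>" unfolding Y(2) by (rule cvec.span_superset)
  then have wt: "?\<D> \<subseteq> weight_operators"
    unfolding weight_operators_def by (intro insert_mono image_mono)
  have "N \<subseteq> cvec.span {w \<in> N. \<forall>D\<in>?\<D>. \<exists>\<mu>. D w = \<mu> *\<^sub>C w}"
  proof (rule joint_eigenvectors_span[OF _ _ _ D(1,2)])
    show "finite ?\<D>" using Y(1) by simp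
    show "spectral_operator S D" if "D \<in> ?\<D>" for D
      using weight_operator_spectral wt that by blast
    show "D (D' w) = D' (D w)" if "D \<in> ?\<D>" "D' \<in> ?\<D>" "w \<in> S" for D D' w
      using weight_operators_commute wt that by blast
    show "D w \<in> N" if "D \<in> ?\<D>" "w \<in> N" for D w
      using submodule_weight_invariant[OF N] wt that unfolding invariant_subspace_def by blast
    show "nil D w = 0" if "D \<in> ?\<D>" "w \<in> N" for D w
      using ker that unfolding joint_kernel_def by blast
  qed
  moreover have "{w \<in> N. \<forall>D\<in>?\<D>. \<exists>\<mu>. D w = \<mu> *\<^sub>C w} \<subseteq> ?P"
  proof
    fix w assume w: "w \<in> {w \<in> N. \<forall>D\<in>?\<D>. \<exists>\<mu>. D w = \<mu> *\<^sub>C w}"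
    then have wS: "w \<in> S" using D(2) by blast
    obtain l where l: "L w = l *\<^sub>C w" using w by blast
    have h: "\<exists>c. cur h 0 w = c *\<^sub>C w" if "h \<in> \<hh>" for h
      using that unfolding Y(2)
    proof (induction rule: cvec.span_induct_alt)
      case base
      show ?case by (rule exI[of _ 0]) (simp add: \<iota>_zero mode_zero_left[OF wS])
    next
      case (step c x y)
      then obtain a b where "cur x 0 w = a *\<^sub>C w" "cur y 0 w = b *\<^sub>C w" using w by blast
      then have "cur (c *\<^sub>C x + y) 0 w = (c * a + b) *\<^sub>C w"
        by (simp add: cur_add[OF wS] cur_scale[OF wS] cvec.scale_left_distrib)
      then show ?case by blast
    qed
    have "\<exists>c. affine_cartan_act g B k V \<iota> (restrict_mod M N) z w = c *\<^sub>C w" if z: "z \<in> \<hh> \<times> UNIV \<times> UNIV" for z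
    proof -
      obtain h a b where z': "z = (h, a, b)" "h \<in> \<hh>" using z by auto
      obtain c where c: "cur h 0 w = c *\<^sub>C w" using h[OF z'(2)] by blast
      have "affine_cartan_act g B k V \<iota> (restrict_mod M N) z w = (c + a * k - b * l) *\<^sub>C w"
        by (simp add: affine_cartan_act_def z'(1) c l cvec.scale_left_distrib cvec.scale_left_diff_distrib)
      then show ?thesis by blast
    qed
    then have "\<exists>\<mu>. \<forall>z \<in> \<hh> \<times> UNIV \<times> UNIV. affine_cartan_act g B k V \<iota> (restrict_mod M N) z w = \<mu> z *\<^sub>C w"
      by metis
    then show "w \<in> ?P" using w by blast
  qed
  ultimately have "N \<subseteq> cvec.span ?P" using cvec.span_mono by blast
  moreover have "cvec.span ?P \<subseteq> N" by (rule cvec.span_minimal[OF _ D(1)]) blast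
  ultimately show ?thesis
    using restrict_KL[OF N] unfolding KL_fin_def by simp
qed

end


section \<open>Complements of submodules of semisimple modules\<close>

context affine_module
begin

abbreviation top_of :: "'m set \<Rightarrow> ('g, 'm) gmod" where
  "top_of N \<equiv> top_component g B k V \<iota> (restrict_mod M N)"

definition simple_submodule :: "'m set \<Rightarrow> bool" where
  "simple_submodule N \<longleftrightarrow> submodule M N \<and> irreducible_mod (restrict_mod M N)"

lemma simple_submoduleD:
  assumes "simple_submodule N"
  shows "submodule M N" "N \<noteq> {0}" "submodule M N' \<Longrightarrow> N' \<subseteq> N \<Longrightarrow> N' = {0} \<or> N' = N"
  using assms submodule_restrict_iff[of N] by (auto simp: simple_submodule_def irreducible_mod_def)

lemma simple_decomposition:
  assumes C: "semisimple_category C" and N: "submodule M N" "restrict_mod M N \<in> C"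
  obtains \<N> where "\<And>K. K \<in> \<N> \<Longrightarrow> simple_submodule K \<and> K \<subseteq> N" "N = cvec.span (\<Union>\<N>)"
proof -
  obtain \<N> where \<N>: "\<forall>K\<in>\<N>. submodule (restrict_mod M N) K \<and> irreducible_mod (restrict_mod (restrict_mod M N) K)"
      "direct_sum_of N \<N>"
    using C N(2) unfolding semisimple_category_def by force
  have "simple_submodule K \<and> K \<subseteq> N" if "K \<in> \<N>" for K
    using \<N>(1) that submodule_restrict_iff[OF N(1)] restrict_restrict_mod[of K N M]
    unfolding simple_submodule_def by auto
  moreover have "N = cvec.span (\<Union>\<N>)" using \<N>(2) unfolding direct_sum_of_def by blast
  ultimately show ?thesis using that by blast
qed

lemma submodule_Union_chain:
  assumes "C \<noteq> {}" "\<And>N. N \<in> C \<Longrightarrow> submodule M N"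
    and chain: "\<And>N N'. N \<in> C \<Longrightarrow> N' \<in> C \<Longrightarrow> N \<subseteq> N' \<or> N' \<subseteq> N"
  shows "submodule M (\<Union>C)"
proof (rule submoduleI)
  note D = submoduleD[OF assms(2)]
  show "cvec.subspace (\<Union>C)"
  proof (rule cvec.subspaceI)
    show "0 \<in> \<Union>C" using assms(1) cvec.subspace_0[OF D(1)] by blast
    show "x + y \<in> \<Union>C" if xy: "x \<in> \<Union>C" "y \<in> \<Union>C" for x y
    proof -
      obtain N N' where N: "N \<in> C" "N' \<in> C" "x \<in> N" "y \<in> N'" using xy by blast
      then obtain K where K: "K \<in> C" "x \<in> K" "y \<in> K" using chain[OF N(1,2)] by blast
      show ?thesis using cvec.subspace_add[OF D(1)[OF K(1)] K(2,3)] K(1) by blast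
    qed
    show "c *\<^sub>C x \<in> \<Union>C" if "x \<in> \<Union>C" for c x
      using that cvec.subspace_scale[OF D(1)] by blast
  qed
  show "\<Union>C \<subseteq> S" using D(2) by blast
  show "cur x n w \<in> \<Union>C" if "w \<in> \<Union>C" for x n w using D(3) that by blast
  show "x0 \<in> \<Union>C" if "x0 \<in> mgrade M 0" "x1 \<in> mgrade M 1" "x0 + x1 \<in> \<Union>C" for x0 x1
    using submodule_component(1)[OF assms(2) that(1,2)] that(3) by blast
qed

text \<open>
  The usual argument by Zorn's lemma: for a submodule \<open>N'\<close> maximal with \<open>N \<inter> N' = 0\<close>, every simple
  submodule \<open>K\<close> meets \<open>N + N'\<close>, since otherwise \<open>N' + K\<close> would contradict maximality. Being simple, it
  is contained in \<open>N + N'\<close>.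
\<close>

lemma complement_exists:
  assumes \<N>: "\<And>K. K \<in> \<N> \<Longrightarrow> simple_submodule K" "U = cvec.span (\<Union>\<N>)"
    and U: "submodule M U" and N: "submodule M N" "N \<subseteq> U"
  obtains N' where "submodule M N'" "N' \<subseteq> U" "N \<inter> N' = {0}" "U = {x + y |x y. x \<in> N \<and> y \<in> N'}"
proof -
  define Z where "Z = {N'. submodule M N' \<and> N' \<subseteq> U \<and> N \<inter> N' = {0}}"
  have "{0} \<in> Z"
    using submodule_zero cvec.subspace_0[OF submoduleD(1)[OF U]] cvec.subspace_0[OF submoduleD(1)[OF N(1)]]
    by (auto simp: Z_def)
  moreover have "\<Union>C \<in> Z" if C: "C \<noteq> {}" "subset.chain Z C" for C
  proof -
    have CZ: "C \<subseteq> Z" and chain: "\<And>N N'. N \<in> C \<Longrightarrow> N' \<in> C \<Longrightarrow> N \<subseteq> N' \<or> N' \<subseteq> N"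
      using C(2) by (auto simp: subset_chain_def)
    have "submodule M (\<Union>C)"
      using C(1) CZ chain by (intro submodule_Union_chain) (auto simp: Z_def)
    moreover have "N \<inter> \<Union>C = {0}" using C(1) CZ by (auto simp: Z_def)
    ultimately show ?thesis using CZ by (auto simp: Z_def)
  qed
  ultimately obtain N' where N'Z: "N' \<in> Z" and max: "\<And>X. X \<in> Z \<Longrightarrow> N' \<subseteq> X \<Longrightarrow> X = N'"
    using subset_Zorn_nonempty[of Z] by blast
  have N': "submodule M N'" "N' \<subseteq> U" "N \<inter> N' = {0}" using N'Z by (auto simp: Z_def)
  define W where "W = {x + y |x y. x \<in> N \<and> y \<in> N'}"
  have W: "submodule M W" unfolding W_def by (rule submodule_sum[OF N(1) N'(1)])
  have N0: "0 \<in> N" "0 \<in> N'" using cvec.subspace_0 submoduleD(1) N(1) N'(1) by blast+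
  have NW: "N \<subseteq> W" "N' \<subseteq> W"
  proof -
    have "x = x + 0" "x = 0 + x" for x :: 'm by simp_all
    then show "N \<subseteq> W" "N' \<subseteq> W" unfolding W_def using N0 by blast+
  qed
  have "K \<subseteq> W" if K: "K \<in> \<N>" for K
  proof (rule ccontr)
    assume notin: "\<not> K \<subseteq> W"
    note sK = simple_submoduleD[OF \<N>(1)[OF K]]
    have KU: "K \<subseteq> U" unfolding \<N>(2) using K cvec.span_superset by blast
    have KW: "K \<inter> W = {0}"
      using sK(3)[OF submodule_Int[OF sK(1) W]] notin by blast
    define N'' where "N'' = {x + y |x y. x \<in> N' \<and> y \<in> K}"
    have "submodule M N''" unfolding N''_def by (rule submodule_sum[OF N'(1) sK(1)])
    moreover have "N'' \<subseteq> U"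
      unfolding N''_def using N'(2) KU cvec.subspace_add[OF submoduleD(1)[OF U]] by blast
    moreover have "N \<inter> N'' = {0}"
    proof -
      have "w = 0" if w: "w \<in> N" "w \<in> N''" for w
      proof -
        obtain x y where xy: "x \<in> N'" "y \<in> K" "w = x + y" using w(2) unfolding N''_def by blast
        have "y = w - x" using xy(3) by simp
        moreover have "w - x \<in> W"
          using cvec.subspace_diff[OF submoduleD(1)[OF W]] NW w(1) xy(1) by blast
        ultimately have "y = 0" using KW xy(2) by blast
        then have "w = x" using xy(3) by simp
        then show ?thesis using N'(3) w(1) xy(1) by blast
      qed
      moreover have "0 \<in> N''"
      proof -
        have "0 + 0 \<in> N''"
          unfolding N''_def using N0(2) cvec.subspace_0[OF submoduleD(1)[OF sK(1)]] by blast
        then show ?thesis by simp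
      qed
      ultimately show ?thesis using N0(1) by blast
    qed
    ultimately have "N'' \<in> Z" by (simp add: Z_def)
    moreover have "N' \<subseteq> N''" "K \<subseteq> N''"
    proof -
      have "x = x + 0" "x = 0 + x" for x :: 'm by simp_all
      then show "N' \<subseteq> N''" "K \<subseteq> N''"
        unfolding N''_def using N0(2) cvec.subspace_0[OF submoduleD(1)[OF sK(1)]] by blast+
    qed
    ultimately have "K \<subseteq> N'" using max by blast
    then show False using NW(2) notin by blast
  qed
  then have "U \<subseteq> W"
    unfolding \<N>(2) using submoduleD(1)[OF W] by (intro cvec.span_minimal) blast+
  moreover have "W \<subseteq> U"
    unfolding W_def using N(2) N'(2) cvec.subspace_add[OF submoduleD(1)[OF U]] by blast
  ultimately show ?thesis using that[OF N'] unfolding W_def by blast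
qed

end

locale complemented_submodule = affine_module g B k V \<iota> M
  for g :: "'g::complex_vector lie_sa" and B k and V :: "'v::complex_vector vertex_sa" and \<iota>
    and M :: "('v, 'm::complex_vector) vmod" +
  fixes U N N' :: "'m set"
  assumes sub_N: "submodule M N" and sub_N': "submodule M N'"
    and disjoint: "N \<inter> N' = {0}" and sum: "U = {x + y |x y. x \<in> N \<and> y \<in> N'}"
begin

lemma sub_U: "submodule M U"
  unfolding sum by (rule submodule_sum[OF sub_N sub_N'])

lemmas N_D = submoduleD[OF sub_N] and N'_D = submoduleD[OF sub_N'] and U_D = submoduleD[OF sub_U]

lemma N_subset: "N \<subseteq> U" and N'_subset: "N' \<subseteq> U"
proof -
  have "x = x + 0" "x = 0 + x" for x :: 'm by simp_all
  then show "N \<subseteq> U" "N' \<subseteq> U"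
    unfolding sum using cvec.subspace_0[OF N_D(1)] cvec.subspace_0[OF N'_D(1)] by blast+
qed

definition proj :: "'m \<Rightarrow> 'm" where
  "proj w = (THE x. x \<in> N \<and> w - x \<in> N')"

lemma proj_eqI:
  assumes "x \<in> N" "w - x \<in> N'"
  shows "proj w = x"
  unfolding proj_def
proof (rule the_equality)
  fix y assume y: "y \<in> N \<and> w - y \<in> N'"
  have "y - x = (w - x) - (w - y)" by simp
  then have "y - x \<in> N \<inter> N'"
    using y assms cvec.subspace_diff[OF N_D(1)] cvec.subspace_diff[OF N'_D(1)] by (metis IntI)
  then show "y = x" using disjoint by simp
qed (use assms in blast)

lemma proj_props:
  assumes "w \<in> U"
  shows "proj w \<in> N" "w - proj w \<in> N'"
proof -
  obtain x y where xy: "x \<in> N" "y \<in> N'" "w = x + y" using assms unfolding sum by blast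
  then have "proj w = x" by (intro proj_eqI) simp_all
  then show "proj w \<in> N" "w - proj w \<in> N'" using xy by simp_all
qed

lemma proj_zero_iff: "w \<in> U \<Longrightarrow> proj w = 0 \<longleftrightarrow> w \<in> N'"
  using proj_props(2)[of w] proj_eqI[of 0 w] cvec.subspace_0[OF N_D(1)] by auto

lemma proj_linear: "clinear_on U proj"
proof (rule clinear_onI)
  fix x y assume xy: "x \<in> U" "y \<in> U"
  note px = proj_props[OF xy(1)] and py = proj_props[OF xy(2)]
  have "(x + y) - (proj x + proj y) = (x - proj x) + (y - proj y)" by simp
  also have "\<dots> \<in> N'" by (rule cvec.subspace_add[OF N'_D(1) px(2) py(2)])
  finally show "proj (x + y) = proj x + proj y"
    by (rule proj_eqI[OF cvec.subspace_add[OF N_D(1) px(1) py(1)]])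
next
  fix c x assume x: "x \<in> U"
  note px = proj_props[OF x]
  have "c *\<^sub>C x - c *\<^sub>C proj x = c *\<^sub>C (x - proj x)" by (simp add: cvec.scale_right_diff_distrib)
  also have "\<dots> \<in> N'" by (rule cvec.subspace_scale[OF N'_D(1) px(2)])
  finally show "proj (c *\<^sub>C x) = c *\<^sub>C proj x"
    by (rule proj_eqI[OF cvec.subspace_scale[OF N_D(1) px(1)]])
qed

lemma proj_mode:
  assumes w: "w \<in> U"
  shows "proj (act M a n w) = act M a n (proj w)"
proof (rule proj_eqI)
  note pw = proj_props[OF w]
  show "act M a n (proj w) \<in> N" by (rule N_D(3)[OF pw(1)])
  have "w \<in> S" "proj w \<in> S" using w pw(1) U_D(2) N_D(2) by blast+
  then have "act M a n w - act M a n (proj w) = act M a n (w - proj w)"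
    by (rule mode_diff[symmetric])
  then show "act M a n w - act M a n (proj w) \<in> N'"
    using N'_D(3)[OF pw(2)] by simp
qed

lemma proj_even:
  assumes w: "w \<in> U" "w \<in> mgrade M p"
  shows "proj w \<in> mgrade M p"
proof -
  note pw = proj_props[OF w(1)]
  have pS: "proj w \<in> S" using pw(1) N_D(2) by blast
  obtain x0 x1 where x: "x0 \<in> mgrade M 0" "x1 \<in> mgrade M 1" "proj w = x0 + x1"
    by (rule superspace_decompose[OF M_super pS])
  have xN: "x0 \<in> N" "x1 \<in> N" using submodule_component[OF sub_N x(1,2)] pw(1) x(3) by simp_all
  consider "p = 0" | "p = 1" using bit_eq_0_or_1 by blast
  then show ?thesis
  proof cases
    case 1
    have "(w - x0) + (- x1) = w - proj w" unfolding x(3) by simp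
    also have "\<dots> \<in> N'" by (rule pw(2))
    finally have "(w - x0) + (- x1) \<in> N'" .
    moreover have "w - x0 \<in> mgrade M 0"
      using w(2) unfolding 1 by (rule cvec.subspace_diff[OF grade_subspace _ x(1)])
    moreover have "- x1 \<in> mgrade M 1" by (rule cvec.subspace_neg[OF grade_subspace x(2)])
    ultimately have "w - x0 \<in> N'" using submodule_component(1)[OF sub_N'] by blast
    then have "proj w = x0" using proj_eqI xN(1) by blast
    then show ?thesis using x(1) 1 by simp
  next
    case 2
    have "(- x0) + (w - x1) = w - proj w" unfolding x(3) by simp
    also have "\<dots> \<in> N'" by (rule pw(2))
    finally have "(- x0) + (w - x1) \<in> N'" .
    moreover have "w - x1 \<in> mgrade M 1"
      using w(2) unfolding 2 by (rule cvec.subspace_diff[OF grade_subspace _ x(2)])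
    moreover have "- x0 \<in> mgrade M 0" by (rule cvec.subspace_neg[OF grade_subspace x(1)])
    ultimately have "w - x1 \<in> N'" using submodule_component(2)[OF sub_N'] by blast
    then have "proj w = x1" using proj_eqI xN(2) by blast
    then show ?thesis using x(2) 2 by simp
  qed
qed

end

section \<open>Extensions\<close>

lemma ext_equiv_refl:
  assumes "e \<in> extensions g A C"
  shows "(e, e) \<in> ext_equiv g A C"
proof -
  obtain E i p where e: "e = (E, i, p)" by (cases e)
  have "gmod_hom E E id" by (simp add: gmod_hom_def clinear_on_def)
  moreover have "bij_betw id (gcarrier E) (gcarrier E)" by simp
  ultimately have "\<exists>f. gmod_hom E E f \<and> bij_betw f (gcarrier E) (gcarrier E) \<and>
      (\<forall>w\<in>gcarrier C. f (i w) = i w) \<and> (\<forall>w\<in>gcarrier E. p (f w) = p w)"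
    by (intro exI[of _ id]) simp
  then show ?thesis using assms by (simp add: e ext_equiv_def)
qed

lemma ext_equivD:
  assumes "((E, i, p), (E', i', p')) \<in> ext_equiv g A C"
  shows "\<exists>f. gmod_hom E E' f \<and> bij_betw f (gcarrier E) (gcarrier E') \<and>
    (\<forall>w\<in>gcarrier C. f (i w) = i' w) \<and> (\<forall>w\<in>gcarrier E. p' (f w) = p w)"
  using assms by (simp add: ext_equiv_def)

lemma trivial_Ext1_split:
  assumes "Ext1 g A C = {Ext1_zero g A C}" "e \<in> extensions g A C"
  shows "(split_extension A C, e) \<in> ext_equiv g A C"
proof -
  have "ext_equiv g A C `` {e} \<in> Ext1 g A C"
    unfolding Ext1_def using assms(2) by (rule quotientI)
  then have "ext_equiv g A C `` {e} = Ext1_zero g A C" using assms(1) by simp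
  moreover have "e \<in> ext_equiv g A C `` {e}" using ext_equiv_refl[OF assms(2)] by simp
  ultimately show ?thesis unfolding Ext1_zero_def by blast
qed


section \<open>A self-extension of a top component\<close>

text \<open>
  Here \<open>E\<close> is an extension by \<open>U\<close> of a submodule of \<open>U\<close>, via the nilpotent part of \<open>D\<close>. The situation is
  contradictory when \<open>N \<noteq> 0\<close>, which is implied by the hypothesis on \<open>Ext\<close>: a lowest weight exists.
\<close>

locale extension_situation =
  KL_object g B k V \<iota> M \<hh> + complemented_submodule g B k V \<iota> M U N N'
  for g :: "'g::complex_vector lie_sa" and B k and V :: "'v::complex_vector vertex_sa" and \<iota>
    and M :: "('v, 'm::complex_vector) vmod" and \<hh> and U N N' +
  fixes E :: "'m set" and D :: "'m \<Rightarrow> 'm"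
  assumes D: "D \<in> weight_operators"
    and sub_E: "submodule M E" and U_E: "U \<subseteq> E"
    and kernel: "\<And>w. w \<in> E \<Longrightarrow> nil D w = 0 \<longleftrightarrow> w \<in> U"
    and image: "N \<subseteq> nil D ` E"
    and L_semisimple: "\<And>w. w \<in> U \<Longrightarrow> nil L w = 0"
    and ext: "Ext1 g (top_of N) (top_of N) = {Ext1_zero g (top_of N) (top_of N)}"
begin

abbreviation topc :: "('g, 'm) gmod" where
  "topc \<equiv> top_of N"

definition A :: "'m set" where
  "A = top_space g B k V \<iota> (restrict_mod M N)"

abbreviation T :: "'m \<Rightarrow> 'm" where "T \<equiv> nil D"

lemma A_eigenvectors: "A = {w \<in> N. \<exists>\<mu>. lowest_weight N L \<mu> \<and> L w = \<mu> *\<^sub>C w}"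
  unfolding A_def top_space_def by simp

lemma A_subset_N: "A \<subseteq> N" unfolding A_eigenvectors by blast

lemma topc_simps: "gcarrier topc = A" "ggrade topc = (\<lambda>p. A \<inter> mgrade M p)" "gact topc x = cur x 0"
  using A_subset_N by (auto simp: top_component_def A_def)

text \<open>
  Extensions are formed in the category of finite-dimensional modules, so the hypothesis on \<open>Ext\<close>
  contains that the top component is such a module. In particular it is a subspace, and this forces
  a lowest weight to exist and, as sums of eigenvectors are eigenvectors, to be unique.
\<close>

lemma topc_fin_dim_module: "fin_dim_module g topc"
proof -
  have "extensions g topc topc \<noteq> {}"
    using ext unfolding Ext1_def quotient_def by fastforce
  then show ?thesis unfolding extensions_def by blast
qed

lemma A_super: "superspace A (\<lambda>p. A \<inter> mgrade M p)" and A_fin_dim: "fin_dim A"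
  using topc_fin_dim_module by (simp_all add: fin_dim_module_def lie_module_def topc_simps)

lemmas A_subspace = superspace_subspace(1)[OF A_super]

sublocale LO: spectral_operator S L by (rule L_spectral)
sublocale DO: spectral_operator S D by (rule weight_operator_spectral[OF D])

lemma geig_N: "gen_eigenspace N L \<mu> = N \<inter> LO.geig \<mu>"
  by (rule LO.geig_restrict[OF N_D(2)])

lemma U_eigenvector: "w \<in> U \<Longrightarrow> w \<in> LO.geig \<mu> \<Longrightarrow> L w = \<mu> *\<^sub>C w"
  using LO.geig_eigenvector L_semisimple by blast

lemma lowest_weight_unique: "\<exists>\<mu>. lowest_weight N L \<mu> \<and> A = {w \<in> N. L w = \<mu> *\<^sub>C w}"
proof -
  obtain \<mu> where \<mu>: "lowest_weight N L \<mu>"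
    using cvec.subspace_0[OF A_subspace] unfolding A_eigenvectors by blast
  have "0 \<in> gen_eigenspace N L \<mu>"
    unfolding geig_N using cvec.subspace_0[OF N_D(1)] cvec.subspace_0[OF LO.geig_subspace] by blast
  then obtain v where v: "v \<in> N" "v \<in> LO.geig \<mu>" "v \<noteq> 0"
    using \<mu> unfolding lowest_weight_def geig_N by blast
  have Lv: "L v = \<mu> *\<^sub>C v" using U_eigenvector v N_subset by blast
  then have vA: "v \<in> A" unfolding A_eigenvectors using \<mu> v(1) by blast
  have "L w = \<mu> *\<^sub>C w" if w: "w \<in> A" for w
  proof (cases "w = 0")
    case True
    then show ?thesis by (simp add: LO.A_zero)
  next
    case False
    have geig: "\<exists>\<nu>. L x = \<nu> *\<^sub>C x \<and> x \<in> LO.geig \<nu>" if "x \<in> A" for x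
      using that LO.eigenvector_in_geig A_subset_N N_D(2) unfolding A_eigenvectors by blast
    obtain \<mu>' where \<mu>': "L w = \<mu>' *\<^sub>C w" "w \<in> LO.geig \<mu>'" using geig[OF w] by blast
    obtain \<nu> where \<nu>: "w + v \<in> LO.geig \<nu>"
      using geig[OF cvec.subspace_add[OF A_subspace w vA]] by blast
    have "\<mu>' = \<mu>"
    proof (rule ccontr)
      assume neq: "\<mu>' \<noteq> \<mu>"
      define f where "f x = (if x = \<mu> then v else w)" for x
      have f: "sum f {\<mu>', \<mu>} \<in> LO.geig \<nu>" using neq \<nu> by (simp add: f_def)
      have inv: "invariant_subspace L (LO.geig \<nu>)"
        by (simp add: invariant_subspace_def LO.geig_subspace LO.geig_closed)
      have "f x \<in> LO.geig \<nu>" if "x \<in> {\<mu>', \<mu>}" for x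
        by (rule LO.components_in_invariant[OF inv _ _ f that]) (use v(2) \<mu>'(2) in \<open>auto simp: f_def\<close>)
      then have "v \<in> LO.geig \<nu>" "w \<in> LO.geig \<nu>" using neq by (force simp: f_def)+
      then have "\<mu> = \<nu>" "\<mu>' = \<nu>" using LO.geig_disjoint v(2,3) \<mu>'(2) False by blast+
      then show False using neq by simp
    qed
    then show ?thesis using \<mu>'(1) by simp
  qed
  then have "A = {w \<in> N. L w = \<mu> *\<^sub>C w}" using \<mu> unfolding A_eigenvectors by blast
  then show ?thesis using \<mu> by blast
qed

definition lw :: complex where
  "lw = (SOME \<mu>. lowest_weight N L \<mu> \<and> A = {w \<in> N. L w = \<mu> *\<^sub>C w})"

lemma lw: "lowest_weight N L lw" and A_eigen: "A = {w \<in> N. L w = lw *\<^sub>C w}"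
  using someI_ex[OF lowest_weight_unique] unfolding lw_def by blast+

lemma A_eq: "A = N \<inter> LO.geig lw"
  unfolding A_eigen using LO.eigenvector_in_geig U_eigenvector N_subset N_D(2) by blast

lemma A_nonzero: "A \<noteq> {0}"
  using lw unfolding lowest_weight_def geig_N A_eq by blast

lemma below_lowest_weight:
  assumes "w \<in> N" "w \<in> LO.geig (lw + (- of_int n))" "n \<ge> 1"
  shows "w = 0"
proof (rule ccontr)
  assume "w \<noteq> 0"
  then have "gen_eigenspace N L (lw + (- of_int n)) \<noteq> {0}"
    unfolding geig_N using assms by blast
  then have "Re lw \<le> Re (lw + (- of_int n))" using lw unfolding lowest_weight_def by blast
  then show False using assms(3) by simp
qed

lemma current_geig: "w \<in> LO.geig \<mu> \<Longrightarrow> cur x n w \<in> LO.geig (\<mu> + (- of_int n))"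
  by (rule LO.homogeneous_geig[OF mode_linear mode_closed L_current])

lemma zero_mode_geig: "w \<in> LO.geig \<mu> \<Longrightarrow> cur x 0 w \<in> LO.geig \<mu>"
  using current_geig[of w \<mu> x 0] by simp

lemma A_zero_mode: "a \<in> A \<Longrightarrow> cur x 0 a \<in> A"
  unfolding A_eq using N_D(3) zero_mode_geig by blast

lemma A_positive_mode: "a \<in> A \<Longrightarrow> n \<ge> 1 \<Longrightarrow> cur x n a = 0"
  unfolding A_eq using N_D(3) current_geig below_lowest_weight by blast

lemma proj_geig:
  assumes "w \<in> U" "w \<in> LO.geig \<mu>"
  shows "proj w \<in> N \<inter> LO.geig \<mu>"
proof -
  have pS: "proj w \<in> S" using proj_props(1)[OF assms(1)] N_D(2) by blast
  have "L (proj w) = proj (L w)"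
    unfolding L0_def using proj_mode[OF assms(1)] by simp
  also have "\<dots> = \<mu> *\<^sub>C proj w"
    unfolding U_eigenvector[OF assms] by (rule clinear_on_scale[OF proj_linear assms(1)])
  finally show ?thesis
    using LO.eigenvector_in_geig[OF pS] proj_props(1)[OF assms(1)] by blast
qed

lemma proj_in_A: "w \<in> U \<Longrightarrow> w \<in> LO.geig lw \<Longrightarrow> proj w \<in> A"
  unfolding A_eq by (rule proj_geig)

lemma below_lowest_weight_U:
  assumes "w \<in> U" "w \<in> LO.geig (lw + (- of_int n))" "n \<ge> 1"
  shows "w \<in> N'"
  using below_lowest_weight[of "proj w" n] proj_geig[OF assms(1,2)] assms(3) proj_zero_iff[OF assms(1)]
  by blast

lemmas E_D = submoduleD[OF sub_E]
lemmas T_endo = even_endoD[OF nil_endo[OF D]]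
lemmas T_add = clinear_on_add[OF T_endo(1)] and T_diff = clinear_on_diff[OF S_subspace T_endo(1)]

lemma T_L: "w \<in> S \<Longrightarrow> L (T w) = T (L w)"
  unfolding L0_def by (rule T_endo(3)[symmetric])

text \<open>
  To lift a homogeneous element of \<open>A\<close>, take an arbitrary preimage under \<open>T\<close>, then its component of
  the right parity, and then the component of this in the generalized \<open>L0\<close>-eigenspace of the lowest
  weight. All this commutes with \<open>T\<close>.
\<close>

lemma section_exists:
  obtains s where "clinear_on A s" "\<And>a. a \<in> A \<Longrightarrow> s a \<in> E" "\<And>a. a \<in> A \<Longrightarrow> s a \<in> LO.geig lw"
    "\<And>a. a \<in> A \<Longrightarrow> T (s a) = a" "\<And>a p. a \<in> A \<Longrightarrow> a \<in> mgrade M p \<Longrightarrow> s a \<in> mgrade M p"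
proof -
  let ?U = "\<lambda>p. E \<inter> mgrade M p \<inter> LO.geig lw"
  have sub: "cvec.subspace (E \<inter> mgrade M p)" for p
    by (rule cvec.subspace_inter[OF E_D(1) grade_subspace])
  have "\<exists>u\<in>?U p. T u = a" if a: "a \<in> A \<inter> mgrade M p" for p a
  proof -
    obtain e where e: "e \<in> E" "T e = a" using a A_subset_N image by blast
    have eS: "e \<in> S" using e(1) E_D(2) by blast
    obtain e0 e1 where e': "e0 \<in> mgrade M 0" "e1 \<in> mgrade M 1" "e = e0 + e1"
      by (rule superspace_decompose[OF M_super eS])
    have eE: "e0 \<in> E" "e1 \<in> E" using submodule_component[OF sub_E e'(1,2)] e(1) e'(3) by simp_all
    note Te = even_endo_component[OF nil_endo[OF D] e'(1,2)]
    have zero: "0 \<in> mgrade M q" for q by (rule cvec.subspace_0[OF grade_subspace])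
    have "\<exists>u\<in>E \<inter> mgrade M p. T u = a"
    proof -
      consider "p = 0" | "p = 1" using bit_eq_0_or_1 by blast
      then show ?thesis
      proof cases
        case 1
        have "T e0 + T e1 = a + 0" using Te(1) e(2) e'(3) by simp
        then have "T e0 = a"
          using superspace_unique(1)[OF M_super Te(2,3) _ zero] a 1 by blast
        then show ?thesis using eE(1) e'(1) 1 by blast
      next
        case 2
        have "T e0 + T e1 = 0 + a" using Te(1) e(2) e'(3) by simp
        then have "T e1 = a"
          using superspace_unique(2)[OF M_super Te(2,3) zero] a 2 by blast
        then show ?thesis using eE(2) e'(2) 2 by blast
      qed
    qed
    then obtain u where u: "u \<in> E \<inter> mgrade M p" "T u = a" by blast
    have "invariant_subspace L (E \<inter> mgrade M p)"
      using sub submodule_weight_invariant[OF sub_E L_weight_operator] L_even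
      unfolding invariant_subspace_def by blast
    moreover have "E \<inter> mgrade M p \<subseteq> S" using E_D(2) by blast
    moreover have "T u \<in> LO.geig lw" using u(2) a A_eq by blast
    ultimately have "\<exists>v \<in> (E \<inter> mgrade M p) \<inter> LO.geig lw. T v = T u"
      using LO.preimage_in_geig[OF T_endo(1,4) T_L _ _ u(1)] by blast
    then show ?thesis using u(2) by blast
  qed
  moreover have "cvec.subspace (?U p)" for p
    by (rule cvec.subspace_inter[OF sub LO.geig_subspace])
  moreover have "clinear_on (?U p) T" for p
    using E_D(2) by (intro clinear_on_subset[OF T_endo(1)]) blast
  ultimately obtain s where s: "clinear_on A s"
      "\<And>p a. a \<in> A \<inter> mgrade M p \<Longrightarrow> s a \<in> ?U p \<and> T (s a) = a"
    using graded_section_exists[OF A_super, of ?U T] by metis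
  have "s a \<in> E \<inter> LO.geig lw \<and> T (s a) = a" if a: "a \<in> A" for a
  proof -
    obtain a0 a1 where a': "a0 \<in> A \<inter> mgrade M 0" "a1 \<in> A \<inter> mgrade M 1" "a = a0 + a1"
      by (rule superspace_decompose[OF A_super a])
    have "s a = s a0 + s a1" unfolding a'(3) using a' by (intro clinear_on_add[OF s(1)]) blast+
    moreover have "T (s a0 + s a1) = T (s a0) + T (s a1)"
      using s(2)[OF a'(1)] s(2)[OF a'(2)] E_D(2) by (intro T_add) blast+
    moreover have "s a0 + s a1 \<in> E \<inter> LO.geig lw"
      using s(2)[OF a'(1)] s(2)[OF a'(2)] cvec.subspace_add[OF E_D(1)]
        cvec.subspace_add[OF LO.geig_subspace] by blast
    ultimately show ?thesis using s(2)[OF a'(1)] s(2)[OF a'(2)] a'(3) by simp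
  qed
  then show ?thesis using that[of s] s by blast
qed

end

locale extension_section = extension_situation g B k V \<iota> M \<hh> U N N' E D
  for g :: "'g::complex_vector lie_sa" and B k and V :: "'v::complex_vector vertex_sa" and \<iota>
    and M :: "('v, 'm::complex_vector) vmod" and \<hh> U N N' E D +
  fixes s :: "'m \<Rightarrow> 'm"
  assumes s_linear: "clinear_on A s" and s_E: "a \<in> A \<Longrightarrow> s a \<in> E"
    and s_geig: "a \<in> A \<Longrightarrow> s a \<in> LO.geig lw" and T_s: "a \<in> A \<Longrightarrow> T (s a) = a"
    and s_even: "a \<in> A \<Longrightarrow> a \<in> mgrade M p \<Longrightarrow> s a \<in> mgrade M p"
begin

lemmas A_add = cvec.subspace_add[OF A_subspace] and A_scale = cvec.subspace_scale[OF A_subspace]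
  and s_add = clinear_on_add[OF s_linear] and s_scale = clinear_on_scale[OF s_linear]
  and s_diff = clinear_on_diff[OF A_subspace s_linear]
  and s_zero = clinear_on_zero[OF A_subspace s_linear]

lemma A_S: "a \<in> A \<Longrightarrow> a \<in> S" and s_S: "a \<in> A \<Longrightarrow> s a \<in> S"
  using A_subset_N N_D(2) s_E E_D(2) by blast+

lemma T_zero_mode: "w \<in> S \<Longrightarrow> T (cur x n w) = cur x n (T w)"
  by (rule T_endo(3))

lemma in_U_iff: "w \<in> E \<Longrightarrow> w \<in> U \<longleftrightarrow> T w = 0"
  using kernel by blast

definition defect :: "'g \<Rightarrow> 'm \<Rightarrow> 'm" where
  "defect x a = cur x 0 (s a) - s (cur x 0 a)"

definition cocycle :: "'g \<Rightarrow> 'm \<Rightarrow> 'm" where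
  "cocycle x a = proj (defect x a)"

lemma defect_E: "a \<in> A \<Longrightarrow> defect x a \<in> E"
  unfolding defect_def
  by (intro cvec.subspace_diff[OF E_D(1)] E_D(3) s_E A_zero_mode)

lemma defect_geig: "a \<in> A \<Longrightarrow> defect x a \<in> LO.geig lw"
  unfolding defect_def
  by (intro cvec.subspace_diff[OF LO.geig_subspace] zero_mode_geig s_geig A_zero_mode)

lemma defect_U:
  assumes a: "a \<in> A"
  shows "defect x a \<in> U"
proof -
  have "T (defect x a) = T (cur x 0 (s a)) - T (s (cur x 0 a))"
    unfolding defect_def by (rule T_diff[OF mode_closed[OF s_S[OF a]] s_S[OF A_zero_mode[OF a]]])
  also have "\<dots> = cur x 0 a - cur x 0 a"
    by (simp add: T_zero_mode[OF s_S[OF a]] T_s[OF a] T_s[OF A_zero_mode[OF a]])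
  finally show ?thesis using in_U_iff[OF defect_E[OF a]] by simp
qed

lemma cocycle_A: "a \<in> A \<Longrightarrow> cocycle x a \<in> A"
  unfolding cocycle_def by (rule proj_in_A[OF defect_U defect_geig])

lemma defect_add: "a \<in> A \<Longrightarrow> b \<in> A \<Longrightarrow> defect x (a + b) = defect x a + defect x b"
  and defect_scale: "a \<in> A \<Longrightarrow> defect x (c *\<^sub>C a) = c *\<^sub>C defect x a"
  by (simp_all add: defect_def s_add s_scale A_S s_S mode_add mode_scale A_zero_mode
      cvec.scale_right_diff_distrib)

lemma defect_add_left: "a \<in> A \<Longrightarrow> defect (x + y) a = defect x a + defect y a"
  and defect_scale_left: "a \<in> A \<Longrightarrow> defect (c *\<^sub>C x) a = c *\<^sub>C defect x a"
  by (simp_all add: defect_def s_add s_scale A_S s_S cur_add cur_scale A_zero_mode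
      cvec.scale_right_diff_distrib)

lemmas proj_add = clinear_on_add[OF proj_linear] and proj_scale = clinear_on_scale[OF proj_linear]
  and proj_diff = clinear_on_diff[OF U_D(1) proj_linear]

lemma cocycle_linear: "clinear_on A (cocycle x)"
  by (rule clinear_onI) (simp_all add: cocycle_def defect_add defect_scale proj_add proj_scale defect_U)

lemma cocycle_linear_left: "a \<in> A \<Longrightarrow> clinear_on UNIV (\<lambda>x. cocycle x a)"
  by (rule clinear_onI)
    (simp_all add: cocycle_def defect_add_left defect_scale_left proj_add proj_scale defect_U)

lemma cocycle_grade:
  assumes x: "x \<in> gr p" and a: "a \<in> A" "a \<in> mgrade M q"
  shows "cocycle x a \<in> mgrade M (p + q)"
proof -
  have "defect x a \<in> mgrade M (p + q)"
    unfolding defect_def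
    by (intro cvec.subspace_diff[OF grade_subspace] cur_grade[OF x] s_even A_zero_mode a)
  then show ?thesis unfolding cocycle_def by (rule proj_even[OF defect_U[OF a(1)]])
qed

lemma zero_mode_bracket:
  assumes x: "x \<in> gr p" and y: "y \<in> gr q" and w: "w \<in> S"
  shows "cur (brac x y) 0 w = cur x 0 (cur y 0 w) - koszul p q *\<^sub>C cur y 0 (cur x 0 w)"
  using current_commutator[OF x y w, of 0 0] by simp

text \<open>
  Both terms on the left add up to the failure of \<open>s\<close> to commute with the product \<open>x y\<close>; the cocycle
  identity is the antisymmetrization of this.
\<close>

lemma cocycle_composition:
  assumes a: "a \<in> A"
  shows "cur x 0 (cur y 0 (s a)) - s (cur x 0 (cur y 0 a)) \<in> U"
    and "cur x 0 (cocycle y a) + cocycle x (cur y 0 a) =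
      proj (cur x 0 (cur y 0 (s a)) - s (cur x 0 (cur y 0 a)))"
proof -
  have ya: "cur y 0 a \<in> A" by (rule A_zero_mode[OF a])
  have "cur x 0 (defect y a) = cur x 0 (cur y 0 (s a)) - cur x 0 (s (cur y 0 a))"
    unfolding defect_def by (rule mode_diff[OF mode_closed[OF s_S[OF a]] s_S[OF ya]])
  then have eq: "cur x 0 (cur y 0 (s a)) - s (cur x 0 (cur y 0 a)) =
      cur x 0 (defect y a) + defect x (cur y 0 a)"
    by (simp add: defect_def)
  have xU: "cur x 0 (defect y a) \<in> U" by (rule U_D(3)[OF defect_U[OF a]])
  show "cur x 0 (cur y 0 (s a)) - s (cur x 0 (cur y 0 a)) \<in> U"
    unfolding eq by (rule cvec.subspace_add[OF U_D(1) xU defect_U[OF ya]])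
  show "cur x 0 (cocycle y a) + cocycle x (cur y 0 a) =
      proj (cur x 0 (cur y 0 (s a)) - s (cur x 0 (cur y 0 a)))"
    unfolding eq proj_add[OF xU defect_U[OF ya]] cocycle_def proj_mode[OF defect_U[OF a]] ..
qed

lemma cocycle_bracket:
  assumes x: "x \<in> gr p" and y: "y \<in> gr q" and a: "a \<in> A"
  shows "cocycle (brac x y) a = (cur x 0 (cocycle y a) + cocycle x (cur y 0 a)) -
    koszul p q *\<^sub>C (cur y 0 (cocycle x a) + cocycle y (cur x 0 a))"
proof -
  let ?c = "koszul p q"
  let ?d = "\<lambda>x y. cur x 0 (cur y 0 (s a)) - s (cur x 0 (cur y 0 a))"
  have AA: "cur x 0 (cur y 0 a) \<in> A" "cur y 0 (cur x 0 a) \<in> A" by (intro A_zero_mode a)+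
  have "s (cur (brac x y) 0 a) = s (cur x 0 (cur y 0 a)) - ?c *\<^sub>C s (cur y 0 (cur x 0 a))"
    unfolding zero_mode_bracket[OF x y A_S[OF a]] s_diff[OF AA(1) A_scale[OF AA(2)]] s_scale[OF AA(2)] ..
  then have "defect (brac x y) a = ?d x y - ?c *\<^sub>C ?d y x"
    unfolding defect_def zero_mode_bracket[OF x y s_S[OF a]]
    by (simp add: cvec.scale_right_diff_distrib)
  then have "cocycle (brac x y) a = proj (?d x y) - ?c *\<^sub>C proj (?d y x)"
    unfolding cocycle_def
    using proj_diff[OF cocycle_composition(1)[OF a, of x y]
        cvec.subspace_scale[OF U_D(1) cocycle_composition(1)[OF a, of y x], of ?c]]
      proj_scale[OF cocycle_composition(1)[OF a, of y x], of ?c] by simp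
  then show ?thesis by (simp only: cocycle_composition(2)[OF a])
qed

text \<open>For the zero cocycle this is the split extension.\<close>

definition ext_mod :: "('g, 'm \<times> 'm) gmod" where
  "ext_mod = \<lparr> gcarrier = A \<times> A, ggrade = (\<lambda>p. (A \<inter> mgrade M p) \<times> (A \<inter> mgrade M p)),
     gact = (\<lambda>x (c, a). (cur x 0 c + cocycle x a, cur x 0 a)) \<rparr>"

lemma ext_mod_simps [simp]:
  "gcarrier ext_mod = A \<times> A" "ggrade ext_mod = (\<lambda>p. (A \<inter> mgrade M p) \<times> (A \<inter> mgrade M p))"
  "gact ext_mod x (c, a) = (cur x 0 c + cocycle x a, cur x 0 a)"
  by (simp_all add: ext_mod_def)

lemma ext_mod_module: "fin_dim_module g ext_mod"
  unfolding fin_dim_module_def lie_module_def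
proof (intro conjI allI ballI)
  show "superspace (gcarrier ext_mod) (ggrade ext_mod)"
    unfolding ext_mod_simps by (rule superspace_Times[OF A_super A_super])
  show "clinear_on (gcarrier ext_mod) (gact ext_mod x)" for x
    by (rule clinear_onI)
      (auto simp: scaleC_prod_def mode_add mode_scale A_S clinear_on_add[OF cocycle_linear]
        clinear_on_scale[OF cocycle_linear] cvec.scale_right_distrib)
  show "clinear_on UNIV (\<lambda>x. gact ext_mod x w)" if "w \<in> gcarrier ext_mod" for w
    using that
    by (auto intro!: clinear_onI simp: scaleC_prod_def cur_add cur_scale A_S
        clinear_on_add[OF cocycle_linear_left] clinear_on_scale[OF cocycle_linear_left]
        cvec.scale_right_distrib)
  show "fin_dim (gcarrier ext_mod)" by (simp add: fin_dim_Times A_fin_dim)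
next
  fix p q x w assume x: "x \<in> gr p" and "w \<in> ggrade ext_mod q"
  then obtain c a where w: "w = (c, a)" "c \<in> A" "c \<in> mgrade M q" "a \<in> A" "a \<in> mgrade M q"
    by auto
  have "cur x 0 c + cocycle x a \<in> A" "cur x 0 a \<in> A"
    by (intro A_add A_zero_mode cocycle_A w)+
  moreover have "cur x 0 c + cocycle x a \<in> mgrade M (p + q)" "cur x 0 a \<in> mgrade M (p + q)"
    by (intro cvec.subspace_add[OF grade_subspace] cur_grade[OF x] cocycle_grade[OF x] w)+
  ultimately show "gact ext_mod x w \<in> ggrade ext_mod (p + q)"
    unfolding w(1) ext_mod_simps by blast
next
  fix p q x y w assume x: "x \<in> gr p" and y: "y \<in> gr q" and "w \<in> gcarrier ext_mod"
  then obtain c a where w: "w = (c, a)" "c \<in> A" "a \<in> A" by auto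
  have mode: "cur u 0 (b + cocycle v a) = cur u 0 b + cur u 0 (cocycle v a)" if "b \<in> A" for u v b
    by (rule mode_add[OF A_S[OF that] A_S[OF cocycle_A[OF w(3)]]])
  have "cur (brac x y) 0 c + cocycle (brac x y) a =
      (cur x 0 (cur y 0 c + cocycle y a) + cocycle x (cur y 0 a)) -
      koszul p q *\<^sub>C (cur y 0 (cur x 0 c + cocycle x a) + cocycle y (cur x 0 a))"
    unfolding zero_mode_bracket[OF x y A_S[OF w(2)]] cocycle_bracket[OF x y w(3)]
      mode[OF A_zero_mode[OF w(2)]]
    by (simp add: cvec.scale_right_distrib)
  then show "gact ext_mod (brac x y) w = gact ext_mod x (gact ext_mod y w) -
      koszul p q *\<^sub>C gact ext_mod y (gact ext_mod x w)"
    unfolding w(1) ext_mod_simps zero_mode_bracket[OF x y A_S[OF w(3)]]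
    by (simp add: scaleC_prod_def)
qed

lemma ext_mod_extension: "(ext_mod, (\<lambda>c. (c, 0)), snd) \<in> extensions g topc topc"
proof -
  have coc_zero: "cocycle x 0 = 0" for x by (rule clinear_on_zero[OF A_subspace cocycle_linear])
  have "gmod_hom topc ext_mod (\<lambda>c. (c, 0))"
    using cvec.subspace_0[OF A_subspace] cvec.subspace_0[OF grade_subspace]
    unfolding gmod_hom_def topc_simps
    by (auto intro!: clinear_onI simp: scaleC_prod_def coc_zero mode_zero)
  moreover have "gmod_hom ext_mod topc snd"
    unfolding gmod_hom_def topc_simps by (auto intro!: clinear_onI simp: scaleC_prod_def)
  moreover have "inj_on (\<lambda>c. (c, 0)) (gcarrier topc)" by (auto intro: inj_onI)
  moreover have "snd ` gcarrier ext_mod = gcarrier topc"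
    using cvec.subspace_0[OF A_subspace] by (auto simp: topc_simps image_iff)
  moreover have "(\<lambda>c. (c, 0)) ` gcarrier topc = {w \<in> gcarrier ext_mod. snd w = 0}"
    using cvec.subspace_0[OF A_subspace] by (auto simp: topc_simps)
  ultimately show ?thesis
    using ext_mod_module topc_fin_dim_module unfolding extensions_def by blast
qed

text \<open>
  An isomorphism with the split extension maps \<open>(0, a)\<close> to \<open>(\<sigma> a, a)\<close>. Its \<open>g\<close>-linearity says that the
  cocycle is the coboundary of \<open>\<sigma>\<close>.
\<close>

lemma coboundary:
  obtains \<sigma> where "clinear_on A \<sigma>" "\<And>a. a \<in> A \<Longrightarrow> \<sigma> a \<in> A"
    "\<And>x a. a \<in> A \<Longrightarrow> \<sigma> (cur x 0 a) = cur x 0 (\<sigma> a) + cocycle x a"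
proof -
  define Sp where "Sp = (\<lparr> gcarrier = A \<times> A,
      ggrade = (\<lambda>p. (A \<inter> mgrade M p) \<times> (A \<inter> mgrade M p)),
      gact = (\<lambda>x (c, a). (cur x 0 c, cur x 0 a)) \<rparr> :: ('g, 'm \<times> 'm) gmod)"
  have Sp: "split_extension topc topc = (Sp, (\<lambda>c. (c, 0)), snd)"
    unfolding split_extension_def Sp_def topc_simps ..
  obtain f where f: "gmod_hom Sp ext_mod f" "bij_betw f (gcarrier Sp) (gcarrier ext_mod)"
      "\<forall>w\<in>gcarrier Sp. snd (f w) = snd w"
    using ext_equivD[OF trivial_Ext1_split[OF ext ext_mod_extension, unfolded Sp]] by blast
  have Sp_simps: "gcarrier Sp = A \<times> A" "gact Sp x (c, a) = (cur x 0 c, cur x 0 a)" for x c a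
    by (simp_all add: Sp_def)
  have f_lin: "clinear_on (A \<times> A) f"
    using f(1) unfolding gmod_hom_def Sp_simps by blast
  have f_act: "f (cur x 0 0, cur x 0 a) = gact ext_mod x (f (0, a))" if "a \<in> A" for x a
  proof -
    have "(0, a) \<in> gcarrier Sp" using that cvec.subspace_0[OF A_subspace] by (simp add: Sp_simps)
    then have "f (gact Sp x (0, a)) = gact ext_mod x (f (0, a))"
      using f(1) unfolding gmod_hom_def by blast
    then show ?thesis by (simp only: Sp_simps)
  qed
  define \<sigma> where "\<sigma> a = fst (f (0, a))" for a
  have zA: "(0, a) \<in> A \<times> A" if "a \<in> A" for a using that cvec.subspace_0[OF A_subspace] by blast
  have f\<sigma>: "f (0, a) = (\<sigma> a, a)" if "a \<in> A" for a
    using f(3) zA[OF that] by (simp add: \<sigma>_def prod_eq_iff Sp_simps)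
  have \<sigma>A: "\<sigma> a \<in> A" if "a \<in> A" for a
  proof -
    have "f (0, a) \<in> A \<times> A"
      using bij_betwE[OF f(2)] zA[OF that] unfolding Sp_simps ext_mod_simps by blast
    then show ?thesis by (simp add: f\<sigma>[OF that])
  qed
  show ?thesis
  proof (rule that)
    show "clinear_on A \<sigma>"
    proof (rule clinear_onI)
      fix a b assume ab: "a \<in> A" "b \<in> A"
      have "f (0, a + b) = f (0, a) + f (0, b)"
        using clinear_on_add[OF f_lin zA[OF ab(1)] zA[OF ab(2)]] by simp
      then show "\<sigma> (a + b) = \<sigma> a + \<sigma> b" by (simp add: \<sigma>_def)
    next
      fix c a assume a: "a \<in> A"
      have "f (0, c *\<^sub>C a) = c *\<^sub>C f (0, a)"
        using clinear_on_scale[OF f_lin zA[OF a], of c] by (simp add: scaleC_prod_def)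
      then show "\<sigma> (c *\<^sub>C a) = c *\<^sub>C \<sigma> a" by (simp add: \<sigma>_def scaleC_prod_def)
    qed
    show "\<sigma> a \<in> A" if "a \<in> A" for a by (rule \<sigma>A[OF that])
    show "\<sigma> (cur x 0 a) = cur x 0 (\<sigma> a) + cocycle x a" if a: "a \<in> A" for x a
      using f_act[OF a, of x] f\<sigma>[OF a] f\<sigma>[OF A_zero_mode[OF a, of x]] by (simp add: mode_zero)
  qed
qed

text \<open>
  Correcting \<open>s\<close> by the coboundary gives a section that is \<open>g\<close>-linear modulo \<open>N'\<close>. Modulo \<open>N'\<close> its
  values are also killed by the positive modes, so that \<open>L0\<close> acts on them through the Casimir
  operator of \<open>g\<close>. Hence every weight operator commutes with the section modulo \<open>N'\<close>, and the lift
  of an eigenvector \<open>a\<close> of \<open>D\<close> is an eigenvector modulo \<open>N'\<close>. So \<open>T\<close> sends it into \<open>N'\<close>, but also to \<open>a\<close>.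
\<close>

lemma inconsistent: False
proof -
  obtain \<sigma> where \<sigma>: "clinear_on A \<sigma>" "\<And>a. a \<in> A \<Longrightarrow> \<sigma> a \<in> A"
    "\<And>x a. a \<in> A \<Longrightarrow> \<sigma> (cur x 0 a) = cur x 0 (\<sigma> a) + cocycle x a"
    by (rule coboundary) blast
  define s' where "s' a = s a + \<sigma> a" for a
  have \<sigma>U: "\<sigma> a \<in> U" if "a \<in> A" for a using \<sigma>(2)[OF that] A_subset_N N_subset by blast
  have s'E: "s' a \<in> E" if "a \<in> A" for a
    unfolding s'_def using cvec.subspace_add[OF E_D(1) s_E[OF that]] \<sigma>U[OF that] U_E by blast
  have s'S: "s' a \<in> S" if "a \<in> A" for a using s'E[OF that] E_D(2) by blast
  have s'geig: "s' a \<in> LO.geig lw" if a: "a \<in> A" for a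
  proof -
    have "\<sigma> a \<in> LO.geig lw" using \<sigma>(2)[OF a] unfolding A_eq by blast
    then show ?thesis
      unfolding s'_def by (rule cvec.subspace_add[OF LO.geig_subspace s_geig[OF a]])
  qed
  have Ts': "T (s' a) = a" if a: "a \<in> A" for a
  proof -
    have "T (\<sigma> a) = 0" using kernel \<sigma>U[OF a] U_E by blast
    then show ?thesis
      unfolding s'_def using T_add[OF s_S[OF a] A_S[OF \<sigma>(2)[OF a]]] T_s[OF a] by simp
  qed
  have s'_lin: "clinear_on A s'"
    unfolding s'_def by (rule clinear_onI)
      (simp_all add: s_add s_scale clinear_on_add[OF \<sigma>(1)] clinear_on_scale[OF \<sigma>(1)]
        cvec.scale_right_distrib)
  have hom: "cur x 0 (s' a) - s' (cur x 0 a) \<in> N'" if a: "a \<in> A" for x a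
  proof -
    let ?\<gamma> = "cocycle x a"
    have "cur x 0 (s' a) = cur x 0 (s a) + cur x 0 (\<sigma> a)"
      unfolding s'_def by (rule mode_add[OF s_S[OF a] A_S[OF \<sigma>(2)[OF a]]])
    then have eq: "cur x 0 (s' a) - s' (cur x 0 a) = defect x a - ?\<gamma>"
      by (simp add: s'_def \<sigma>(3)[OF a] defect_def)
    show ?thesis
      unfolding eq cocycle_def by (rule proj_props(2)[OF defect_U[OF a]])
  qed
  have pos: "cur x n (s' a) \<in> N'" if a: "a \<in> A" and n: "n \<ge> 1" for x n a
  proof (rule below_lowest_weight_U[OF _ current_geig[OF s'geig[OF a]] n])
    have "T (cur x n (s' a)) = cur x n a"
      using T_endo(3)[OF s'S[OF a]] Ts'[OF a] by simp
    then show "cur x n (s' a) \<in> U"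
      using in_U_iff[OF E_D(3)[OF s'E[OF a]]] A_positive_mode[OF a n] by simp
  qed
  have hom_h: "casimir_zero_modes (s' a) - s' (casimir_zero_modes a) \<in> N'" if a: "a \<in> A" for a
  proof -
    let ?c = "1 / (2 * (k + dual_coxeter g B))"
    let ?e = "\<lambda>i. (if i \<in> gr 1 then - 1 else 1 :: complex)"
    have AA: "cur i 0 (cur (dv i) 0 a) \<in> A" for i by (intro A_zero_mode a)
    have summand: "cur i 0 (cur (dv i) 0 (s' a)) - s' (cur i 0 (cur (dv i) 0 a)) \<in> N'" for i
    proof -
      have da: "cur (dv i) 0 a \<in> A" by (rule A_zero_mode[OF a])
      have "cur i 0 (cur (dv i) 0 (s' a) - s' (cur (dv i) 0 a)) =
          cur i 0 (cur (dv i) 0 (s' a)) - cur i 0 (s' (cur (dv i) 0 a))"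
        by (rule mode_diff[OF mode_closed[OF s'S[OF a]] s'S[OF da]])
      then have eq: "cur i 0 (cur (dv i) 0 (s' a)) - s' (cur i 0 (cur (dv i) 0 a)) =
          cur i 0 (cur (dv i) 0 (s' a) - s' (cur (dv i) 0 a)) +
          (cur i 0 (s' (cur (dv i) 0 a)) - s' (cur i 0 (cur (dv i) 0 a)))"
        by simp
      show ?thesis
        unfolding eq by (rule cvec.subspace_add[OF N'_D(1) N'_D(3)[OF hom[OF a]] hom[OF da]])
    qed
    have "s' (casimir_zero_modes a) = ?c *\<^sub>C s' (\<Sum>i\<in>X. ?e i *\<^sub>C cur i 0 (cur (dv i) 0 a))"
      unfolding casimir_zero_modes_def
      by (rule clinear_on_scale[OF s'_lin cvec.subspace_sum[OF A_subspace]]) (rule A_scale[OF AA])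
    also have "s' (\<Sum>i\<in>X. ?e i *\<^sub>C cur i 0 (cur (dv i) 0 a)) =
        (\<Sum>i\<in>X. s' (?e i *\<^sub>C cur i 0 (cur (dv i) 0 a)))"
      by (rule clinear_on_sum[OF A_subspace s'_lin]) (rule A_scale[OF AA])
    also have "\<dots> = (\<Sum>i\<in>X. ?e i *\<^sub>C s' (cur i 0 (cur (dv i) 0 a)))"
      by (rule sum.cong[OF refl clinear_on_scale[OF s'_lin AA]])
    finally have "casimir_zero_modes (s' a) - s' (casimir_zero_modes a) =
        ?c *\<^sub>C (\<Sum>i\<in>X. ?e i *\<^sub>C (cur i 0 (cur (dv i) 0 (s' a)) - s' (cur i 0 (cur (dv i) 0 a))))"
      unfolding casimir_zero_modes_def by (simp only: cvec.scale_right_diff_distrib sum_subtractf)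
    also have "\<dots> \<in> N'"
      by (intro cvec.subspace_scale[OF N'_D(1)] cvec.subspace_sum[OF N'_D(1)] summand)
    finally show ?thesis .
  qed
  have hom_L: "L (s' a) - s' (L a) \<in> N'" if a: "a \<in> A" for a
  proof -
    have "L a - casimir_zero_modes a \<in> {0}"
      by (rule L_casimir_modulo[OF _ _ _ A_S[OF a]])
        (auto simp: A_positive_mode[OF a] mode_zero cvec.subspace_0[OF S_subspace])
    then have "L (s' a) - s' (L a) =
        (L (s' a) - casimir_zero_modes (s' a)) + (casimir_zero_modes (s' a) - s' (casimir_zero_modes a))"
      by simp
    also have "\<dots> \<in> N'"
      by (rule cvec.subspace_add[OF N'_D(1)
            L_casimir_modulo[OF N'_D(1,2) N'_D(3) s'S[OF a] pos[OF a]] hom_h[OF a]])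
    finally show ?thesis .
  qed
  have hom_D: "D (s' a) - s' (D a) \<in> N'" and D_A: "D a \<in> A" if a: "a \<in> A" for a
  proof -
    have LA: "L a \<in> A" using a A_scale[OF a] unfolding A_eigen by simp
    from D have "D (s' a) - s' (D a) \<in> N' \<and> D a \<in> A"
    proof (cases rule: weight_operator_cases)
      case 1
      show ?thesis unfolding 1 using hom_L[OF a] LA by blast
    next
      case (2 h)
      show ?thesis unfolding 2 using hom[OF a] A_zero_mode[OF a] by blast
    qed
    then show "D (s' a) - s' (D a) \<in> N'" "D a \<in> A" by blast+
  qed
  have "invariant_subspace D A" using A_subspace D_A by (simp add: invariant_subspace_def)
  moreover have "A \<subseteq> S" using A_S by blast
  ultimately obtain c a where a: "a \<in> A" "a \<noteq> 0" "D a = c *\<^sub>C a"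
    using DO.fin_dim_invariant_eigenvector[OF A_fin_dim _ _ A_nonzero] by metis
  have "D (s' a) - c *\<^sub>C s' a \<in> N'"
    using hom_D[OF a(1)] clinear_on_scale[OF s'_lin a(1), of c] a(3) by simp
  moreover have "T w = 0" if "w \<in> N'" for w using that kernel N'_subset U_E by blast
  ultimately have "T (s' a) \<in> N'"
    using DO.nil_part_of_eigenvector_modulo[OF submodule_weight_invariant[OF sub_N' D] N'_D(2)]
      s'S[OF a(1)] by blast
  then have "a \<in> N \<inter> N'" using Ts'[OF a(1)] a(1) A_subset_N by auto
  then show False using disjoint a(2) by blast
qed

end

lemma (in extension_situation) no_extension_situation: False
proof -
  obtain s where s: "clinear_on A s" "\<And>a. a \<in> A \<Longrightarrow> s a \<in> E" "\<And>a. a \<in> A \<Longrightarrow> s a \<in> LO.geig lw"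
    "\<And>a. a \<in> A \<Longrightarrow> T (s a) = a" "\<And>a p. a \<in> A \<Longrightarrow> a \<in> mgrade M p \<Longrightarrow> s a \<in> mgrade M p"
    by (rule section_exists) blast
  interpret extension_section g B k V \<iota> M \<hh> U N N' E D s
    by unfold_locales (fact s)+
  show False by (rule inconsistent)
qed


section \<open>Vanishing of the nilpotent parts\<close>

text \<open>
  If the joint kernel \<open>U\<close> were smaller, the impossible extension would arise: \<open>E\<close> consists of the
  vectors of a larger joint kernel that the nilpotent part of one further operator sends into \<open>U\<close>.
  Semisimplicity is used for the image of \<open>E\<close>, to find \<open>N\<close>, and for \<open>U\<close>, to find the complement.
\<close>

lemma (in KL_object) joint_kernel_eq_carrier:
  assumes Y: "finite Y" "\<hh> = cvec.span Y"
    and ss: "semisimple_category (KL_fin g \<hh> B k V \<iota> :: ('v, 'm) vmod set)"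
    and ext: "\<And>M :: ('v, 'm) vmod. M \<in> KL g B k V \<iota> \<Longrightarrow> irreducible_mod M \<Longrightarrow>
      Ext1 g (top_component g B k V \<iota> M) (top_component g B k V \<iota> M) =
        {Ext1_zero g (top_component g B k V \<iota> M) (top_component g B k V \<iota> M)}"
  shows "joint_kernel (insert L ((\<lambda>h. cur h 0) ` Y)) = S"
proof (rule ccontr)
  define \<D> where "\<D> = insert L ((\<lambda>h. cur h 0) ` Y)"
  define U where "U = joint_kernel \<D>"
  assume "joint_kernel (insert L ((\<lambda>h. cur h 0) ` Y)) \<noteq> S"
  then have neq: "S \<noteq> U" by (simp add: U_def \<D>_def)
  have fin: "finite \<D>" using Y(1) by (simp add: \<D>_def)
  have "Y \<subseteq> \<hh>" unfolding Y(2) by (rule cvec.span_superset)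
  then have wt: "\<D> \<subseteq> weight_operators"
    unfolding weight_operators_def \<D>_def by (intro insert_mono image_mono)
  \<comment> \<open>If \<open>F\<close> is a maximal family with joint kernel larger than \<open>U\<close>, then inside this joint kernel \<open>U\<close>
     is the kernel of the nilpotent part of a single operator \<open>D\<close>.\<close>
  define Z where "Z = {F. F \<subseteq> \<D> \<and> joint_kernel F \<noteq> U}"
  have "finite Z" unfolding Z_def using fin by simp
  moreover have "{} \<in> Z" unfolding Z_def using neq by (simp add: joint_kernel_empty)
  ultimately obtain F where F: "F \<in> Z" and max: "\<And>F'. F' \<in> Z \<Longrightarrow> F \<subseteq> F' \<Longrightarrow> F = F'"
    using finite_has_maximal[of Z] by blast
  have FD: "F \<subseteq> \<D>" "joint_kernel F \<noteq> U" using F by (simp_all add: Z_def)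
  from FD(2) have "F \<noteq> \<D>" unfolding U_def by blast
  then obtain D where D: "D \<in> \<D>" "D \<notin> F" using FD(1) by blast
  have "insert D F \<notin> Z" using max D(2) by blast
  then have U_eq: "U = {w \<in> joint_kernel F. nil D w \<in> {0}}"
    unfolding Z_def using FD(1) D(1) by (simp add: joint_kernel_insert)
  have D_wt: "D \<in> weight_operators" using D(1) wt by blast
  have sub_F: "submodule M (joint_kernel F)"
    by (rule joint_kernel_submodule[OF finite_subset[OF FD(1) fin] order_trans[OF FD(1) wt]])
  have sub_U: "submodule M U" unfolding U_def by (rule joint_kernel_submodule[OF fin wt])
  define E where "E = {w \<in> joint_kernel F. nil D w \<in> U}"
  have sub_E: "submodule M E"
    unfolding E_def by (rule submodule_vimage[OF nil_endo[OF D_wt] sub_F sub_U])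
  have U0: "0 \<in> U" by (rule cvec.subspace_0[OF submoduleD(1)[OF sub_U]])
  have U_E: "U \<subseteq> E"
  proof
    fix w assume "w \<in> U"
    then have "w \<in> joint_kernel F" "nil D w = 0" using U_eq by auto
    then show "w \<in> E" using U0 by (simp add: E_def)
  qed
  have kernel: "nil D w = 0 \<longleftrightarrow> w \<in> U" if "w \<in> E" for w
    using that U_eq by (auto simp: E_def)
  \<comment> \<open>By local nilpotency \<open>E\<close> is strictly larger than \<open>U\<close>.\<close>
  have "\<exists>w\<in>E. nil D w \<noteq> 0"
  proof -
    interpret D: spectral_operator S D by (rule weight_operator_spectral[OF D_wt])
    obtain w where w: "w \<in> joint_kernel F" "nil D w \<noteq> 0" using U_eq FD(2) by blast
    have wS: "w \<in> S" using w(1) by (simp add: joint_kernel_def)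
    have "invariant_subspace (nil D) (joint_kernel F)"
      unfolding invariant_subspace_def
      using submoduleD(1,2)[OF sub_F] D.nil_part_invariant[OF submodule_weight_invariant[OF sub_F D_wt]]
      by blast
    then have pow_F: "(nil D ^^ n) w \<in> joint_kernel F" for n
      using w(1) by (induction n) (auto simp: invariant_subspace_def)
    define n where "n = (LEAST n. (nil D ^^ n) w = 0)"
    have n: "(nil D ^^ n) w = 0"
      unfolding n_def using D.nil_part_locally_nilpotent[OF wS] by (rule LeastI_ex)
    have least: "(nil D ^^ m) w \<noteq> 0" if "m < n" for m
      using not_less_Least that unfolding n_def by blast
    have zero: "nil D 0 = 0" by (rule clinear_on_zero[OF S_subspace D.nil_part_linear])
    have "w \<noteq> 0" using w(2) zero by metis
    then have "n \<noteq> 0" "n \<noteq> 1" using n w(2) by (auto intro: gr0I)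
    then obtain m where m: "n = Suc (Suc m)" by (metis One_nat_def not0_implies_Suc)
    have "nil D (nil D ((nil D ^^ m) w)) = 0" using n by (simp add: m)
    moreover have "nil D ((nil D ^^ m) w) \<in> joint_kernel F" using pow_F[of "Suc m"] by simp
    ultimately have "nil D ((nil D ^^ m) w) \<in> U" using U_eq by blast
    then have "(nil D ^^ m) w \<in> E" using pow_F by (simp add: E_def)
    moreover have "nil D ((nil D ^^ m) w) \<noteq> 0" using least[of "Suc m"] by (simp add: m)
    ultimately show ?thesis by blast
  qed
  then have image: "nil D ` E \<noteq> {0}" by blast
  have sub_T: "submodule M (nil D ` E)" by (rule submodule_image[OF nil_endo[OF D_wt] sub_E])
  have T_U: "nil D ` E \<subseteq> U" unfolding E_def by blast
  have KL_fin: "restrict_mod M K \<in> KL_fin g \<hh> B k V \<iota>" if "submodule M K" "K \<subseteq> U" for K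
    using restrict_KL_fin[OF Y that(1)] that(2) unfolding U_def \<D>_def .
  obtain \<N> where \<N>: "\<And>K. K \<in> \<N> \<Longrightarrow> simple_submodule K \<and> K \<subseteq> nil D ` E" "nil D ` E = cvec.span (\<Union>\<N>)"
    using simple_decomposition[OF ss sub_T KL_fin[OF sub_T T_U]] by metis
  have "\<N> \<noteq> {}" using image \<N>(2) by auto
  then obtain N where N: "simple_submodule N" "N \<subseteq> nil D ` E" using \<N>(1) by blast
  note sub_N = simple_submoduleD(1)[OF N(1)]
  obtain \<K> where \<K>: "\<And>K. K \<in> \<K> \<Longrightarrow> simple_submodule K \<and> K \<subseteq> U" "U = cvec.span (\<Union>\<K>)"
    using simple_decomposition[OF ss sub_U KL_fin[OF sub_U order_refl]] by metis
  have simple: "simple_submodule K" if "K \<in> \<K>" for K using \<K>(1) that by blast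
  have NU: "N \<subseteq> U" using N(2) T_U by blast
  obtain N' where N': "submodule M N'" "N' \<subseteq> U" "N \<inter> N' = {0}" "U = {x + y |x y. x \<in> N \<and> y \<in> N'}"
    by (rule complement_exists[OF simple \<K>(2) sub_U sub_N NU])
  interpret extension_situation g B k V \<iota> M \<hh> U N N' E D
  proof unfold_locales
    show "Ext1 g (top_of N) (top_of N) = {Ext1_zero g (top_of N) (top_of N)}"
      using restrict_KL[OF sub_N] N(1) unfolding simple_submodule_def by (intro ext) blast+
    show "nil L w = 0" if "w \<in> U" for w using that by (simp add: U_def \<D>_def joint_kernel_def)
  qed (fact sub_N N' D_wt sub_E U_E kernel N)+
  show False by (rule no_extension_situation)
qed

theorem theorem5p5:
  fixes g :: "'g::complex_vector lie_sa"
    and \<hh> :: "'g set"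
    and P :: "('g \<Rightarrow> complex) set"
    and \<theta> :: "'g \<Rightarrow> complex"
    and B :: "'g \<Rightarrow> 'g \<Rightarrow> complex"
    and k :: complex
    and V :: "'v::complex_vector vertex_sa"
    and \<iota> :: "'g \<Rightarrow> 'v"
  assumes "basic_lie_superalgebra g"
    and "cartan_subalgebra g \<hh>"
    and "positive_system g \<hh> P"
    and "maximal_even_root g \<hh> P \<theta>"
    and "basic_form g B"
    and "dual_form B \<hh> \<theta> \<theta> = 2"
    and "k \<noteq> - dual_coxeter g B"
    and "simple_affine_vertex_algebra g B k V \<iota>"
    and "semisimple_category (KL_fin g \<hh> B k V \<iota> :: ('v, 'm::complex_vector) vmod set)"
    and "\<And>M :: ('v, 'm) vmod. M \<in> KL g B k V \<iota> \<Longrightarrow> irreducible_mod M \<Longrightarrow>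
           Ext1 g (top_component g B k V \<iota> M) (top_component g B k V \<iota> M) =
             {Ext1_zero g (top_component g B k V \<iota> M) (top_component g B k V \<iota> M)}"
  shows "semisimple_category (KL g B k V \<iota> :: ('v, 'm) vmod set) \<and>
         (KL_fin g \<hh> B k V \<iota> :: ('v, 'm) vmod set) = KL g B k V \<iota>"
proof -
  have toral: "toral g \<hh>" using assms(2) by (simp add: cartan_subalgebra_def)
  have "fin_dim \<hh>"
    using assms(1) toral fin_dim_subspace[of UNIV \<hh>]
    by (auto simp: basic_lie_superalgebra_def toral_def)
  then obtain Y where Y: "finite Y" "\<hh> = cvec.span Y" by (auto simp: fin_dim_def)
  have "M \<in> KL_fin g \<hh> B k V \<iota>" if M: "M \<in> KL g B k V \<iota>" for M :: "('v, 'm) vmod"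
  proof -
    interpret affine_algebra g B k V \<iota> by unfold_locales (fact assms)+
    interpret KL_object g B k V \<iota> M \<hh>
      using M toral va by unfold_locales (simp_all add: KL_def)
    have "restrict_mod M S \<in> KL_fin g \<hh> B k V \<iota>"
      by (rule restrict_KL_fin[OF Y submodule_carrier])
        (simp add: joint_kernel_eq_carrier[OF Y assms(9,10)])
    then show ?thesis by (simp add: restrict_mod_carrier)
  qed
  then have "(KL_fin g \<hh> B k V \<iota> :: ('v, 'm) vmod set) = KL g B k V \<iota>"
    unfolding KL_fin_def by blast
  then show ?thesis using assms(9) by simp
qed

end
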